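(* Suppose the rewards are Markovian, i.e. generated by $K$ independent stationary (hidden) Markov chains as described in the context, and that the following hold. (C1) For $1\le k\le K$ there exists a non-trivial measure $\lambda_k$ on $(\mathcal X,\mathcal A)$ such that $P_k(x,A)\ge\lambda_k(A)$ for all $x\in\mathcal X$, $A\in\mathcal A$. (C2) For any $\epsilon>0$ there exist $b=b_\epsilon>0$ and $Q=Q_\epsilon>0$ such that for $1\le k\le K$ and $t\ge1$, $P(|\bar Y_{kt}-\mu_k|\ge\epsilon)\le Qe^{-tb}$. (C3) For $k$ such that $\mu_k<\mu_*$ and $\ell$ such that $\mu_\ell=\mu_*$, there exist $b_1>0$, $Q_1>0$ and $t_1\ge1$ such that for all $\omega\le\mu_k$ and $t\ge t_1$, $P(\bar Y_{\ell t}<\omega)\le Q_1e^{-tb_1}P(\bar Y_{kt}<\omega)$. Then the arm allocation procedure SSMC achieves $En_k^r=O(\log r)$ as $r\to\infty$ for every $k\notin\Xi$, and hence $R_N=O(\log N)$ as $N\to\infty$.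
   Context: There are $K\ge 2$ arms $\Pi_1,\dots,\Pi_K$. For $1\le k\le K$, $X_{k1},X_{k2},\dots$ is a (potentially unobserved) stationary Markov chain on a measurable space $(\mathcal X,\mathcal A)$ with transition kernel $P_k(x,A)=P(X_{kt}\in A\mid X_{k,t-1}=x)$; the $K$ Markov chains are independent. The real-valued rewards $Y_{k1},Y_{k2},\dots$ of $\Pi_k$ are conditionally independent given $(X_{kt})_{t\ge1}$, with conditional densities $f_k(\cdot|x)$, $x\in\mathcal X$, with respect to some measure $\nu$: $P(Y_{kt}\in B\mid X_{k1}=x_1,X_{k2}=x_2,\dots)=\int_Bf_k(y|x_t)\,\nu(dy)$. Let $\mu_k=EY_{kt}$, $\mu_*=\max_k\mu_k$, $\Xi=\{\ell:\mu_\ell=\mu_*\}$ (optimal arms), $\bar Y_{k,t:u}=\frac{1}{u-t+1}\sum_{v=t}^uY_{kv}$ and $\bar Y_{kt}=\bar Y_{k,1:t}$. Sampling proceeds in rounds $r=1,2,\dots$. At the beginning of round $r$, $n_k=n_k^r$ is the number of observations taken so far from $\Pi_k$ and $n=n^r=\sum_kn_k^r$ (so $n_k^1=0$ and $n_k^2=1$); the $j$-th observation taken from $\Pi_k$ is $Y_{kj}$. The threshold $c_n$ is a non-negative monotone increasing sequence with $c_n=o(\log n)$ and $c_n/\log\log n\to\infty$ as $n\to\infty$. SSMC (subsample-mean comparison): In round 1, sample each arm exactly once. In round $r\ge2$: (a) the leader $\zeta=\zeta^r$ is the arm with the most observations, ties being resolved (in order) by larger sample mean, then by being the leader of the previous round,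 then by uniform randomization. (b) For every $k\ne\zeta$ there is a challenge between $\Pi_\zeta$ and $\Pi_k$: (i) if $n_k=n_\zeta$ then $\Pi_k$ loses; (ii) if $n_k<n_\zeta$ and $n_k<c_n$ then $\Pi_k$ wins; (iii) if $c_n\le n_k<n_\zeta$ then $\Pi_k$ wins if and only if $\bar Y_{kn_k}\ge\bar Y_{\zeta,t:(t+n_k-1)}$ for some $1\le t\le n_\zeta-n_k+1$. (c) Each $\Pi_k$, $k\neq\zeta$, that wins its challenge is sampled once; $\Pi_\zeta$ is sampled once if it wins all its challenges, and is not sampled otherwise. For a total of $N$ observations, $N_k$ denotes the number taken from $\Pi_k$ ($N=\sum_kN_k$); if $n^r<N<n^{r+1}$ for some $r$, then $N-n^r$ arms are selected randomly from the $n^{r+1}-n^r$ arms to be sampled in round $r$, to make up exactly $N$ observations. The regret is $R_N=\sum_{k:\mu_k<\mu_*}(\mu_*-\mu_k)EN_k$. *)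

theory Defs
  imports "HOL-Probability.Probability" "HOL-Library.Landau_Symbols"
begin

section \<open>Hidden Markov rewards\<close>

text \<open>Arms are numbered 1, ..., K and time, observations and rounds are numbered from 1;
  \<open>X k t\<close> and \<open>Y k t\<close> are unconstrained at \<open>t = 0\<close>.\<close>

definition gen_algebra ::
    "'w measure \<Rightarrow> 's measure \<Rightarrow> 'i set \<Rightarrow> ('i \<Rightarrow> 'w \<Rightarrow> 's) \<Rightarrow> 'w measure" where
  "gen_algebra M S I Z = vimage_algebra (space M) (\<lambda>w. \<lambda>i\<in>I. Z i w) (PiM I (\<lambda>_. S))"

definition stationary_process :: "'w measure \<Rightarrow> 'x measure \<Rightarrow> (nat \<Rightarrow> 'w \<Rightarrow> 'x) \<Rightarrow> bool" where
  "stationary_process M S X \<longleftrightarrow>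
     distr M (PiM {1..} (\<lambda>_. S)) (\<lambda>w. \<lambda>t\<in>{1..}. X (Suc t) w) =
     distr M (PiM {1..} (\<lambda>_. S)) (\<lambda>w. \<lambda>t\<in>{1..}. X t w)"

definition markov_chain ::
    "'w measure \<Rightarrow> 'x measure \<Rightarrow> ('x \<Rightarrow> 'x measure) \<Rightarrow> (nat \<Rightarrow> 'w \<Rightarrow> 'x) \<Rightarrow> bool" where
  "markov_chain M S P X \<longleftrightarrow>
     P \<in> S \<rightarrow>\<^sub>M prob_algebra S \<and>
     (\<forall>t\<ge>1. X t \<in> M \<rightarrow>\<^sub>M S) \<and>
     (\<forall>t\<ge>1. \<forall>A\<in>sets S. AE w in M.
        real_cond_exp M (gen_algebra M S {1..t} X) (indicator {v \<in> space M. X (Suc t) v \<in> A}) w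
          = measure (P (X t w)) A)"

definition cond_indep_given ::
    "'w measure \<Rightarrow> 'w measure \<Rightarrow> 's measure \<Rightarrow> 'i set \<Rightarrow> ('i \<Rightarrow> 'w \<Rightarrow> 's) \<Rightarrow> bool" where
  "cond_indep_given M G S I Z \<longleftrightarrow>
     (\<forall>J B. finite J \<longrightarrow> J \<noteq> {} \<longrightarrow> J \<subseteq> I \<longrightarrow> (\<forall>j\<in>J. B j \<in> sets S) \<longrightarrow>
        (AE w in M.
           real_cond_exp M G (indicator {v \<in> space M. \<forall>j\<in>J. Z j v \<in> B j}) w =
           (\<Prod>j\<in>J. real_cond_exp M G (indicator {v \<in> space M. Z j v \<in> B j}) w)))"

text \<open>\<open>f x\<close> is a probability density with respect to \<open>\<nu>\<close> for every state \<open>x\<close>, and the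
  resulting family of reward distributions is a Markov kernel. Stating measurability in \<open>x\<close> for
  the kernel rather than for \<open>f\<close> makes it unnecessary to assume that \<open>\<nu>\<close> is sigma-finite.\<close>

definition conditional_density ::
    "'x measure \<Rightarrow> real measure \<Rightarrow> ('x \<Rightarrow> real \<Rightarrow> real) \<Rightarrow> bool" where
  "conditional_density S \<nu> f \<longleftrightarrow>
     (\<forall>x\<in>space S. f x \<in> borel_measurable \<nu> \<and> (\<forall>y. 0 \<le> f x y)) \<and>
     (\<lambda>x. density \<nu> (\<lambda>y. ennreal (f x y))) \<in> S \<rightarrow>\<^sub>M prob_algebra borel"

definition hidden_rewards ::
    "'w measure \<Rightarrow> 'x measure \<Rightarrow> real measure \<Rightarrow> ('x \<Rightarrow> real \<Rightarrow> real) \<Rightarrow>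
     (nat \<Rightarrow> 'w \<Rightarrow> 'x) \<Rightarrow> (nat \<Rightarrow> 'w \<Rightarrow> real) \<Rightarrow> bool" where
  "hidden_rewards M S \<nu> f X Y \<longleftrightarrow>
     (\<forall>t\<ge>1. Y t \<in> borel_measurable M) \<and>
     conditional_density S \<nu> f \<and>
     cond_indep_given M (gen_algebra M S {1..} X) borel {1..} Y \<and>
     (\<forall>t\<ge>1. \<forall>B\<in>sets borel. AE w in M.
        real_cond_exp M (gen_algebra M S {1..} X) (indicator {v \<in> space M. Y t v \<in> B}) w
          = (LINT y:B|\<nu>. f (X t w) y))"

section \<open>Subsample-mean comparison\<close>

text \<open>The procedure is a deterministic function of the reward table \<open>y\<close> (\<open>y k j\<close> is the
  \<open>j\<close>-th observation from arm \<open>k\<close>), the threshold \<open>c\<close>, and the outcomes of the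
  randomizations: \<open>\<tau> r A\<close> is the arm drawn from the set \<open>A\<close> of still tied arms in
  round \<open>r\<close>.\<close>

definition block_mean :: "(nat \<Rightarrow> nat \<Rightarrow> real) \<Rightarrow> nat \<Rightarrow> nat \<Rightarrow> nat \<Rightarrow> real" where
  "block_mean y k t u = (\<Sum>v=t..u. y k v) / (real u - real t + 1)"

definition most_sampled :: "nat \<Rightarrow> (nat \<Rightarrow> nat) \<Rightarrow> nat set" where
  "most_sampled K n = {k \<in> {1..K}. \<forall>j\<in>{1..K}. n j \<le> n k}"

definition tied_arms :: "nat \<Rightarrow> (nat \<Rightarrow> nat \<Rightarrow> real) \<Rightarrow> (nat \<Rightarrow> nat) \<Rightarrow> nat set" where
  "tied_arms K y n =
     {k \<in> most_sampled K n. \<forall>j\<in>most_sampled K n. block_mean y j 1 (n j) \<le> block_mean y k 1 (n k)}"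

definition leader ::
    "nat \<Rightarrow> (nat \<Rightarrow> nat \<Rightarrow> real) \<Rightarrow> (nat set \<Rightarrow> nat) \<Rightarrow> (nat \<Rightarrow> nat) \<Rightarrow> nat option \<Rightarrow> nat" where
  "leader K y draw n prev =
     (case prev of
        Some z \<Rightarrow> if z \<in> tied_arms K y n then z else draw (tied_arms K y n)
      | None \<Rightarrow> draw (tied_arms K y n))"

definition challenger_wins ::
    "nat \<Rightarrow> (nat \<Rightarrow> real) \<Rightarrow> (nat \<Rightarrow> nat \<Rightarrow> real) \<Rightarrow> (nat \<Rightarrow> nat) \<Rightarrow> nat \<Rightarrow> nat \<Rightarrow> bool" where
  "challenger_wins K c y n z k \<longleftrightarrow>
     n k < n z \<and>
     (real (n k) < c (\<Sum>j=1..K. n j) \<or>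
      (\<exists>t\<in>{1..n z - n k + 1}. block_mean y k 1 (n k) \<ge> block_mean y z t (t + n k - 1)))"

definition sampled_arms ::
    "nat \<Rightarrow> (nat \<Rightarrow> real) \<Rightarrow> (nat \<Rightarrow> nat \<Rightarrow> real) \<Rightarrow> (nat \<Rightarrow> nat) \<Rightarrow> nat \<Rightarrow> nat set" where
  "sampled_arms K c y n z =
     (let W = {k \<in> {1..K}. k \<noteq> z \<and> challenger_wins K c y n z k}
      in if W = {} then {z} else W)"

text \<open>Given the counts and the leader of the previous round (round 1 has none), \<open>ssmc_round\<close>
  returns the arms sampled in round \<open>r\<close> and the leader of round \<open>r\<close>.\<close>

definition ssmc_round ::
    "nat \<Rightarrow> (nat \<Rightarrow> real) \<Rightarrow> (nat \<Rightarrow> nat \<Rightarrow> real) \<Rightarrow> (nat \<Rightarrow> nat set \<Rightarrow> nat) \<Rightarrow> nat \<Rightarrow>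
     (nat \<Rightarrow> nat) \<times> nat option \<Rightarrow> nat set \<times> nat option" where
  "ssmc_round K c y \<tau> r s =
     (if r = 1 then ({1..K}, None)
      else let z = leader K y (\<tau> r) (fst s) (snd s)
           in (sampled_arms K c y (fst s) z, Some z))"

text \<open>State after \<open>j\<close> completed rounds, that is, at the beginning of round \<open>j + 1\<close>.\<close>

primrec ssmc_state ::
    "nat \<Rightarrow> (nat \<Rightarrow> real) \<Rightarrow> (nat \<Rightarrow> nat \<Rightarrow> real) \<Rightarrow> (nat \<Rightarrow> nat set \<Rightarrow> nat) \<Rightarrow> nat \<Rightarrow>
     (nat \<Rightarrow> nat) \<times> nat option" where
  "ssmc_state K c y \<tau> 0 = (\<lambda>_. 0, None)"
| "ssmc_state K c y \<tau> (Suc j) =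
     (let s = ssmc_state K c y \<tau> j; (A, z) = ssmc_round K c y \<tau> (Suc j) s
      in (\<lambda>k. if k \<in> A then fst s k + 1 else fst s k, z))"

definition ssmc_count ::
    "nat \<Rightarrow> (nat \<Rightarrow> real) \<Rightarrow> (nat \<Rightarrow> nat \<Rightarrow> real) \<Rightarrow> (nat \<Rightarrow> nat set \<Rightarrow> nat) \<Rightarrow> nat \<Rightarrow> nat \<Rightarrow> nat" where
  "ssmc_count K c y \<tau> r k = fst (ssmc_state K c y \<tau> (r - 1)) k"

definition ssmc_total ::
    "nat \<Rightarrow> (nat \<Rightarrow> real) \<Rightarrow> (nat \<Rightarrow> nat \<Rightarrow> real) \<Rightarrow> (nat \<Rightarrow> nat set \<Rightarrow> nat) \<Rightarrow> nat \<Rightarrow> nat" where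
  "ssmc_total K c y \<tau> r = (\<Sum>k=1..K. ssmc_count K c y \<tau> r k)"

text \<open>Number of observations from arm \<open>k\<close> among the first \<open>N\<close>. The last round may be
  incomplete; \<open>\<sigma> N A m\<close> is the \<open>m\<close>-element subset drawn from the arms \<open>A\<close> to be
  sampled in that round. For \<open>N = n\<^sup>r\<close> the drawn subset is empty.\<close>

definition ssmc_alloc ::
    "nat \<Rightarrow> (nat \<Rightarrow> real) \<Rightarrow> (nat \<Rightarrow> nat \<Rightarrow> real) \<Rightarrow> (nat \<Rightarrow> nat set \<Rightarrow> nat) \<Rightarrow>
     (nat \<Rightarrow> nat set \<Rightarrow> nat \<Rightarrow> nat set) \<Rightarrow> nat \<Rightarrow> nat \<Rightarrow> nat" where
  "ssmc_alloc K c y \<tau> \<sigma> N k =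
     (let r = (THE r. 1 \<le> r \<and> ssmc_total K c y \<tau> r \<le> N \<and> N < ssmc_total K c y \<tau> (Suc r));
          A = fst (ssmc_round K c y \<tau> r (ssmc_state K c y \<tau> (r - 1)))
      in ssmc_count K c y \<tau> r k +
         (if k \<in> \<sigma> N A (N - ssmc_total K c y \<tau> r) then 1 else 0))"

section \<open>Randomization and independence\<close>

definition uniform_draws ::
    "'w measure \<Rightarrow> nat \<Rightarrow> (nat \<Rightarrow> nat set \<Rightarrow> 'w \<Rightarrow> nat) \<Rightarrow>
     (nat \<Rightarrow> nat set \<Rightarrow> nat \<Rightarrow> 'w \<Rightarrow> nat set) \<Rightarrow> bool" where
  "uniform_draws M K tie sel \<longleftrightarrow>
     (\<forall>r\<ge>2. \<forall>A. A \<subseteq> {1..K} \<longrightarrow> A \<noteq> {} \<longrightarrow>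
        tie r A \<in> M \<rightarrow>\<^sub>M count_space A \<and>
        distr M (count_space A) (tie r A) = uniform_count_measure A) \<and>
     (\<forall>N A m. A \<subseteq> {1..K} \<longrightarrow> m \<le> card A \<longrightarrow>
        sel N A m \<in> M \<rightarrow>\<^sub>M count_space {B. B \<subseteq> A \<and> card B = m} \<and>
        distr M (count_space {B. B \<subseteq> A \<and> card B = m}) (sel N A m) =
          uniform_count_measure {B. B \<subseteq> A \<and> card B = m})"

datatype source = Arm nat | Tie nat | Sel nat

fun source_events ::
    "'w measure \<Rightarrow> 'x measure \<Rightarrow> nat \<Rightarrow> (nat \<Rightarrow> nat \<Rightarrow> 'w \<Rightarrow> 'x) \<Rightarrow> (nat \<Rightarrow> nat \<Rightarrow> 'w \<Rightarrow> real) \<Rightarrow>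
     (nat \<Rightarrow> nat set \<Rightarrow> 'w \<Rightarrow> nat) \<Rightarrow> (nat \<Rightarrow> nat set \<Rightarrow> nat \<Rightarrow> 'w \<Rightarrow> nat set) \<Rightarrow>
     source \<Rightarrow> 'w set set" where
  "source_events M S K X Y tie sel (Arm k) =
     sets (gen_algebra M (S \<Otimes>\<^sub>M borel) {1..} (\<lambda>t w. (X k t w, Y k t w)))"
| "source_events M S K X Y tie sel (Tie r) =
     sets (gen_algebra M (count_space UNIV) {A. A \<subseteq> {1..K} \<and> A \<noteq> {}} (tie r))"
| "source_events M S K X Y tie sel (Sel N) =
     sets (gen_algebra M (count_space UNIV) {(A, m). A \<subseteq> {1..K} \<and> m \<le> card A}
       (\<lambda>(A, m). sel N A m))"

text \<open>The arms and all randomizations used up to observation number \<open>N\<close> are mutually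
  independent. Nothing is said about the joint law of the incomplete-round selections for
  different horizons \<open>N\<close>, which are never used together.\<close>

definition independent_sources ::
    "'w measure \<Rightarrow> 'x measure \<Rightarrow> nat \<Rightarrow> (nat \<Rightarrow> nat \<Rightarrow> 'w \<Rightarrow> 'x) \<Rightarrow> (nat \<Rightarrow> nat \<Rightarrow> 'w \<Rightarrow> real) \<Rightarrow>
     (nat \<Rightarrow> nat set \<Rightarrow> 'w \<Rightarrow> nat) \<Rightarrow> (nat \<Rightarrow> nat set \<Rightarrow> nat \<Rightarrow> 'w \<Rightarrow> nat set) \<Rightarrow> bool" where
  "independent_sources M S K X Y tie sel \<longleftrightarrow>
     (\<forall>N. prob_space.indep_sets M (source_events M S K X Y tie sel)
        (Arm ` {1..K} \<union> Tie ` {2..} \<union> {Sel N}))"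

section \<open>Random allocations and regret\<close>

definition round_count ::
    "nat \<Rightarrow> (nat \<Rightarrow> real) \<Rightarrow> (nat \<Rightarrow> nat \<Rightarrow> 'w \<Rightarrow> real) \<Rightarrow> (nat \<Rightarrow> nat set \<Rightarrow> 'w \<Rightarrow> nat) \<Rightarrow>
     nat \<Rightarrow> nat \<Rightarrow> 'w \<Rightarrow> nat" where
  "round_count K c Y tie r k w = ssmc_count K c (\<lambda>j t. Y j t w) (\<lambda>i A. tie i A w) r k"

definition horizon_count ::
    "nat \<Rightarrow> (nat \<Rightarrow> real) \<Rightarrow> (nat \<Rightarrow> nat \<Rightarrow> 'w \<Rightarrow> real) \<Rightarrow> (nat \<Rightarrow> nat set \<Rightarrow> 'w \<Rightarrow> nat) \<Rightarrow>
     (nat \<Rightarrow> nat set \<Rightarrow> nat \<Rightarrow> 'w \<Rightarrow> nat set) \<Rightarrow> nat \<Rightarrow> nat \<Rightarrow> 'w \<Rightarrow> nat" where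
  "horizon_count K c Y tie sel N k w =
     ssmc_alloc K c (\<lambda>j t. Y j t w) (\<lambda>i A. tie i A w) (\<lambda>i A m. sel i A m w) N k"

definition best_mean :: "nat \<Rightarrow> (nat \<Rightarrow> real) \<Rightarrow> real" where
  "best_mean K \<mu> = Max (\<mu> ` {1..K})"

definition optimal_arms :: "nat \<Rightarrow> (nat \<Rightarrow> real) \<Rightarrow> nat set" where
  "optimal_arms K \<mu> = {l \<in> {1..K}. \<mu> l = best_mean K \<mu>}"

definition regret ::
    "'w measure \<Rightarrow> nat \<Rightarrow> (nat \<Rightarrow> real) \<Rightarrow> (nat \<Rightarrow> real) \<Rightarrow> (nat \<Rightarrow> nat \<Rightarrow> 'w \<Rightarrow> real) \<Rightarrow>
     (nat \<Rightarrow> nat set \<Rightarrow> 'w \<Rightarrow> nat) \<Rightarrow> (nat \<Rightarrow> nat set \<Rightarrow> nat \<Rightarrow> 'w \<Rightarrow> nat set) \<Rightarrow> nat \<Rightarrow> real" where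
  "regret M K \<mu> c Y tie sel N =
     (\<Sum>k\<in>{k \<in> {1..K}. \<mu> k < best_mean K \<mu>}.
        (best_mean K \<mu> - \<mu> k) * (\<integral>w. real (horizon_count K c Y tie sel N k w) \<partial>M))"

end

theory Submission
  imports Defs "HOL-Real_Asymp.Real_Asymp"
begin

text \<open>By the minorization (C1), integrating against the transition kernel contracts the oscillation
  of a function by a fixed factor, so for a single arm, events about the past and events about a
  later block of rewards are nearly independent, with an error geometric in the gap.

  A leader in round \<open>u\<close> has at least \<open>u / K\<close> observations. By (C2) and a union bound, arms with
  at least \<open>D ln u\<close> observations are ranked correctly except on an event of probability
  \<open>O(u\<^sup>-\<^sup>3)\<close>. If an optimal arm with \<open>m\<close> observations, \<open>c\<^sub>u \<le> m < D ln u\<close>, loses against a suboptimal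
  leader, then its mean lies below all of roughly \<open>u / ln u\<close> nearly independent block means of the
  leader. Let \<open>x\<close> be a quantile of the block mean at level \<open>v\<close>, where \<open>v\<close> is of order
  \<open>(ln u)\<^sup>2 / u\<close>. All blocks exceed \<open>x\<close> with probability \<open>O(u\<^sup>-\<^sup>2)\<close>, and by (C3) the optimal mean is
  below \<open>x\<close> with probability \<open>O(e\<^sup>-\<^sup>b\<^sup>m v)\<close>; as \<open>c\<^sub>u\<close> dominates \<open>ln ln u\<close>, the sum over \<open>m\<close> is \<open>O(1 / u)\<close>.
  Applying (C3) requires \<open>x \<le> \<mu>\<^sub>k\<close>, that is, a lower bound for the probability that a block mean does
  not exceed its expectation.

  On a sample path, an optimal arm gains an observation and the maximal count stays constant in
  every round in which the leader is suboptimal, unless one of these exceptional events occurs.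
  Hence a suboptimal leader in round \<open>s\<close> forces a misranking, or a fixed fraction of lost
  challenges, in the rounds from \<open>s / 4\<close> to \<open>s\<close>, which has probability \<open>O(1 / s)\<close>.
  Summing over \<open>s \<le> r\<close> gives \<open>O(log r)\<close>; all other rounds that sample a suboptimal arm number \<open>O(log r)\<close> up to the same kind of exceptional event.\<close>

section \<open>The law of a hidden Markov chain\<close>

text \<open>The sample sizes in a challenge are random and depend on all rewards, whereas the
  probability bounds hold for fixed sizes. A union bound over the size m of the optimal arm bridges
  this. The size of the leader needs none: a loss against all windows of its sample is a loss
  against those within its first u / K observations. The union runs over O(ln u) sizes, so each may
  cost only O(1 / (u ln u)). The quantile level contributes (ln u)^2 / u, so the factor from (C3)
  has to be of order (ln u)^(-3), which an exponential in m >= c_u reaches at every rate because c_u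
  / ln ln u tends to infinity. From size D ln u on, (C2) makes errors polynomially small and all
  comparisons can be afforded at once. Lost challenges in different rounds are strongly dependent.
  Suboptimal leadership in round s is therefore bounded by Markov's inequality: each of about s
  rounds is exceptional with probability O(1 / s), so a fixed fraction of them is so with
  probability O(1 / s), whatever their joint law.\<close>

lemma measure_eqI_pair_rectangles:
  assumes sets: "sets P = sets (A \<Otimes>\<^sub>M B)" "sets Q = sets (A \<Otimes>\<^sub>M B)" and "finite_measure P"
    and eq: "\<And>a b. a \<in> sets A \<Longrightarrow> b \<in> sets B \<Longrightarrow> emeasure P (a \<times> b) = emeasure Q (a \<times> b)"
  shows "P = Q"
proof -
  interpret finite_measure P by fact
  show ?thesis
  proof (rule measure_eqI_generator_eq[OF Int_stable_pair_measure_generator[of A B],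
        where \<Omega>="space A \<times> space B" and A="\<lambda>_. space A \<times> space B"])
    show "{a \<times> b |a b. a \<in> sets A \<and> b \<in> sets B} \<subseteq> Pow (space A \<times> space B)"
      by (blast dest: sets.sets_into_space)
    show "range (\<lambda>_::nat. space A \<times> space B) \<subseteq> {a \<times> b |a b. a \<in> sets A \<and> b \<in> sets B}"
      by auto
    show "sets P = sigma_sets (space A \<times> space B) {a \<times> b |a b. a \<in> sets A \<and> b \<in> sets B}"
      "sets Q = sigma_sets (space A \<times> space B) {a \<times> b |a b. a \<in> sets A \<and> b \<in> sets B}"
      by (simp_all only: sets sets_pair_measure)
    show "emeasure P E = emeasure Q E" if "E \<in> {a \<times> b |a b. a \<in> sets A \<and> b \<in> sets B}" for E
      using that eq by blast
  qed simp_all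
qed

lemma space_gen_algebra [simp]: "space (gen_algebra M S I Z) = space M"
  by (simp add: gen_algebra_def)

lemma subalgebra_gen_algebra:
  assumes "\<And>i. i \<in> I \<Longrightarrow> Z i \<in> M \<rightarrow>\<^sub>M S"
  shows "subalgebra M (gen_algebra M S I Z)"
proof -
  have "(\<lambda>w. \<lambda>i\<in>I. Z i w) \<in> M \<rightarrow>\<^sub>M PiM I (\<lambda>_. S)"
    using assms by (intro measurable_restrict) auto
  then have "sets (gen_algebra M S I Z) \<subseteq> sets M"
    unfolding gen_algebra_def by (intro sets_image_in_sets) auto
  then show ?thesis by (simp add: subalgebra_def)
qed

lemma measurable_gen_algebra_component:
  assumes "\<And>i. i \<in> I \<Longrightarrow> Z i \<in> M \<rightarrow>\<^sub>M S" and "i \<in> I"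
  shows "Z i \<in> gen_algebra M S I Z \<rightarrow>\<^sub>M S"
proof -
  have "(\<lambda>w. \<lambda>i\<in>I. Z i w) \<in> gen_algebra M S I Z \<rightarrow>\<^sub>M PiM I (\<lambda>_. S)"
    unfolding gen_algebra_def using assms
    by (intro measurable_vimage_algebra1) (auto simp: space_PiM intro: measurable_space)
  then have "(\<lambda>w. (\<lambda>i\<in>I. Z i w) i) \<in> gen_algebra M S I Z \<rightarrow>\<^sub>M S"
    by (rule measurable_compose[OF _ measurable_component_singleton[OF assms(2)]])
  then show ?thesis using assms(2) by simp
qed

lemma nn_integral_le_one:
  assumes "prob_space N" "\<And>x. x \<in> space N \<Longrightarrow> g x \<le> (1::ennreal)"
  shows "(\<integral>\<^sup>+x. g x \<partial>N) \<le> 1"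
proof -
  interpret N: prob_space N by fact
  have "(\<integral>\<^sup>+x. g x \<partial>N) \<le> (\<integral>\<^sup>+x. 1 \<partial>N)" using assms(2) by (rule nn_integral_mono)
  then show ?thesis by (simp add: N.emeasure_space_1)
qed

section \<open>One arm: conditional laws of the rewards and of the next state\<close>

locale hidden_markov = prob_space M for M :: "'w measure" +
  fixes S :: "'x measure" and P :: "'x \<Rightarrow> 'x measure" and \<nu> :: "real measure"
    and f :: "'x \<Rightarrow> real \<Rightarrow> real" and X :: "nat \<Rightarrow> 'w \<Rightarrow> 'x" and Y :: "nat \<Rightarrow> 'w \<Rightarrow> real"
  assumes sets_nu: "sets \<nu> = sets borel"
    and chain: "markov_chain M S P X"
    and rewards: "hidden_rewards M S \<nu> f X Y"
begin

definition emission :: "'x \<Rightarrow> real measure" where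
  "emission x = density \<nu> (\<lambda>y. ennreal (f x y))"

lemma measurable_X [measurable]: "1 \<le> t \<Longrightarrow> X t \<in> M \<rightarrow>\<^sub>M S"
  and measurable_P [measurable]: "P \<in> S \<rightarrow>\<^sub>M prob_algebra S"
  using chain by (auto simp: markov_chain_def)

lemma measurable_Y [measurable]: "1 \<le> t \<Longrightarrow> Y t \<in> borel_measurable M"
  using rewards by (auto simp: hidden_rewards_def)

lemma measurable_emission [measurable]: "emission \<in> S \<rightarrow>\<^sub>M prob_algebra borel"
  using rewards unfolding hidden_rewards_def conditional_density_def emission_def[abs_def] by auto

lemma X_space: "1 \<le> t \<Longrightarrow> w \<in> space M \<Longrightarrow> X t w \<in> space S"
  using measurable_X measurable_space by metis

lemma emission_space: "x \<in> space S \<Longrightarrow> emission x \<in> space (prob_algebra borel)"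
  and P_space: "x \<in> space S \<Longrightarrow> P x \<in> space (prob_algebra S)"
  by (auto intro: measurable_space[OF measurable_emission] measurable_space[OF measurable_P])

lemma emission_prob: "x \<in> space S \<Longrightarrow> prob_space (emission x)"
  and P_prob: "x \<in> space S \<Longrightarrow> prob_space (P x)"
  and sets_emission: "x \<in> space S \<Longrightarrow> sets (emission x) = sets borel"
  and sets_P: "x \<in> space S \<Longrightarrow> sets (P x) = sets S"
  using emission_space P_space by (auto simp: space_prob_algebra)

lemma measure_emission:
  assumes x: "x \<in> space S" and B: "B \<in> sets borel"
  shows "measure (emission x) B = (LINT y:B|\<nu>. f x y)"
proof -
  have f: "f x \<in> borel_measurable \<nu>" "\<And>y. 0 \<le> f x y"
    using rewards x by (auto simp: hidden_rewards_def conditional_density_def)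
  have B': "B \<in> sets \<nu>" using B sets_nu by simp
  have "emeasure (emission x) B = (\<integral>\<^sup>+y. ennreal (f x y * indicator B y) \<partial>\<nu>)"
    using f B' by (auto simp: emission_def emeasure_density intro!: nn_integral_cong split: split_indicator)
  then have "measure (emission x) B = (\<integral>y. f x y * indicator B y \<partial>\<nu>)"
    using f B' by (subst integral_eq_nn_integral) (auto simp: measure_def)
  then show ?thesis
    by (simp add: set_lebesgue_integral_def mult.commute)
qed

lemma sets_reward_rectangle:
  assumes J: "finite J" "J \<subseteq> {1..}" and B: "\<And>j. j \<in> J \<Longrightarrow> B j \<in> sets borel"
  shows "{v \<in> space M. \<forall>j\<in>J. Y j v \<in> B j} \<in> sets M"
proof (rule sets.sets_Collect_finite_All[OF _ J(1)])
  fix j assume "j \<in> J"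
  then have "Y j -` B j \<inter> space M \<in> sets M"
    using J(2) B by (intro measurable_sets[OF measurable_Y]) auto
  then show "{v \<in> space M. Y j v \<in> B j} \<in> sets M"
    by (simp add: vimage_def Int_def conj_commute)
qed

abbreviation G where "G \<equiv> gen_algebra M S {1..} X"

lemma subalg_G: "subalgebra M G"
  by (intro subalgebra_gen_algebra) auto

sublocale G: finite_measure_subalgebra M G
  using subalg_G by unfold_locales

lemma X_G: "1 \<le> t \<Longrightarrow> X t \<in> G \<rightarrow>\<^sub>M S"
  by (intro measurable_gen_algebra_component) auto

lemma measurable_emission_prob [measurable]:
  "B \<in> sets borel \<Longrightarrow> (\<lambda>x. measure (emission x) B) \<in> borel_measurable S"
  by (rule measurable_compose[OF measurable_prob_algebraD[OF measurable_emission]]) simp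

lemma measurable_P_prob [measurable]:
  "A \<in> sets S \<Longrightarrow> (\<lambda>x. measure (P x) A) \<in> borel_measurable S"
  by (rule measurable_compose[OF measurable_prob_algebraD[OF measurable_P]]) simp

lemma cond_exp_rewards:
  assumes J: "finite J" "J \<noteq> {}" "J \<subseteq> {1..}" and B: "\<And>j. j \<in> J \<Longrightarrow> B j \<in> sets borel"
  shows "AE w in M. real_cond_exp M G (indicator {v \<in> space M. \<forall>j\<in>J. Y j v \<in> B j}) w
     = (\<Prod>j\<in>J. measure (emission (X j w)) (B j))"
proof -
  have "cond_indep_given M G borel {1..} Y"
    using rewards by (simp add: hidden_rewards_def)
  then have "AE w in M. real_cond_exp M G (indicator {v \<in> space M. \<forall>j\<in>J. Y j v \<in> B j}) w =
      (\<Prod>j\<in>J. real_cond_exp M G (indicator {v \<in> space M. Y j v \<in> B j}) w)"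
    unfolding cond_indep_given_def using J B by (elim allE[of _ J] allE[of _ B]) auto
  moreover have "AE w in M. \<forall>j\<in>J.
      real_cond_exp M G (indicator {v \<in> space M. Y j v \<in> B j}) w = (LINT y:B j|\<nu>. f (X j w) y)"
  proof (rule AE_finite_allI[OF J(1)])
    fix j assume "j \<in> J"
    then have "1 \<le> j" "B j \<in> sets borel" using J B by auto
    then show "AE w in M. real_cond_exp M G (indicator {v \<in> space M. Y j v \<in> B j}) w
        = (LINT y:B j|\<nu>. f (X j w) y)"
      using rewards by (simp add: hidden_rewards_def)
  qed
  ultimately show ?thesis
    using AE_space
  proof eventually_elim
    case (elim w)
    have "measure (emission (X j w)) (B j) = (LINT y:B j|\<nu>. f (X j w) y)" if "j \<in> J" for j
      using that elim J B by (intro measure_emission X_space) auto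
    then show ?case using elim by simp
  qed
qed

text \<open>The weight \<open>h\<close> depends on the hidden trajectory only, so it can be pulled
  out of the conditional expectation, which is a product of emission probabilities. The identity is
  used in both directions: to replace rewards by emissions and to restore them.\<close>

lemma integral_rewards:
  assumes J: "finite J" "J \<subseteq> {1..}" and B: "\<And>j. j \<in> J \<Longrightarrow> B j \<in> sets borel"
    and h: "h \<in> borel_measurable G" "\<And>w. w \<in> space M \<Longrightarrow> \<bar>h w\<bar> \<le> 1"
  shows "(\<integral>w. h w * indicator {v \<in> space M. \<forall>j\<in>J. Y j v \<in> B j} w \<partial>M)
       = (\<integral>w. h w * (\<Prod>j\<in>J. measure (emission (X j w)) (B j)) \<partial>M)"
proof (cases "J = {}")
  case True
  then show ?thesis by (auto intro!: Bochner_Integration.integral_cong)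
next
  case False
  let ?E = "{v \<in> space M. \<forall>j\<in>J. Y j v \<in> B j}"
  have E: "?E \<in> sets M" using J B by (rule sets_reward_rectangle)
  have ce: "AE w in M. real_cond_exp M G (indicator ?E) w = (\<Prod>j\<in>J. measure (emission (X j w)) (B j))"
    using B by (rule cond_exp_rewards[OF J(1) False J(2)])
  have hM: "h \<in> borel_measurable M"
    using measurable_from_subalg[OF subalg_G] h by auto
  have "integrable M (\<lambda>w. h w * indicator ?E w)"
    using E hM h(2) by (intro integrable_const_bound[where B=1]) (auto simp: abs_mult split: split_indicator)
  then have "(\<integral>w. h w * indicator ?E w \<partial>M) = (\<integral>w. h w * real_cond_exp M G (indicator ?E) w \<partial>M)"
    using h E by (intro G.real_cond_exp_intg(2)[symmetric]) auto
  also have "\<dots> = (\<integral>w. h w * (\<Prod>j\<in>J. measure (emission (X j w)) (B j)) \<partial>M)"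
  proof (rule integral_cong_AE)
    show "(\<lambda>w. h w * (\<Prod>j\<in>J. measure (emission (X j w)) (B j))) \<in> borel_measurable M"
      using J B hM by (intro borel_measurable_times borel_measurable_prod
          measurable_compose[OF measurable_X measurable_emission_prob]) auto
      show "AE w in M. h w * real_cond_exp M G (indicator ?E) w
        = h w * (\<Prod>j\<in>J. measure (emission (X j w)) (B j))"
      using ce by eventually_elim simp
  qed (use hM in measurable)
  finally show ?thesis .
qed

lemma integral_markov:
  assumes s: "1 \<le> s" and A: "A \<in> sets S"
    and h: "h \<in> borel_measurable (gen_algebra M S {1..s} X)" "\<And>w. w \<in> space M \<Longrightarrow> \<bar>h w\<bar> \<le> 1"
  shows "(\<integral>w. h w * indicator A (X (Suc s) w) \<partial>M) = (\<integral>w. h w * measure (P (X s w)) A \<partial>M)"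
proof -
  let ?F = "gen_algebra M S {1..s} X"
  have sub: "subalgebra M ?F" by (intro subalgebra_gen_algebra) auto
  interpret F: finite_measure_subalgebra M ?F using sub by unfold_locales
  let ?E = "{v \<in> space M. X (Suc s) v \<in> A}"
  have E: "?E \<in> sets M" using A by measurable
  have hM: "h \<in> borel_measurable M" using measurable_from_subalg[OF sub] h by auto
  have "(\<integral>w. h w * indicator A (X (Suc s) w) \<partial>M) = (\<integral>w. h w * indicator ?E w \<partial>M)"
    by (auto intro!: Bochner_Integration.integral_cong split: split_indicator)
  also have "\<dots> = (\<integral>w. h w * real_cond_exp M ?F (indicator ?E) w \<partial>M)"
  proof (intro F.real_cond_exp_intg(2)[symmetric])
    show "integrable M (\<lambda>w. h w * indicator ?E w)"
      using E hM h(2) by (intro integrable_const_bound[where B=1]) (auto simp: abs_mult split: split_indicator)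
  qed (use h E in auto)
  also have "\<dots> = (\<integral>w. h w * measure (P (X s w)) A \<partial>M)"
  proof (rule integral_cong_AE)
    have "AE w in M. real_cond_exp M ?F (indicator ?E) w = measure (P (X s w)) A"
      using chain s A by (auto simp: markov_chain_def)
    then show "AE w in M. h w * real_cond_exp M ?F (indicator ?E) w = h w * measure (P (X s w)) A"
      by auto
    show "(\<lambda>w. h w * measure (P (X s w)) A) \<in> borel_measurable M"
      using s A hM by (intro borel_measurable_times measurable_compose[OF measurable_X measurable_P_prob]) auto
  qed (use hM in auto)
  finally show ?thesis .
qed

text \<open>The Markov property in \<open>markov_chain\<close> conditions on past states, not on
  past rewards. So all rewards are first integrated out given the trajectory, then the state at
  \<open>Suc s\<close> is integrated out, and finally the rewards before \<open>s\<close> are put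
  back.\<close>

lemma prob_rectangle:
  assumes s: "1 \<le> s" and B: "\<And>j. B j \<in> sets borel" and A: "A \<in> sets S"
  shows "prob {w \<in> space M. (\<forall>j\<in>{1..<Suc s}. Y j w \<in> B j) \<and> X (Suc s) w \<in> A} =
    (\<integral>w. indicator {w \<in> space M. \<forall>j\<in>{1..<s}. Y j w \<in> B j} w *
       (measure (emission (X s w)) (B s) * measure (P (X s w)) A) \<partial>M)"
proof -
  let ?E = "{w \<in> space M. \<forall>j\<in>{1..<Suc s}. Y j w \<in> B j}"
  let ?E' = "{w \<in> space M. \<forall>j\<in>{1..<s}. Y j w \<in> B j}"
  let ?p = "\<lambda>j w. measure (emission (X j w)) (B j)"
  have p1: "0 \<le> ?p j w \<and> ?p j w \<le> 1" if "1 \<le> j" "w \<in> space M" for j w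
    using emission_prob[OF X_space[OF that]] by (simp add: prob_space.prob_le_1)
  have q1: "0 \<le> measure (P (X s w)) A \<and> measure (P (X s w)) A \<le> 1" if "w \<in> space M" for w
    using P_prob[OF X_space[OF s that]] by (simp add: prob_space.prob_le_1)
  have "prob {w \<in> space M. (\<forall>j\<in>{1..<Suc s}. Y j w \<in> B j) \<and> X (Suc s) w \<in> A}
      = (\<integral>w. indicator {w \<in> space M. (\<forall>j\<in>{1..<Suc s}. Y j w \<in> B j) \<and> X (Suc s) w \<in> A} w \<partial>M)"
    by (subst Bochner_Integration.integral_indicator) (auto intro!: arg_cong[where f=prob])
  also have "\<dots> = (\<integral>w. indicator A (X (Suc s) w) * indicator ?E w \<partial>M)"
    by (rule Bochner_Integration.integral_cong) (auto split: split_indicator)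
  also have "\<dots> = (\<integral>w. indicator A (X (Suc s) w) * (\<Prod>j\<in>{1..<Suc s}. ?p j w) \<partial>M)"
  proof (rule integral_rewards)
    show "(\<lambda>w. indicator A (X (Suc s) w) :: real) \<in> borel_measurable G"
      using A by (intro measurable_compose[OF X_G]) auto
    show "\<bar>indicator A (X (Suc s) w) :: real\<bar> \<le> 1" for w
      by (simp add: indicator_def)
  qed (use B in auto)
  also have "\<dots> = (\<integral>w. (\<Prod>j\<in>{1..<Suc s}. ?p j w) * indicator A (X (Suc s) w) \<partial>M)"
    by (simp add: mult.commute)
  also have "\<dots> = (\<integral>w. (\<Prod>j\<in>{1..<Suc s}. ?p j w) * measure (P (X s w)) A \<partial>M)"
  proof (rule integral_markov[OF s A])
    show "(\<lambda>w. \<Prod>j\<in>{1..<Suc s}. ?p j w) \<in> borel_measurable (gen_algebra M S {1..s} X)"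
      using B by (intro borel_measurable_prod
          measurable_compose[OF measurable_gen_algebra_component measurable_emission_prob]) auto
    show "\<bar>\<Prod>j\<in>{1..<Suc s}. ?p j w\<bar> \<le> 1" if "w \<in> space M" for w
    proof -
      have "(\<Prod>j\<in>{1..<Suc s}. ?p j w) \<le> 1" using p1 that by (intro prod_le_1) auto
      moreover have "0 \<le> (\<Prod>j\<in>{1..<Suc s}. ?p j w)" by (intro prod_nonneg) auto
      ultimately show ?thesis by linarith
    qed
  qed
  also have "\<dots> = (\<integral>w. (?p s w * measure (P (X s w)) A) * (\<Prod>j\<in>{1..<s}. ?p j w) \<partial>M)"
    using s by (simp add: mult_ac atLeastLessThanSuc)
  also have "\<dots> = (\<integral>w. (?p s w * measure (P (X s w)) A) * indicator ?E' w \<partial>M)"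
  proof (rule integral_rewards[symmetric])
    show "(\<lambda>w. ?p s w * measure (P (X s w)) A) \<in> borel_measurable G"
      using s A B by (intro borel_measurable_times measurable_compose[OF X_G]) auto
    show "\<bar>?p s w * measure (P (X s w)) A\<bar> \<le> 1" if "w \<in> space M" for w
      using p1[OF s that] q1[OF that] by (simp add: abs_mult mult_le_one)
  qed (use B in auto)
  finally show ?thesis by (simp add: mult.commute)
qed

section \<open>The Markov chain formed by the reward history and the current state\<close>

definition past :: "nat \<Rightarrow> (nat \<Rightarrow> real) measure" where
  "past s = PiM {1..<s} (\<lambda>_. borel)"

lemma sets_past_rectangle: "(\<And>j. B j \<in> sets borel) \<Longrightarrow> PiE {1..<s} B \<in> sets (past s)"
  unfolding past_def by (intro sets_PiM_I_finite) auto

text \<open>The history stops before \<open>s\<close>. Reward \<open>s\<close> is then still to be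
  drawn from the state \<open>X s\<close>, which makes the pair \<open>(hist s, X s)\<close>
  Markov.\<close>

definition hist :: "nat \<Rightarrow> 'w \<Rightarrow> nat \<Rightarrow> real" where
  "hist s w = (\<lambda>j\<in>{1..<s}. Y j w)"

text \<open>Transition kernel of that pair: given the state, reward \<open>s\<close> and the next
  state are drawn independently.\<close>

definition advance :: "nat \<Rightarrow> (nat \<Rightarrow> real) \<times> 'x \<Rightarrow> ((nat \<Rightarrow> real) \<times> 'x) measure" where
  "advance s z = distr (emission (snd z) \<Otimes>\<^sub>M P (snd z)) (past (Suc s) \<Otimes>\<^sub>M S)
     (\<lambda>(y, x). ((fst z)(s := y), x))"

lemma measurable_hist [measurable]: "hist s \<in> M \<rightarrow>\<^sub>M past s"
  unfolding hist_def[abs_def] past_def by (intro measurable_restrict) auto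

lemma measurable_hist_state [measurable]:
  "1 \<le> s \<Longrightarrow> (\<lambda>w. (hist s w, X s w)) \<in> M \<rightarrow>\<^sub>M past s \<Otimes>\<^sub>M S"
  by measurable

lemma insert_last: "1 \<le> s \<Longrightarrow> {1..<Suc s} = insert s {1..<s}"
  by auto

lemma measurable_extend:
  assumes "1 \<le> s"
  shows "(\<lambda>(z, y, x). ((fst z)(s := y), x)) \<in> (past s \<Otimes>\<^sub>M S) \<Otimes>\<^sub>M (borel \<Otimes>\<^sub>M S) \<rightarrow>\<^sub>M past (Suc s) \<Otimes>\<^sub>M S"
proof -
  have "(\<lambda>(p, y). p(s := y)) \<in> past s \<Otimes>\<^sub>M borel \<rightarrow>\<^sub>M past (Suc s)"
    unfolding past_def insert_last[OF assms] by (rule measurable_add_dim)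
  then have "(\<lambda>v. (\<lambda>(p, y). p(s := y)) (fst (fst v), fst (snd v)))
      \<in> (past s \<Otimes>\<^sub>M S) \<Otimes>\<^sub>M (borel \<Otimes>\<^sub>M S) \<rightarrow>\<^sub>M past (Suc s)"
    by (rule measurable_compose_rev) measurable
  then show ?thesis
    by (simp add: case_prod_beta' measurable_Pair)
qed

lemma sets_emission_P: "x \<in> space S \<Longrightarrow> sets (emission x \<Otimes>\<^sub>M P x) = sets (borel \<Otimes>\<^sub>M S)"
  by (intro sets_pair_measure_cong sets_emission sets_P)

lemma measurable_extend_section:
  assumes "1 \<le> s" "z \<in> space (past s \<Otimes>\<^sub>M S)"
  shows "(\<lambda>(y, x). ((fst z)(s := y), x)) \<in> emission (snd z) \<Otimes>\<^sub>M P (snd z) \<rightarrow>\<^sub>M past (Suc s) \<Otimes>\<^sub>M S"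
proof -
  have "(\<lambda>v. (\<lambda>(z, y, x). ((fst z)(s := y), x)) (z, v)) \<in> borel \<Otimes>\<^sub>M S \<rightarrow>\<^sub>M past (Suc s) \<Otimes>\<^sub>M S"
    using assms by (intro measurable_compose[OF measurable_Pair1' measurable_extend])
  moreover have "snd z \<in> space S" using assms(2) by (auto simp: space_pair_measure)
  ultimately show ?thesis
    by (simp add: measurable_cong_sets[OF sets_emission_P refl] case_prod_beta')
qed

lemma measurable_advance:
  assumes "1 \<le> s"
  shows "advance s \<in> past s \<Otimes>\<^sub>M S \<rightarrow>\<^sub>M subprob_algebra (past (Suc s) \<Otimes>\<^sub>M S)"
  unfolding advance_def[abs_def]
proof (rule measurable_distr2)
  show "case_prod (\<lambda>z. \<lambda>(y, x). ((fst z)(s := y), x))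
      \<in> (past s \<Otimes>\<^sub>M S) \<Otimes>\<^sub>M (borel \<Otimes>\<^sub>M S) \<rightarrow>\<^sub>M past (Suc s) \<Otimes>\<^sub>M S"
    using measurable_extend[OF assms] by (simp add: case_prod_beta')
  show "(\<lambda>z. emission (snd z) \<Otimes>\<^sub>M P (snd z)) \<in> past s \<Otimes>\<^sub>M S \<rightarrow>\<^sub>M subprob_algebra (borel \<Otimes>\<^sub>M S)"
    by (intro measurable_pair_measure measurable_prob_algebraD) measurable
qed

lemma nn_integral_advance:
  assumes s: "1 \<le> s" and z: "z \<in> space (past s \<Otimes>\<^sub>M S)"
    and \<phi>: "\<phi> \<in> borel_measurable (past (Suc s) \<Otimes>\<^sub>M S)"
  shows "(\<integral>\<^sup>+v. \<phi> v \<partial>advance s z)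
    = (\<integral>\<^sup>+y. (\<integral>\<^sup>+x. \<phi> ((fst z)(s := y), x) \<partial>P (snd z)) \<partial>emission (snd z))"
proof -
  have x: "snd z \<in> space S" using z by (auto simp: space_pair_measure)
  interpret Q: prob_space "P (snd z)" using P_prob[OF x] .
  have "(\<integral>\<^sup>+v. \<phi> v \<partial>advance s z) = (\<integral>\<^sup>+v. \<phi> ((\<lambda>(y, x). ((fst z)(s := y), x)) v) \<partial>(emission (snd z) \<Otimes>\<^sub>M P (snd z)))"
    unfolding advance_def using \<phi> by (intro nn_integral_distr measurable_extend_section s z) simp
  also have "\<dots> = (\<integral>\<^sup>+y. (\<integral>\<^sup>+x. \<phi> ((fst z)(s := y), x) \<partial>P (snd z)) \<partial>emission (snd z))"
    using measurable_compose[OF measurable_extend_section[OF s z] \<phi>]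
    by (subst Q.nn_integral_fst[symmetric]) (auto simp: case_prod_beta')
  finally show ?thesis .
qed

lemma emeasure_advance_rectangle:
  assumes s: "1 \<le> s" and z: "z \<in> space (past s \<Otimes>\<^sub>M S)"
    and B: "\<And>j. B j \<in> sets borel" and A: "A \<in> sets S"
  shows "emeasure (advance s z) (PiE {1..<Suc s} B \<times> A)
    = indicator (PiE {1..<s} B) (fst z) * (emeasure (emission (snd z)) (B s) * emeasure (P (snd z)) A)"
proof -
  have x: "snd z \<in> space S" and p: "fst z \<in> extensional {1..<s}"
    using z by (auto simp: space_pair_measure past_def space_PiM PiE_def)
  interpret Q: prob_space "P (snd z)" using P_prob[OF x] .
  have R: "PiE {1..<Suc s} B \<times> A \<in> sets (past (Suc s) \<Otimes>\<^sub>M S)"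
    using A B by (intro pair_measureI sets_past_rectangle)
  have upd: "(fst z)(s := y) \<in> PiE {1..<Suc s} B \<longleftrightarrow> fst z \<in> PiE {1..<s} B \<and> y \<in> B s" for y
    using p s by (auto simp: PiE_iff extensional_def)
  have "emeasure (advance s z) (PiE {1..<Suc s} B \<times> A) = emeasure (emission (snd z) \<Otimes>\<^sub>M P (snd z))
      ((\<lambda>(y, x). ((fst z)(s := y), x)) -` (PiE {1..<Suc s} B \<times> A) \<inter> space (emission (snd z) \<Otimes>\<^sub>M P (snd z)))"
    unfolding advance_def by (rule emeasure_distr[OF measurable_extend_section[OF s z] R])
  also have "(\<lambda>(y, x). ((fst z)(s := y), x)) -` (PiE {1..<Suc s} B \<times> A) \<inter> space (emission (snd z) \<Otimes>\<^sub>M P (snd z))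
     = (if fst z \<in> PiE {1..<s} B then B s \<times> A else {})"
  proof -
    define C where "C = PiE {1..<Suc s} B"
    define C' where "C' = PiE {1..<s} B"
    have upd': "(fst z)(s := y) \<in> C \<longleftrightarrow> fst z \<in> C' \<and> y \<in> B s" for y
      unfolding C_def C'_def by (rule upd)
    have "(\<lambda>(y, x). ((fst z)(s := y), x)) -` (C \<times> A) \<inter> (UNIV \<times> space S)
        = (if fst z \<in> C' then B s \<times> A else {})"
      using sets.sets_into_space[OF A] by (auto simp: upd')
    then show ?thesis
      using sets_eq_imp_space_eq[OF sets_emission_P[OF x]]
      by (simp add: space_pair_measure C_def C'_def)
  qed
  also have "emeasure (emission (snd z) \<Otimes>\<^sub>M P (snd z)) \<dots>
     = indicator (PiE {1..<s} B) (fst z) * (emeasure (emission (snd z)) (B s) * emeasure (P (snd z)) A)"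
    using A B by (auto simp: Q.emeasure_pair_measure_Times sets_emission[OF x] sets_P[OF x])
  finally show ?thesis .
qed

text \<open>On rectangles both sides reduce to the integral in \<open>prob_rectangle\<close>.
  Uniqueness is applied twice, to the history coordinates for a fixed set of states and then to the
  pair of history and state.\<close>

lemma law_advance:
  assumes s: "1 \<le> s"
  shows "distr M (past (Suc s) \<Otimes>\<^sub>M S) (\<lambda>w. (hist (Suc s) w, X (Suc s) w))
    = Giry_Monad.bind (distr M (past s \<Otimes>\<^sub>M S) (\<lambda>w. (hist s w, X s w))) (advance s)"
    (is "?L = Giry_Monad.bind ?D _")
proof (rule measure_eqI_pair_rectangles)
  have ne: "space ?D \<noteq> {}"
    using not_empty measurable_space[OF measurable_hist_state[OF s]] by fastforce
  have adv: "advance s \<in> ?D \<rightarrow>\<^sub>M subprob_algebra (past (Suc s) \<Otimes>\<^sub>M S)"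
    using measurable_advance[OF s] by simp
  have sets_bind: "sets (Giry_Monad.bind ?D (advance s)) = sets (past (Suc s) \<Otimes>\<^sub>M S)"
    using ne by (intro sets_bind) (auto simp: advance_def)
  then show "sets (Giry_Monad.bind ?D (advance s)) = sets (past (Suc s) \<Otimes>\<^sub>M S)" .
  show "sets ?L = sets (past (Suc s) \<Otimes>\<^sub>M S)" by simp
  interpret L: prob_space ?L by (rule prob_space_distr) simp
  show "finite_measure ?L" by unfold_locales
  fix a A assume a: "a \<in> sets (past (Suc s))" and A: "A \<in> sets S"
  \<comment> \<open>for fixed \<open>A\<close> both sides are finite measures in \<open>a\<close>\<close>
  define L' where "L' = distr (density ?L (indicator (space (past (Suc s)) \<times> A))) (past (Suc s)) fst"
  define R' where "R' = distr (density (Giry_Monad.bind ?D (advance s)) (indicator (space (past (Suc s)) \<times> A))) (past (Suc s)) fst"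
  have eL: "emeasure L' b = emeasure ?L (b \<times> A)" and eR: "emeasure R' b = emeasure (Giry_Monad.bind ?D (advance s)) (b \<times> A)"
    if b: "b \<in> sets (past (Suc s))" for b
  proof -
    have "emeasure (distr (density N (indicator (space (past (Suc s)) \<times> A))) (past (Suc s)) fst) b
        = emeasure N (b \<times> A)" if N: "sets N = sets (past (Suc s) \<Otimes>\<^sub>M S)" for N
    proof -
      have sp: "space N = space (past (Suc s)) \<times> space S"
        using sets_eq_imp_space_eq[OF N] by (simp add: space_pair_measure)
      have f: "fst \<in> density N (indicator (space (past (Suc s)) \<times> A)) \<rightarrow>\<^sub>M past (Suc s)"
        by (simp add: measurable_cong_sets[OF N refl])
      have bs: "b \<times> space S \<in> sets N" and bA: "b \<times> A \<in> sets N"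
        and sA: "space (past (Suc s)) \<times> A \<in> sets N" using b A by (auto simp: N)
      have "fst -` b \<inter> space N = b \<times> space S"
        using sets.sets_into_space[OF b] by (auto simp: sp)
      then have "emeasure (distr (density N (indicator (space (past (Suc s)) \<times> A))) (past (Suc s)) fst) b
        = (\<integral>\<^sup>+v. indicator (space (past (Suc s)) \<times> A) v * indicator (b \<times> space S) v \<partial>N)"
        using bs sA by (simp add: emeasure_distr[OF f b] emeasure_density)
      also have "\<dots> = (\<integral>\<^sup>+v. indicator (b \<times> A) v \<partial>N)"
        using sets.sets_into_space[OF b] sets.sets_into_space[OF A]
        by (intro nn_integral_cong) (auto split: split_indicator)
      finally show ?thesis using bA by simp
    qed
    then show "emeasure L' b = emeasure ?L (b \<times> A)" "emeasure R' b = emeasure (Giry_Monad.bind ?D (advance s)) (b \<times> A)"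
      unfolding L'_def R'_def using sets_bind by simp_all
  qed
  have "L' = R'"
  proof (rule measure_eqI_PiM_finite)
    show "sets L' = sets (PiM {1..<Suc s} (\<lambda>_. borel))" "sets R' = sets (PiM {1..<Suc s} (\<lambda>_. borel))"
      by (simp_all add: L'_def R'_def past_def)
    show "range (\<lambda>_::nat. PiE {1..<Suc s} (\<lambda>_. UNIV)) \<subseteq> prod_algebra {1..<Suc s} (\<lambda>_. borel :: real measure)"
      by (auto intro!: prod_algebraI_finite)
    show "(\<Union>_::nat. PiE {1..<Suc s} (\<lambda>_. UNIV)) = space (PiM {1..<Suc s} (\<lambda>_. borel))"
      by (simp add: space_PiM)
    have "PiE {1..<Suc s} (\<lambda>_. UNIV) \<in> sets (past (Suc s))" by (intro sets_past_rectangle) auto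
    then show "emeasure L' (PiE {1..<Suc s} (\<lambda>_. UNIV)) \<noteq> \<infinity>" for i :: nat
      using L.emeasure_finite by (simp add: eL)
    fix B0 :: "nat \<Rightarrow> real set" assume B0: "\<And>i. i \<in> {1..<Suc s} \<Longrightarrow> B0 i \<in> sets borel"
    \<comment> \<open>\<open>PiE\<close> sees only the indices below \<open>Suc s\<close>; padding
      with \<open>UNIV\<close> makes every side Borel, as the rectangle lemmas require.\<close>
    define B where "B i = (if i \<in> {1..<Suc s} then B0 i else UNIV)" for i
    have B: "B i \<in> sets borel" for i using B0 by (simp add: B_def)
    have BB: "PiE {1..<Suc s} B0 = PiE {1..<Suc s} B" by (rule PiE_cong) (simp add: B_def)
    have R: "PiE {1..<Suc s} B \<in> sets (past (Suc s))" using B by (intro sets_past_rectangle)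
    let ?E' = "{w \<in> space M. \<forall>j\<in>{1..<s}. Y j w \<in> B j}"
    have E': "?E' \<in> sets M" using B by (intro sets_reward_rectangle) auto
    have "emeasure ?L (PiE {1..<Suc s} B \<times> A)
        = emeasure M ((\<lambda>w. (hist (Suc s) w, X (Suc s) w)) -` (PiE {1..<Suc s} B \<times> A) \<inter> space M)"
      using R A by (intro emeasure_distr) auto
    also have "(\<lambda>w. (hist (Suc s) w, X (Suc s) w)) -` (PiE {1..<Suc s} B \<times> A) \<inter> space M
        = {w \<in> space M. (\<forall>j\<in>{1..<Suc s}. Y j w \<in> B j) \<and> X (Suc s) w \<in> A}"
      by (auto simp: hist_def PiE_iff)
    also have "emeasure M \<dots> = ennreal (\<integral>w. indicator ?E' w *
        (measure (emission (X s w)) (B s) * measure (P (X s w)) A) \<partial>M)"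
      using prob_rectangle[OF s B A] by (simp add: emeasure_eq_measure)
    also have "\<dots> = (\<integral>\<^sup>+w. ennreal (indicator ?E' w *
        (measure (emission (X s w)) (B s) * measure (P (X s w)) A)) \<partial>M)"
    proof (rule nn_integral_eq_integral[symmetric], rule integrable_const_bound[where B=1])
      show "(\<lambda>w. indicator ?E' w * (measure (emission (X s w)) (B s) * measure (P (X s w)) A)) \<in> borel_measurable M"
        using E' s A B by (intro borel_measurable_times borel_measurable_indicator
            measurable_compose[OF measurable_X measurable_emission_prob]
            measurable_compose[OF measurable_X measurable_P_prob])
      show "AE w in M. norm (indicator ?E' w * (measure (emission (X s w)) (B s) * measure (P (X s w)) A)) \<le> 1"
      proof (rule AE_I2)
        fix w assume "w \<in> space M"
        then have "measure (emission (X s w)) (B s) \<le> 1" "measure (P (X s w)) A \<le> 1"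
          using X_space[OF s] by (auto intro: prob_space.prob_le_1 emission_prob P_prob)
        then show "norm (indicator ?E' w * (measure (emission (X s w)) (B s) * measure (P (X s w)) A)) \<le> 1"
          by (simp add: mult_le_one indicator_def)
      qed
    qed simp
    also have "\<dots> = (\<integral>\<^sup>+w. emeasure (advance s (hist s w, X s w)) (PiE {1..<Suc s} B \<times> A) \<partial>M)"
    proof (rule nn_integral_cong)
      fix w assume w: "w \<in> space M"
      interpret E: prob_space "emission (X s w)" by (rule emission_prob[OF X_space[OF s w]])
      interpret Q: prob_space "P (X s w)" by (rule P_prob[OF X_space[OF s w]])
      have "(hist s w, X s w) \<in> space (past s \<Otimes>\<^sub>M S)"
        using measurable_space[OF measurable_hist_state[OF s] w] .
      then have "emeasure (advance s (hist s w, X s w)) (PiE {1..<Suc s} B \<times> A)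
         = indicator (PiE {1..<s} B) (hist s w) * (emeasure (emission (X s w)) (B s) * emeasure (P (X s w)) A)"
        using emeasure_advance_rectangle[OF s _ B A] by simp
      also have "indicator (PiE {1..<s} B) (hist s w) = (indicator ?E' w :: ennreal)"
        using w by (auto simp: hist_def PiE_iff split: split_indicator)
      finally show "ennreal (indicator ?E' w * (measure (emission (X s w)) (B s) * measure (P (X s w)) A))
          = emeasure (advance s (hist s w, X s w)) (PiE {1..<Suc s} B \<times> A)"
        by (simp add: E.emeasure_eq_measure Q.emeasure_eq_measure ennreal_mult' ennreal_indicator)
    qed
    also have "\<dots> = (\<integral>\<^sup>+z. emeasure (advance s z) (PiE {1..<Suc s} B \<times> A) \<partial>?D)"
      using measurable_compose[OF measurable_advance[OF s]
          measurable_emeasure_subprob_algebra[OF pair_measureI[OF R A]]]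
      by (intro nn_integral_distr[symmetric] measurable_hist_state s) simp
    also have "\<dots> = emeasure (Giry_Monad.bind ?D (advance s)) (PiE {1..<Suc s} B \<times> A)"
      by (rule emeasure_bind[OF ne adv pair_measureI[OF R A], symmetric])
    finally show "emeasure L' (PiE {1..<Suc s} B0) = emeasure R' (PiE {1..<Suc s} B0)"
      by (simp only: BB eL[OF R] eR[OF R])
  qed simp
  then show "emeasure ?L (a \<times> A) = emeasure (Giry_Monad.bind ?D (advance s)) (a \<times> A)"
    using eL[OF a] eR[OF a] by simp
qed

lemma one_step:
  assumes s: "1 \<le> s" and \<phi>: "\<phi> \<in> borel_measurable (past (Suc s) \<Otimes>\<^sub>M S)"
  shows "(\<integral>\<^sup>+w. \<phi> (hist (Suc s) w, X (Suc s) w) \<partial>M)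
    = (\<integral>\<^sup>+w. \<integral>\<^sup>+y. \<integral>\<^sup>+x. \<phi> ((hist s w)(s := y), x) \<partial>P (X s w) \<partial>emission (X s w) \<partial>M)"
proof -
  let ?D = "distr M (past s \<Otimes>\<^sub>M S) (\<lambda>w. (hist s w, X s w))"
  have "(\<integral>\<^sup>+w. \<phi> (hist (Suc s) w, X (Suc s) w) \<partial>M)
      = (\<integral>\<^sup>+v. \<phi> v \<partial>distr M (past (Suc s) \<Otimes>\<^sub>M S) (\<lambda>w. (hist (Suc s) w, X (Suc s) w)))"
    using \<phi> by (intro nn_integral_distr[symmetric] measurable_hist_state) auto
  also have "\<dots> = (\<integral>\<^sup>+z. \<integral>\<^sup>+v. \<phi> v \<partial>advance s z \<partial>?D)"
    unfolding law_advance[OF s] using measurable_advance[OF s]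
    by (intro nn_integral_bind[OF \<phi>]) simp
  also have "\<dots> = (\<integral>\<^sup>+w. \<integral>\<^sup>+v. \<phi> v \<partial>advance s (hist s w, X s w) \<partial>M)"
    using measurable_compose[OF measurable_advance[OF s] nn_integral_measurable_subprob_algebra[OF \<phi>]]
    by (intro nn_integral_distr measurable_hist_state s) simp
  also have "\<dots> = (\<integral>\<^sup>+w. \<integral>\<^sup>+y. \<integral>\<^sup>+x. \<phi> ((hist s w)(s := y), x) \<partial>P (X s w) \<partial>emission (X s w) \<partial>M)"
    using measurable_space[OF measurable_hist_state[OF s]]
    by (intro nn_integral_cong) (simp add: nn_integral_advance[OF s _ \<phi>])
  finally show ?thesis .
qed

text \<open>Pulling back along \<open>cut\<close> turns an event about an early history into one
  about a later history, so that induction can move forward in time.\<close>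

definition cut :: "nat \<Rightarrow> (nat \<Rightarrow> real) \<Rightarrow> nat \<Rightarrow> real" where
  "cut r p = restrict p {1..<r}"

lemma measurable_cut: "r \<le> s \<Longrightarrow> cut r \<in> past s \<rightarrow>\<^sub>M past r"
  unfolding past_def cut_def[abs_def] by (intro measurable_restrict_subset) auto

lemma cut_hist: "r \<le> s \<Longrightarrow> cut r (hist s w) = hist r w"
  by (auto simp: hist_def cut_def restrict_def)

lemma cut_hist_upd: "cut s ((hist s w)(s := y)) = hist s w"
  by (auto simp: hist_def cut_def restrict_def)

lemma measurable_past_component [measurable]: "1 \<le> j \<Longrightarrow> j < s \<Longrightarrow> (\<lambda>p. p j) \<in> borel_measurable (past s)"
  unfolding past_def by (intro measurable_component_singleton) auto

text \<open>Probability that \<open>a\<close> plus the next \<open>m\<close> rewards falls into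
  \<open>B\<close> when the current state is \<open>x\<close>. The offset \<open>a\<close> closes
  the recursion, since it absorbs the reward just drawn.\<close>

primrec shifted_sum_law :: "real set \<Rightarrow> nat \<Rightarrow> real \<Rightarrow> 'x \<Rightarrow> ennreal" where
  "shifted_sum_law B 0 a x = indicator B a"
| "shifted_sum_law B (Suc m) a x =
     (\<integral>\<^sup>+y. \<integral>\<^sup>+x'. shifted_sum_law B m (a + y) x' \<partial>P x \<partial>emission x)"

lemma measurable_shifted_sum_law:
  assumes B [measurable]: "B \<in> sets borel"
  shows "(\<lambda>(a, x). shifted_sum_law B m a x) \<in> borel_measurable (borel \<Otimes>\<^sub>M S)"
proof (induction m)
  case 0
  then show ?case by simp
next
  case (Suc m)
  have inner: "(\<lambda>((a, x), y). \<integral>\<^sup>+x'. shifted_sum_law B m (a + y) x' \<partial>P x)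
      \<in> borel_measurable ((borel \<Otimes>\<^sub>M S) \<Otimes>\<^sub>M borel)"
  proof -
    have "(\<lambda>v. \<integral>\<^sup>+x'. shifted_sum_law B m (fst (fst v) + snd v) x' \<partial>P (snd (fst v)))
        \<in> borel_measurable ((borel \<Otimes>\<^sub>M S) \<Otimes>\<^sub>M borel)"
    proof (rule nn_integral_measurable_subprob_algebra2)
      show "(\<lambda>(v, x'). shifted_sum_law B m (fst (fst v) + snd v) x')
          \<in> borel_measurable (((borel \<Otimes>\<^sub>M S) \<Otimes>\<^sub>M borel) \<Otimes>\<^sub>M S)"
        using measurable_compose_rev[OF Suc, of "\<lambda>(v, x'). (fst (fst v) + snd v, x')"
            "((borel \<Otimes>\<^sub>M S) \<Otimes>\<^sub>M borel) \<Otimes>\<^sub>M S"]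
        by (simp add: case_prod_beta')
      show "(\<lambda>v. P (snd (fst v))) \<in> (borel \<Otimes>\<^sub>M S) \<Otimes>\<^sub>M borel \<rightarrow>\<^sub>M subprob_algebra S"
        by (intro measurable_prob_algebraD) measurable
    qed
    then show ?thesis by (simp add: case_prod_beta')
  qed
  have "(\<lambda>v. \<integral>\<^sup>+y. (\<integral>\<^sup>+x'. shifted_sum_law B m (fst v + y) x' \<partial>P (snd v)) \<partial>emission (snd v))
      \<in> borel_measurable (borel \<Otimes>\<^sub>M S)"
  proof (rule nn_integral_measurable_subprob_algebra2)
    show "(\<lambda>(v, y). \<integral>\<^sup>+x'. shifted_sum_law B m (fst v + y) x' \<partial>P (snd v))
        \<in> borel_measurable ((borel \<Otimes>\<^sub>M S) \<Otimes>\<^sub>M borel)"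
      using inner by (simp add: case_prod_beta')
    show "(\<lambda>v. emission (snd v)) \<in> borel \<Otimes>\<^sub>M S \<rightarrow>\<^sub>M subprob_algebra borel"
      by (intro measurable_prob_algebraD) measurable
  qed
  then show ?case by (simp add: case_prod_beta')
qed

lemma shifted_sum_law_le_one: "x \<in> space S \<Longrightarrow> shifted_sum_law B m a x \<le> 1"
proof (induction m arbitrary: a x)
  case (Suc m)
  have "space (P x) = space S" using sets_P[OF Suc.prems] by (rule sets_eq_imp_space_eq)
  with Suc show ?case
    by (auto intro!: nn_integral_le_one emission_prob P_prob)
qed (simp add: indicator_def)

text \<open>Each induction step moves the first reward of the block into the history and into the
  offset. Hence the start \<open>s\<close>, the past event \<open>C\<close> and the
  history-dependent offset \<open>a\<close> all vary in the induction.\<close>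

lemma nn_integral_shifted_sum_law:
  assumes B: "B \<in> sets borel" and s: "1 \<le> s" and C: "C \<in> sets (past s)" and a: "a \<in> borel_measurable (past s)"
  shows "(\<integral>\<^sup>+w. indicator C (hist s w) * shifted_sum_law B m (a (hist s w)) (X s w) \<partial>M)
    = (\<integral>\<^sup>+w. indicator C (hist s w) * indicator B (a (hist s w) + (\<Sum>j\<in>{s..<s+m}. Y j w)) \<partial>M)"
  using s C a
proof (induction m arbitrary: s C a)
  case 0
  then show ?case by simp
next
  case (Suc m)
  have r: "cut s \<in> past (Suc s) \<rightarrow>\<^sub>M past s" by (rule measurable_cut) simp
  define C' where "C' = cut s -` C \<inter> space (past (Suc s))"
  define a' where "a' p = a (cut s p) + p s" for p
  define \<phi> where "\<phi> = (\<lambda>(p, x). indicator C (cut s p) * shifted_sum_law B m (a' p) x)"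
  have a': "a' \<in> borel_measurable (past (Suc s))"
    unfolding a'_def using Suc.prems by (intro borel_measurable_add measurable_compose[OF r]) auto
  have C': "C' \<in> sets (past (Suc s))"
    unfolding C'_def using Suc.prems by (intro measurable_sets[OF r]) auto
  have "(\<lambda>z. indicator C (cut s (fst z)) :: ennreal) \<in> borel_measurable (past (Suc s) \<Otimes>\<^sub>M S)"
    using Suc.prems by (intro measurable_compose[OF measurable_fst] measurable_compose[OF r]) auto
  moreover have "(\<lambda>z. shifted_sum_law B m (a' (fst z)) (snd z)) \<in> borel_measurable (past (Suc s) \<Otimes>\<^sub>M S)"
    using measurable_compose_rev[OF measurable_shifted_sum_law[OF B], of "\<lambda>z. (a' (fst z), snd z)" "past (Suc s) \<Otimes>\<^sub>M S" m] a'
    by simp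
  ultimately have \<phi>: "\<phi> \<in> borel_measurable (past (Suc s) \<Otimes>\<^sub>M S)"
    unfolding \<phi>_def by (simp add: case_prod_beta')
  have hC: "indicator C' (hist (Suc s) w) = (indicator C (hist s w) :: ennreal)" if "w \<in> space M" for w
    using measurable_space[OF measurable_hist that, of "Suc s"]
    by (auto simp: C'_def cut_hist split: split_indicator)
  have ha: "a' (hist (Suc s) w) = a (hist s w) + Y s w" for w
    using Suc.prems(1) by (auto simp: a'_def cut_hist) (simp add: hist_def)
  have "(\<integral>\<^sup>+w. indicator C (hist s w) * shifted_sum_law B (Suc m) (a (hist s w)) (X s w) \<partial>M)
    = (\<integral>\<^sup>+w. \<integral>\<^sup>+y. \<integral>\<^sup>+x. \<phi> ((hist s w)(s := y), x) \<partial>P (X s w) \<partial>emission (X s w) \<partial>M)"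
    unfolding \<phi>_def prod.case cut_hist_upd a'_def
    by (intro nn_integral_cong) (auto split: split_indicator)
  also have "\<dots> = (\<integral>\<^sup>+w. \<phi> (hist (Suc s) w, X (Suc s) w) \<partial>M)"
    by (rule one_step[OF Suc.prems(1) \<phi>, symmetric])
  also have "\<dots> = (\<integral>\<^sup>+w. indicator C' (hist (Suc s) w) * shifted_sum_law B m (a' (hist (Suc s) w)) (X (Suc s) w) \<partial>M)"
    by (intro nn_integral_cong) (simp add: \<phi>_def hC cut_hist)
  also have "\<dots> = (\<integral>\<^sup>+w. indicator C' (hist (Suc s) w) *
      indicator B (a' (hist (Suc s) w) + (\<Sum>j\<in>{Suc s..<Suc s+m}. Y j w)) \<partial>M)"
    using a' C' by (intro Suc.IH) auto
  also have "\<dots> = (\<integral>\<^sup>+w. indicator C (hist s w) *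
      indicator B (a (hist s w) + (\<Sum>j\<in>{s..<s+Suc m}. Y j w)) \<partial>M)"
  proof (intro nn_integral_cong)
    fix w assume "w \<in> space M"
    moreover have "(\<Sum>j\<in>{s..<s+Suc m}. Y j w) = Y s w + (\<Sum>j\<in>{Suc s..<Suc s+m}. Y j w)"
      by (subst sum.atLeast_Suc_lessThan) auto
    ultimately show "indicator C' (hist (Suc s) w) *
      indicator B (a' (hist (Suc s) w) + (\<Sum>j\<in>{Suc s..<Suc s+m}. Y j w)) = (indicator C (hist s w) *
      indicator B (a (hist s w) + (\<Sum>j\<in>{s..<s+Suc m}. Y j w)) :: ennreal)"
      by (simp only: hC ha add.assoc)
  qed
  finally show ?case .
qed

text \<open>The Markov operator of the chain on functions. Its powers bridge gaps in which no reward
  is looked at.\<close>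

definition transition :: "('x \<Rightarrow> ennreal) \<Rightarrow> 'x \<Rightarrow> ennreal" where
  "transition q x = (\<integral>\<^sup>+x'. q x' \<partial>P x)"

lemma measurable_transition:
  "q \<in> borel_measurable S \<Longrightarrow> transition q \<in> borel_measurable S"
  unfolding transition_def[abs_def]
  by (intro measurable_compose[OF measurable_prob_algebraD[OF measurable_P] nn_integral_measurable_subprob_algebra])

lemma measurable_transition_pow:
  "q \<in> borel_measurable S \<Longrightarrow> (transition ^^ g) q \<in> borel_measurable S"
  by (induction g) (auto intro: measurable_transition)

lemma nn_integral_transition:
  assumes "1 \<le> s" and q: "q \<in> borel_measurable S" and "C \<in> sets (past s)"
  shows "(\<integral>\<^sup>+w. indicator C (hist s w) * q (X (s + g) w) \<partial>M)
    = (\<integral>\<^sup>+w. indicator C (hist s w) * (transition ^^ g) q (X s w) \<partial>M)"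
  using assms(1,3)
proof (induction g arbitrary: s C)
  case 0
  then show ?case by simp
next
  case (Suc g)
  have r: "cut s \<in> past (Suc s) \<rightarrow>\<^sub>M past s" by (rule measurable_cut) simp
  define C' where "C' = cut s -` C \<inter> space (past (Suc s))"
  define \<phi> where "\<phi> = (\<lambda>(p :: nat \<Rightarrow> real, x). indicator C (cut s p) * (transition ^^ g) q x)"
  have C': "C' \<in> sets (past (Suc s))"
    unfolding C'_def using Suc.prems by (intro measurable_sets[OF r]) auto
  have "(\<lambda>z. indicator C (cut s (fst z)) :: ennreal) \<in> borel_measurable (past (Suc s) \<Otimes>\<^sub>M S)"
    using Suc.prems by (intro measurable_compose[OF measurable_fst] measurable_compose[OF r]) auto
  moreover have "(\<lambda>z. (transition ^^ g) q (snd z)) \<in> borel_measurable (past (Suc s) \<Otimes>\<^sub>M S)"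
    by (intro measurable_compose[OF measurable_snd] measurable_transition_pow q)
  ultimately have \<phi>: "\<phi> \<in> borel_measurable (past (Suc s) \<Otimes>\<^sub>M S)"
    unfolding \<phi>_def by (simp add: case_prod_beta')
  have hC: "indicator C' (hist (Suc s) w) = (indicator C (hist s w) :: ennreal)" if "w \<in> space M" for w
    using measurable_space[OF measurable_hist that, of "Suc s"]
    by (auto simp: C'_def cut_hist split: split_indicator)
  have "(\<integral>\<^sup>+w. indicator C (hist s w) * q (X (s + Suc g) w) \<partial>M)
      = (\<integral>\<^sup>+w. indicator C' (hist (Suc s) w) * q (X (Suc s + g) w) \<partial>M)"
    by (intro nn_integral_cong) (simp add: hC)
  also have "\<dots> = (\<integral>\<^sup>+w. indicator C' (hist (Suc s) w) * (transition ^^ g) q (X (Suc s) w) \<partial>M)"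
    using C' by (intro Suc.IH) auto
  also have "\<dots> = (\<integral>\<^sup>+w. \<phi> (hist (Suc s) w, X (Suc s) w) \<partial>M)"
    by (intro nn_integral_cong) (simp add: \<phi>_def hC cut_hist)
  also have "\<dots> = (\<integral>\<^sup>+w. \<integral>\<^sup>+y. \<integral>\<^sup>+x. \<phi> ((hist s w)(s := y), x) \<partial>P (X s w) \<partial>emission (X s w) \<partial>M)"
    by (rule one_step[OF Suc.prems(1) \<phi>])
  also have "\<dots> = (\<integral>\<^sup>+w. indicator C (hist s w) * (transition ^^ Suc g) q (X s w) \<partial>M)"
  proof (intro nn_integral_cong)
    fix w assume w: "w \<in> space M"
    interpret E: prob_space "emission (X s w)" by (rule emission_prob[OF X_space[OF Suc.prems(1) w]])
    have "\<phi> ((hist s w)(s := y), x) = indicator C (hist s w) * (transition ^^ g) q x" for y x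
      unfolding \<phi>_def prod.case cut_hist_upd ..
    then show "(\<integral>\<^sup>+y. \<integral>\<^sup>+x. \<phi> ((hist s w)(s := y), x) \<partial>P (X s w) \<partial>emission (X s w))
        = indicator C (hist s w) * (transition ^^ Suc g) q (X s w)"
      by (auto simp: transition_def E.emeasure_space_1 split: split_indicator)
  qed
  finally show ?case .
qed

end

section \<open>Mixing\<close>

context hidden_markov
begin

definition block_event :: "real set \<Rightarrow> nat \<Rightarrow> nat \<Rightarrow> 'w set" where
  "block_event B s m = {w \<in> space M. (\<Sum>j\<in>{s..<s+m}. Y j w) \<in> B}"

definition past_event :: "nat \<Rightarrow> (nat \<Rightarrow> real) set \<Rightarrow> 'w set" where
  "past_event s C = {w \<in> space M. hist s w \<in> C}"

lemma sets_block_event [measurable]: "1 \<le> s \<Longrightarrow> B \<in> sets borel \<Longrightarrow> block_event B s m \<in> sets M"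
proof -
  assume "1 \<le> s" and B: "B \<in> sets borel"
  then have "(\<lambda>w. \<Sum>j\<in>{s..<s+m}. Y j w) \<in> borel_measurable M"
    by (intro borel_measurable_sum measurable_Y) auto
  then show ?thesis unfolding block_event_def using B by measurable
qed

lemma sets_past_event [measurable]: "C \<in> sets (past s) \<Longrightarrow> past_event s C \<in> sets M"
  using measurable_sets[OF measurable_hist, of C s]
  by (simp add: past_event_def vimage_def Int_def conj_commute)

lemma measurable_sum_law:
  "B \<in> sets borel \<Longrightarrow> shifted_sum_law B m 0 \<in> borel_measurable S"
  using measurable_compose_rev[OF measurable_shifted_sum_law, of B "\<lambda>x. (0, x)" S m] by simp

text \<open>The past event is first read as an event of the history at \<open>s + g\<close>, where
  the probability of the block is a function of the state. The Markov operator then carries this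
  function back over the gap to the state at \<open>s\<close>.\<close>

lemma emeasure_past_block:
  assumes s: "1 \<le> s" and C: "C \<in> sets (past s)" and B: "B \<in> sets borel"
  shows "emeasure M (past_event s C \<inter> block_event B (s + g) m)
    = (\<integral>\<^sup>+w. indicator C (hist s w) * (transition ^^ g) (shifted_sum_law B m 0) (X s w) \<partial>M)"
proof -
  have c: "cut s \<in> past (s + g) \<rightarrow>\<^sub>M past s" by (rule measurable_cut) simp
  define C' where "C' = cut s -` C \<inter> space (past (s + g))"
  have C': "C' \<in> sets (past (s + g))" unfolding C'_def using c C by (rule measurable_sets)
  have hC: "indicator C' (hist (s + g) w) = (indicator C (hist s w) :: ennreal)" if "w \<in> space M" for w
    using measurable_space[OF measurable_hist that, of "s + g"]
    by (auto simp: C'_def cut_hist split: split_indicator)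
  have "emeasure M (past_event s C \<inter> block_event B (s + g) m)
     = (\<integral>\<^sup>+w. indicator (past_event s C \<inter> block_event B (s + g) m) w \<partial>M)"
    using s C B by (intro nn_integral_indicator[symmetric] sets.Int sets_past_event sets_block_event) auto
  also have "\<dots> = (\<integral>\<^sup>+w. indicator C' (hist (s + g) w) * indicator B (0 + (\<Sum>j\<in>{s + g..<s + g + m}. Y j w)) \<partial>M)"
    by (intro nn_integral_cong) (auto simp: hC past_event_def block_event_def split: split_indicator)
  also have "\<dots> = (\<integral>\<^sup>+w. indicator C' (hist (s + g) w) * shifted_sum_law B m 0 (X (s + g) w) \<partial>M)"
    using s B C' by (intro nn_integral_shifted_sum_law[where a="\<lambda>_. 0", symmetric]) auto
  also have "\<dots> = (\<integral>\<^sup>+w. indicator C (hist s w) * shifted_sum_law B m 0 (X (s + g) w) \<partial>M)"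
    by (intro nn_integral_cong) (simp add: hC)
  also have "\<dots> = (\<integral>\<^sup>+w. indicator C (hist s w) * (transition ^^ g) (shifted_sum_law B m 0) (X s w) \<partial>M)"
    by (intro nn_integral_transition s C measurable_sum_law B)
  finally show ?thesis .
qed

lemma past_event_space: "past_event s (space (past s)) = space M"
  using measurable_space[OF measurable_hist] by (auto simp: past_event_def)

lemma emeasure_block:
  assumes s: "1 \<le> s" and B: "B \<in> sets borel"
  shows "emeasure M (block_event B s m) = (\<integral>\<^sup>+w. shifted_sum_law B m 0 (X s w) \<partial>M)"
proof -
  have "block_event B s m \<subseteq> space M" by (auto simp: block_event_def)
  then have "emeasure M (block_event B s m) = emeasure M (past_event s (space (past s)) \<inter> block_event B (s + 0) m)"
    by (simp add: past_event_space Int_absorb1)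
  also have "\<dots> = (\<integral>\<^sup>+w. shifted_sum_law B m 0 (X s w) \<partial>M)"
    unfolding emeasure_past_block[OF s sets.top B]
    using measurable_space[OF measurable_hist] by (intro nn_integral_cong) simp
  finally show ?thesis .
qed

end

locale stationary_rewards = hidden_markov +
  assumes stationary: "stationary_process M S X"
    and minorization: "\<exists>\<Lambda>. sets \<Lambda> = sets S \<and> emeasure \<Lambda> (space S) \<noteq> 0 \<and>
        (\<forall>x\<in>space S. \<forall>A\<in>sets S. emeasure \<Lambda> A \<le> emeasure (P x) A)"
begin

lemma distr_X: "1 \<le> s \<Longrightarrow> distr M S (X s) = distr M S (X 1)"
proof (induction s rule: dec_induct)
  case (step t)
  let ?N = "PiM {1..} (\<lambda>_::nat. S)"
  have m1: "(\<lambda>w. \<lambda>t\<in>{1..}. X (Suc t) w) \<in> M \<rightarrow>\<^sub>M ?N" and m2: "(\<lambda>w. \<lambda>t\<in>{1..}. X t w) \<in> M \<rightarrow>\<^sub>M ?N"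
    by (intro measurable_restrict; simp)+
  have c: "(\<lambda>p. p t) \<in> ?N \<rightarrow>\<^sub>M S" using step by (intro measurable_component_singleton) auto
  have "distr (distr M ?N (\<lambda>w. \<lambda>t\<in>{1..}. X (Suc t) w)) S (\<lambda>p. p t)
      = distr (distr M ?N (\<lambda>w. \<lambda>t\<in>{1..}. X t w)) S (\<lambda>p. p t)"
    using stationary by (simp add: stationary_process_def)
  then have "distr M S (X (Suc t)) = distr M S (X t)"
    using step.hyps unfolding distr_distr[OF c m1] distr_distr[OF c m2] by (simp add: comp_def)
  with step show ?case by simp
qed simp

text \<open>The probability of a block is the integral of one fixed function against the law of the
  state at its start.\<close>

lemma prob_block_stationary:
  assumes s: "1 \<le> s" and B: "B \<in> sets borel"
  shows "prob (block_event B s m) = prob (block_event B 1 m)"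
proof -
  have "emeasure M (block_event B s m) = (\<integral>\<^sup>+x. shifted_sum_law B m 0 x \<partial>distr M S (X s))"
    if "1 \<le> s" for s
    using that measurable_sum_law[OF B] by (simp add: emeasure_block[OF that B] nn_integral_distr)
  from this[OF s] this[of 1] show ?thesis
    by (simp add: measure_def distr_X[OF s])
qed

text \<open>Doeblin's argument. The distance \<open>r\<close> of \<open>q\<close> from its lower
  bound and the distance \<open>r'\<close> from its upper bound are nonnegative, so their integrals
  against every \<open>P x\<close> are at least those against the minorizing measure,
  \<open>I\<close> and \<open>J\<close>. If \<open>l\<close> is the mass of that measure, then
  \<open>I + J = l * d\<close>. The new values thus lie between \<open>a + I\<close> and
  \<open>a + d - J\<close>, an interval of length \<open>(1 - l) * d\<close>.\<close>

lemma transition_contraction: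
  "\<exists>\<rho>. 0 \<le> \<rho> \<and> \<rho> < 1 \<and> (\<forall>q a d. q \<in> borel_measurable S \<longrightarrow> 0 \<le> a \<longrightarrow> 0 \<le> d \<longrightarrow>
     (\<forall>x\<in>space S. ennreal a \<le> q x \<and> q x \<le> ennreal (a + d)) \<longrightarrow>
     (\<exists>a'\<ge>0. \<forall>x\<in>space S. ennreal a' \<le> transition q x \<and> transition q x \<le> ennreal (a' + \<rho> * d)))"
proof -
  obtain \<Lambda> where L: "sets \<Lambda> = sets S" "emeasure \<Lambda> (space S) \<noteq> 0"
    and minor: "\<And>x A. x \<in> space S \<Longrightarrow> A \<in> sets S \<Longrightarrow> emeasure \<Lambda> A \<le> emeasure (P x) A"
    using minorization by auto
  have sp: "space \<Lambda> = space S" using L(1) by (rule sets_eq_imp_space_eq)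
  \<comment> \<open>Comparison with the probability measure at any one state shows that the
    minorizing mass is at most 1.\<close>
  obtain x0 where x0: "x0 \<in> space S" using not_empty X_space[of 1] by fastforce
  interpret Q0: prob_space "P x0" by (rule P_prob[OF x0])
  have "emeasure \<Lambda> (space S) \<le> emeasure (P x0) (space S)" using minor[OF x0] by auto
  also have "\<dots> \<le> 1" by (rule Q0.emeasure_le_1)
  finally have L1: "emeasure \<Lambda> (space S) \<le> 1" .
  define l where "l = enn2real (emeasure \<Lambda> (space S))"
  have l: "emeasure \<Lambda> (space S) = ennreal l" "0 < l" "l \<le> 1"
    using L(2) L1 unfolding l_def by (auto simp: enn2real_positive_iff less_top[symmetric] top_unique
        ennreal_enn2real_if zero_less_iff_neq_zero intro!: enn2real_leI le_less_trans[OF L1])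
  have "\<exists>a'\<ge>0. \<forall>x\<in>space S. ennreal a' \<le> transition q x \<and> transition q x \<le> ennreal (a' + (1 - l) * d)"
    if q: "q \<in> borel_measurable S" and a: "0 \<le> a" and d: "0 \<le> d"
      and bd: "\<And>x. x \<in> space S \<Longrightarrow> ennreal a \<le> q x \<and> q x \<le> ennreal (a + d)" for q a d
  proof -
    define r where "r x = q x - ennreal a" for x
    define r' where "r' x = ennreal d - r x" for x
    have m: "r \<in> borel_measurable S" "r' \<in> borel_measurable S"
      using q unfolding r_def[abs_def] r'_def[abs_def] by measurable
    have rd: "r x \<le> ennreal d" and q_eq: "q x = ennreal a + r x" and rr': "r x + r' x = ennreal d"
      if "x \<in> space S" for x
    proof -
      show q_eq: "q x = ennreal a + r x"
        using bd[OF that] unfolding r_def by (simp add: ennreal_diff_add_assoc add_diff_inverse_ennreal)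
      show "r x \<le> ennreal d"
        using bd[OF that] a d unfolding q_eq by (simp add: ennreal_plus ennreal_add_left_cancel_le)
      then show "r x + r' x = ennreal d" by (simp add: r'_def add_diff_inverse_ennreal)
    qed
    have mono: "(\<integral>\<^sup>+y. h y \<partial>\<Lambda>) \<le> (\<integral>\<^sup>+y. h y \<partial>P x)" if "x \<in> space S" for x h
      using minor[OF that] L(1) sets_P[OF that]
      by (intro nn_integral_mono_measure) (auto simp: le_measure)
    have sum_L: "(\<integral>\<^sup>+y. r y \<partial>\<Lambda>) + (\<integral>\<^sup>+y. r' y \<partial>\<Lambda>) = ennreal (l * d)"
    proof -
      have "(\<integral>\<^sup>+y. r y \<partial>\<Lambda>) + (\<integral>\<^sup>+y. r' y \<partial>\<Lambda>) = (\<integral>\<^sup>+y. r y + r' y \<partial>\<Lambda>)"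
        using m by (intro nn_integral_add[symmetric]) (simp_all add: measurable_cong_sets[OF L(1) refl])
      also have "\<dots> = (\<integral>\<^sup>+y. ennreal d \<partial>\<Lambda>)"
        by (intro nn_integral_cong) (simp add: rr' sp)
      finally have "(\<integral>\<^sup>+y. r y \<partial>\<Lambda>) + (\<integral>\<^sup>+y. r' y \<partial>\<Lambda>) = (\<integral>\<^sup>+y. ennreal d \<partial>\<Lambda>)" .
      then show ?thesis using l d by (simp add: sp ennreal_mult[symmetric] mult.commute)
    qed
    have sum_P: "(\<integral>\<^sup>+y. r y \<partial>P x) + (\<integral>\<^sup>+y. r' y \<partial>P x) = ennreal d" 
      and trans_eq: "transition q x = ennreal a + (\<integral>\<^sup>+y. r y \<partial>P x)" if x: "x \<in> space S" for x
    proof -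
      interpret Q: prob_space "P x" by (rule P_prob[OF x])
      have spx: "space (P x) = space S" using sets_P[OF x] by (rule sets_eq_imp_space_eq)
      have "(\<integral>\<^sup>+y. r y \<partial>P x) + (\<integral>\<^sup>+y. r' y \<partial>P x) = (\<integral>\<^sup>+y. r y + r' y \<partial>P x)"
        using m by (intro nn_integral_add[symmetric]) (simp_all add: measurable_cong_sets[OF sets_P[OF x] refl])
      also have "\<dots> = (\<integral>\<^sup>+y. ennreal d \<partial>P x)"
        by (intro nn_integral_cong) (simp add: rr' spx)
      finally have "(\<integral>\<^sup>+y. r y \<partial>P x) + (\<integral>\<^sup>+y. r' y \<partial>P x) = (\<integral>\<^sup>+y. ennreal d \<partial>P x)" .
      then show "(\<integral>\<^sup>+y. r y \<partial>P x) + (\<integral>\<^sup>+y. r' y \<partial>P x) = ennreal d" by (simp add: Q.emeasure_space_1)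
      have "transition q x = (\<integral>\<^sup>+y. ennreal a + r y \<partial>P x)"
        unfolding transition_def by (intro nn_integral_cong) (simp add: spx q_eq)
      then show "transition q x = ennreal a + (\<integral>\<^sup>+y. r y \<partial>P x)"
        using m by (simp add: nn_integral_add measurable_cong_sets[OF sets_P[OF x] refl] Q.emeasure_space_1)
    qed
    obtain I J where IJ: "(\<integral>\<^sup>+y. r y \<partial>\<Lambda>) = ennreal I" "(\<integral>\<^sup>+y. r' y \<partial>\<Lambda>) = ennreal J" "0 \<le> I" "0 \<le> J"
      using sum_L by (cases "\<integral>\<^sup>+y. r y \<partial>\<Lambda>"; cases "\<integral>\<^sup>+y. r' y \<partial>\<Lambda>") auto
    then have IJs: "I + J = l * d" using sum_L l d by (simp flip: ennreal_plus)
    show ?thesis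
    proof (intro exI[of _ "a + I"] conjI ballI)
      fix x assume x: "x \<in> space S"
      obtain R T where RT: "(\<integral>\<^sup>+y. r y \<partial>P x) = ennreal R" "(\<integral>\<^sup>+y. r' y \<partial>P x) = ennreal T" "0 \<le> R" "0 \<le> T"
        using sum_P[OF x] by (cases "\<integral>\<^sup>+y. r y \<partial>P x"; cases "\<integral>\<^sup>+y. r' y \<partial>P x") auto
      then have RTs: "R + T = d" using sum_P[OF x] d by (simp flip: ennreal_plus)
      have "I \<le> R" "J \<le> T" using mono[OF x, of r] mono[OF x, of r'] IJ RT by auto
      moreover have "transition q x = ennreal (a + R)" using trans_eq[OF x] RT a by simp
      ultimately show "ennreal (a + I) \<le> transition q x" "transition q x \<le> ennreal (a + I + (1 - l) * d)"
        using RTs IJs by (auto intro!: ennreal_leI simp: algebra_simps)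
    qed (use a IJ in auto)
  qed
  then show ?thesis
    using l by (intro exI[of _ "1 - l"]) auto
qed

text \<open>One factor for the whole arm: it is independent of \<open>q\<close>, \<open>a\<close>
  and \<open>d\<close>, so the contraction can be iterated.\<close>

definition mix :: real where
  "mix = (SOME \<rho>. 0 \<le> \<rho> \<and> \<rho> < 1 \<and> (\<forall>q a d. q \<in> borel_measurable S \<longrightarrow> 0 \<le> a \<longrightarrow> 0 \<le> d \<longrightarrow>
     (\<forall>x\<in>space S. ennreal a \<le> q x \<and> q x \<le> ennreal (a + d)) \<longrightarrow>
     (\<exists>a'\<ge>0. \<forall>x\<in>space S. ennreal a' \<le> transition q x \<and> transition q x \<le> ennreal (a' + \<rho> * d))))"

lemma mix_bounds: "0 \<le> mix" "mix < 1"
  using someI_ex[OF transition_contraction] unfolding mix_def by simp_all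

lemma mix_contraction:
  assumes "q \<in> borel_measurable S" "0 \<le> a" "0 \<le> d"
    and "\<And>x. x \<in> space S \<Longrightarrow> ennreal a \<le> q x \<and> q x \<le> ennreal (a + d)"
  shows "\<exists>a'\<ge>0. \<forall>x\<in>space S. ennreal a' \<le> transition q x \<and> transition q x \<le> ennreal (a' + mix * d)"
proof -
  have "\<forall>q a d. q \<in> borel_measurable S \<longrightarrow> 0 \<le> a \<longrightarrow> 0 \<le> d \<longrightarrow>
     (\<forall>x\<in>space S. ennreal a \<le> q x \<and> q x \<le> ennreal (a + d)) \<longrightarrow>
     (\<exists>a'\<ge>0. \<forall>x\<in>space S. ennreal a' \<le> transition q x \<and> transition q x \<le> ennreal (a' + mix * d))"
    using someI_ex[OF transition_contraction] unfolding mix_def[symmetric] by (elim conjE)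
  from this[rule_format, OF assms] show ?thesis by blast
qed

lemma transition_pow_bounds:
  assumes q: "q \<in> borel_measurable S" "\<And>x. x \<in> space S \<Longrightarrow> q x \<le> 1"
  shows "\<exists>a\<ge>0. \<forall>x\<in>space S. ennreal a \<le> (transition ^^ g) q x \<and> (transition ^^ g) q x \<le> ennreal (a + mix ^ g)"
proof (induction g)
  case 0
  then show ?case using q by (intro exI[of _ 0]) auto
next
  case (Suc g)
  then obtain a where "0 \<le> a" "\<And>x. x \<in> space S \<Longrightarrow>
      ennreal a \<le> (transition ^^ g) q x \<and> (transition ^^ g) q x \<le> ennreal (a + mix ^ g)" by blast
  from mix_contraction[OF measurable_transition_pow[OF q(1)] this(1) _ this(2)] mix_bounds
  show ?case by simp
qed

text \<open>Given the past, the probability of the block is a function of the current state with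
  values in an interval of length \<open>mix ^ g\<close>. Averaging puts the unconditional
  probability into the same interval. The error is proportional to the probability of the past
  event, so that the bound can be multiplied up over many blocks.\<close>

lemma mixing:
  assumes s: "1 \<le> s" and C: "C \<in> sets (past s)" and B: "B \<in> sets borel"
  shows "\<bar>prob (past_event s C \<inter> block_event B (s + g) m) - prob (past_event s C) * prob (block_event B (s + g) m)\<bar>
    \<le> mix ^ g * prob (past_event s C)"
proof -
  obtain a where a: "0 \<le> a" and bd: "\<And>x. x \<in> space S \<Longrightarrow>
      ennreal a \<le> (transition ^^ g) (shifted_sum_law B m 0) x \<and>
      (transition ^^ g) (shifted_sum_law B m 0) x \<le> ennreal (a + mix ^ g)"
    using transition_pow_bounds[OF measurable_sum_law[OF B] shifted_sum_law_le_one] by blast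
  have sandwich: "a * prob (past_event s C) \<le> prob (past_event s C \<inter> block_event B (s + g) m)
    \<and> prob (past_event s C \<inter> block_event B (s + g) m) \<le> (a + mix ^ g) * prob (past_event s C)"
    if C: "C \<in> sets (past s)" for C
  proof -
    have const: "(\<integral>\<^sup>+w. indicator C (hist s w) * ennreal b \<partial>M) = ennreal (b * prob (past_event s C))" if "0 \<le> b" for b
    proof -
      have "(\<integral>\<^sup>+w. indicator C (hist s w) * ennreal b \<partial>M) = (\<integral>\<^sup>+w. ennreal b * indicator (past_event s C) w \<partial>M)"
        by (intro nn_integral_cong) (auto simp: past_event_def split: split_indicator)
      then show ?thesis
        using C that by (simp add: nn_integral_cmult_indicator emeasure_eq_measure ennreal_mult)
    qed
    have "ennreal (a * prob (past_event s C)) \<le> emeasure M (past_event s C \<inter> block_event B (s + g) m)"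
      unfolding const[OF a, symmetric] emeasure_past_block[OF s C B]
      using bd X_space[OF s] by (intro nn_integral_mono mult_left_mono) auto
    moreover have "emeasure M (past_event s C \<inter> block_event B (s + g) m) \<le> ennreal ((a + mix ^ g) * prob (past_event s C))"
      unfolding emeasure_past_block[OF s C B] using a mix_bounds bd X_space[OF s]
      by (subst const[symmetric]) (auto intro!: nn_integral_mono mult_left_mono)
    ultimately show ?thesis using a mix_bounds by (simp add: emeasure_eq_measure)
  qed
  have "block_event B (s + g) m \<subseteq> space M" by (auto simp: block_event_def)
  then have D: "a \<le> prob (block_event B (s + g) m)" "prob (block_event B (s + g) m) \<le> a + mix ^ g"
    using sandwich[OF sets.top] by (auto simp: past_event_space Int_absorb1 prob_space)
  have "prob (past_event s C) * a \<le> prob (past_event s C) * prob (block_event B (s + g) m)"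
    "prob (past_event s C) * prob (block_event B (s + g) m) \<le> prob (past_event s C) * (a + mix ^ g)"
    by (intro mult_left_mono D measure_nonneg)+
  with sandwich[OF C] show ?thesis by (auto simp: abs_le_iff algebra_simps)
qed

text \<open>The last block is split off. The earlier ones end \<open>g\<close> steps before it
  starts, so by \<open>mixing\<close> it contributes a factor of at most \<open>q\<close>.\<close>

lemma prob_separated_blocks:
  assumes B: "B \<in> sets borel" and p: "prob (block_event B 1 m) + mix ^ g \<le> q"
  shows "prob {w \<in> space M. \<forall>i<n. (\<Sum>j\<in>{1 + i * (m + g)..<1 + i * (m + g) + m}. Y j w) \<in> B} \<le> q ^ n"
proof (induction n)
  case 0
  then show ?case by (simp add: prob_space)
next
  case (Suc n)
  define E where "E = {w \<in> space M. \<forall>i<n. (\<Sum>j\<in>{1 + i * (m + g)..<1 + i * (m + g) + m}. Y j w) \<in> B}"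
  have q0: "0 \<le> q" using p mix_bounds measure_nonneg[of M] by (meson add_nonneg_nonneg order_trans zero_le_power)
  show ?case
  proof (cases "n = 0")
    case True
    have "prob {w \<in> space M. \<forall>i<Suc n. (\<Sum>j\<in>{1 + i * (m + g)..<1 + i * (m + g) + m}. Y j w) \<in> B}
        = prob (block_event B 1 m)"
      using True by (simp add: block_event_def)
    also have "\<dots> \<le> q" using p mix_bounds zero_le_power[of mix g] by linarith
    finally show ?thesis using True by simp
  next
    case False
    \<comment> \<open>The past of block \<open>n\<close> consists of the rewards before
      \<open>s\<close>, which lies a gap \<open>g\<close> before the start of the block. For
      \<open>n = 0\<close> truncated subtraction could break this relation, hence the separate
      case.\<close>
    define s where "s = 1 + n * (m + g) - g"
    have sg: "s + g = 1 + n * (m + g)" and s: "1 \<le> s"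
      using False by (cases n; simp add: s_def)+
    define C where "C = {p \<in> space (past s). \<forall>i<n. (\<Sum>j\<in>{1 + i * (m + g)..<1 + i * (m + g) + m}. p j) \<in> B}"
    have end_le: "1 + i * (m + g) + m \<le> s" if "i < n" for i
    proof -
      have "Suc i * (m + g) \<le> n * (m + g)" using that by (intro mult_right_mono) auto
      then show ?thesis using sg by simp
    qed
    have C: "C \<in> sets (past s)"
    proof -
      have "{p \<in> space (past s). \<forall>i\<in>{..<n}. (\<Sum>j\<in>{1 + i * (m + g)..<1 + i * (m + g) + m}. p j) \<in> B} \<in> sets (past s)"
      proof (rule sets.sets_Collect_finite_All)
        fix i assume "i \<in> {..<n}"
        then have "(\<lambda>p. \<Sum>j\<in>{1 + i * (m + g)..<1 + i * (m + g) + m}. p j) \<in> borel_measurable (past s)"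
          using end_le[of i] by (intro borel_measurable_sum measurable_past_component) auto
        from measurable_sets[OF this B]
        show "{p \<in> space (past s). (\<Sum>j\<in>{1 + i * (m + g)..<1 + i * (m + g) + m}. p j) \<in> B} \<in> sets (past s)"
          by (simp add: vimage_def Int_def conj_commute)
      qed simp
      then show ?thesis unfolding C_def lessThan_iff Ball_def .
    qed
    have "(\<Sum>j\<in>{1 + i * (m + g)..<1 + i * (m + g) + m}. hist s w j)
        = (\<Sum>j\<in>{1 + i * (m + g)..<1 + i * (m + g) + m}. Y j w)" if "i < n" for i w
      using end_le[OF that] by (intro sum.cong) (auto simp: hist_def)
    then have E: "past_event s C = E"
      using measurable_space[OF measurable_hist[of s]]
      by (auto simp: past_event_def C_def E_def)
    have split: "{w \<in> space M. \<forall>i<Suc n. (\<Sum>j\<in>{1 + i * (m + g)..<1 + i * (m + g) + m}. Y j w) \<in> B}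
       = past_event s C \<inter> block_event B (s + g) m"
      unfolding E by (auto simp: E_def block_event_def sg less_Suc_eq)
    have "prob (past_event s C \<inter> block_event B (s + g) m)
       \<le> prob (past_event s C) * (prob (block_event B (s + g) m) + mix ^ g)"
      using mixing[OF s C B, of g m] by (simp add: abs_le_iff algebra_simps)
    also have "\<dots> \<le> prob (past_event s C) * q"
      using p prob_block_stationary[of "s + g" B m] s B by (intro mult_left_mono) auto
    also have "\<dots> \<le> q ^ n * q"
      using Suc.IH q0 unfolding E E_def by (rule mult_right_mono)
    finally show ?thesis unfolding split by (simp add: mult.commute)
  qed
qed

end

section \<open>Probability of a sample mean below its expectation\<close>

context stationary_rewards
begin

lemma distr_block:
  assumes s: "1 \<le> s"
  shows "distr M borel (\<lambda>w. \<Sum>j\<in>{s..<s+m}. Y j w) = distr M borel (\<lambda>w. \<Sum>j\<in>{1..<1+m}. Y j w)"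
proof (rule measure_eqI)
  have m: "(\<lambda>w. \<Sum>j\<in>{s..<s+m}. Y j w) \<in> borel_measurable M" if "1 \<le> s" for s
    using that by (intro borel_measurable_sum measurable_Y) auto
  fix B assume "B \<in> sets (distr M borel (\<lambda>w. \<Sum>j\<in>{s..<s+m}. Y j w))"
  then have B: "B \<in> sets borel" by simp
  have "emeasure (distr M borel (\<lambda>w. \<Sum>j\<in>{s..<s+m}. Y j w)) B = emeasure M (block_event B s m)" if "1 \<le> s" for s
    using emeasure_distr[OF m[OF that] B] by (simp add: block_event_def vimage_def Int_def conj_commute)
  from this[OF s] this[of 1]
  show "emeasure (distr M borel (\<lambda>w. \<Sum>j\<in>{s..<s+m}. Y j w)) B = emeasure (distr M borel (\<lambda>w. \<Sum>j\<in>{1..<1+m}. Y j w)) B"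
    using prob_block_stationary[OF s B] by (simp add: emeasure_eq_measure)
qed simp

lemma block_expectation_stationary:
  fixes h :: "real \<Rightarrow> real"
  assumes s: "1 \<le> s" and h: "h \<in> borel_measurable borel"
  shows "expectation (\<lambda>w. h (\<Sum>j\<in>{s..<s+m}. Y j w)) = expectation (\<lambda>w. h (\<Sum>j\<in>{1..<1+m}. Y j w))"
    and "integrable M (\<lambda>w. h (\<Sum>j\<in>{s..<s+m}. Y j w)) \<longleftrightarrow> integrable M (\<lambda>w. h (\<Sum>j\<in>{1..<1+m}. Y j w))"
proof -
  have m: "(\<lambda>w. \<Sum>j\<in>{s..<s+m}. Y j w) \<in> borel_measurable M" if "1 \<le> s" for s
    using that by (intro borel_measurable_sum measurable_Y) auto
  show "expectation (\<lambda>w. h (\<Sum>j\<in>{s..<s+m}. Y j w)) = expectation (\<lambda>w. h (\<Sum>j\<in>{1..<1+m}. Y j w))"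
    using integral_distr[OF m[OF s] h] integral_distr[OF m[of 1] h] distr_block[OF s] by simp
  show "integrable M (\<lambda>w. h (\<Sum>j\<in>{s..<s+m}. Y j w)) \<longleftrightarrow> integrable M (\<lambda>w. h (\<Sum>j\<in>{1..<1+m}. Y j w))"
    using integrable_distr_eq[OF m[OF s] h] integrable_distr_eq[OF m[of 1] h] distr_block[OF s] by simp
qed

text \<open>The tail of a single reward is exponential because the reward is the difference of two
  consecutive partial sums, both of which concentrate.\<close>

lemma reward_tail:
  assumes Q: "0 < Q" "0 < b"
    and conc: "\<And>t. 1 \<le> t \<Longrightarrow>
      prob {w \<in> space M. real t \<le> \<bar>(\<Sum>j\<in>{1..<1+t}. Y j w) - real t * \<mu>\<bar>} \<le> Q * exp (- (real t * b))"
    and t: "2 \<le> t"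
  shows "prob {w \<in> space M. 2 * real t \<le> \<bar>Y 1 w - \<mu>\<bar>} \<le> 2 * Q * exp b * exp (- (real t * b))"
proof -
  define E where "E t = {w \<in> space M. real t \<le> \<bar>(\<Sum>j\<in>{1..<1+t}. Y j w) - real t * \<mu>\<bar>}" for t
  have m: "(\<lambda>w. \<Sum>j\<in>{1..<1+t}. Y j w) \<in> borel_measurable M" for t
    by (intro borel_measurable_sum measurable_Y) auto
  have E: "E t \<in> sets M" for t unfolding E_def using m[of t] by measurable
  have B: "{y. 2 * real t \<le> \<bar>y - \<mu>\<bar>} \<in> sets borel" by measurable
  have "prob {w \<in> space M. 2 * real t \<le> \<bar>Y 1 w - \<mu>\<bar>} = prob (block_event {y. 2 * real t \<le> \<bar>y - \<mu>\<bar>} 1 1)"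
    by (simp add: block_event_def)
  also have "\<dots> = prob (block_event {y. 2 * real t \<le> \<bar>y - \<mu>\<bar>} t 1)"
    using prob_block_stationary[OF _ B, of t] t by simp
  also have "\<dots> \<le> prob (E t \<union> E (t - 1))"
  proof (rule finite_measure_mono)
    show "block_event {y. 2 * real t \<le> \<bar>y - \<mu>\<bar>} t 1 \<subseteq> E t \<union> E (t - 1)"
    proof
      fix w assume w: "w \<in> block_event {y. 2 * real t \<le> \<bar>y - \<mu>\<bar>} t 1"
      have "(\<Sum>j\<in>{1..<1+t}. Y j w) = (\<Sum>j\<in>{1..<1+(t-1)}. Y j w) + Y t w"
        using t by (cases t) auto
      moreover have "2 * real t \<le> \<bar>Y t w - \<mu>\<bar>" "w \<in> space M" using w by (auto simp: block_event_def)
      moreover have "real (t - 1) = real t - 1" using t by simp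
      ultimately show "w \<in> E t \<union> E (t - 1)"
        by (auto simp: E_def algebra_simps abs_if split: if_splits)
    qed
  qed (use E in auto)
  also have "\<dots> \<le> prob (E t) + prob (E (t - 1))"
    by (intro measure_Un_le E)
  also have "\<dots> \<le> Q * exp (- (real t * b)) + Q * exp (- (real (t - 1) * b))"
    using conc[of t] conc[of "t - 1"] t by (intro add_mono) (auto simp: E_def)
  also have "exp (- (real (t - 1) * b)) = exp b * exp (- (real t * b))"
    using t by (simp add: algebra_simps flip: exp_add)
  also have "Q * exp (- (real t * b)) + Q * (exp b * exp (- (real t * b))) \<le> 2 * Q * exp b * exp (- (real t * b))"
    using Q by (simp add: algebra_simps)
  finally show ?thesis .
qed

text \<open>A deviation above 4 lies in a layer between \<open>2 * real (i + 2)\<close> and that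
  number plus 2, and \<open>reward_tail\<close> makes the layers summable against the square. That
  tail bound starts at \<open>t = 2\<close>, whence the shift by 2 and the constant 16 for
  deviations up to 4.\<close>

lemma reward_square_integrable:
  assumes Q: "0 < Q" "0 < b"
    and conc: "\<And>t. 1 \<le> t \<Longrightarrow>
      prob {w \<in> space M. real t \<le> \<bar>(\<Sum>j\<in>{1..<1+t}. Y j w) - real t * \<mu>\<bar>} \<le> Q * exp (- (real t * b))"
    and s: "1 \<le> s"
  shows "integrable M (\<lambda>w. (Y s w - \<mu>)\<^sup>2)"
proof -
  define F where "F i = {w \<in> space M. 2 * real (i + 2) \<le> \<bar>Y 1 w - \<mu>\<bar>}" for i
  define r where "r i = (2 * real (i + 2) + 2)\<^sup>2 * (2 * Q * exp b * exp (- (real (i + 2) * b)))" for i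
  have F: "F i \<in> sets M" for i unfolding F_def by measurable
  have r: "summable r"
  proof (rule summable_comparison_test_bigo)
    show "summable (\<lambda>n. norm (1 / real n ^ 2))"
      using inverse_power_summable[of 2, where 'a=real] by (simp add: field_simps)
    show "r \<in> O(\<lambda>n. 1 / real n ^ 2)"
      using Q unfolding r_def by real_asymp
  qed
  have r0: "0 \<le> r i" for i using Q by (simp add: r_def)
  have bound: "ennreal ((Y 1 w - \<mu>)\<^sup>2) \<le> 16 + (\<Sum>i. ennreal ((2 * real (i + 2) + 2)\<^sup>2) * indicator (F i) w)"
    if w: "w \<in> space M" for w
  proof (cases "\<bar>Y 1 w - \<mu>\<bar> \<le> 4")
    case True
    then have "(Y 1 w - \<mu>)\<^sup>2 \<le> 4\<^sup>2" by (intro abs_le_square_iff[THEN iffD1]) simp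
    then have "ennreal ((Y 1 w - \<mu>)\<^sup>2) \<le> 16" by (simp flip: ennreal_numeral add: ennreal_leI)
    then show ?thesis by (rule order_trans) (rule add_increasing2, simp_all)
  next
    case False
    define i where "i = nat \<lfloor>\<bar>Y 1 w - \<mu>\<bar> / 2\<rfloor> - 2"
    have fl: "2 \<le> \<lfloor>\<bar>Y 1 w - \<mu>\<bar> / 2\<rfloor>" using False by (simp add: le_floor_iff)
    then have "i + 2 = nat \<lfloor>\<bar>Y 1 w - \<mu>\<bar> / 2\<rfloor>" unfolding i_def by linarith
    then have i2: "real (i + 2) = of_int \<lfloor>\<bar>Y 1 w - \<mu>\<bar> / 2\<rfloor>" using fl by simp
    have lo: "2 * real (i + 2) \<le> \<bar>Y 1 w - \<mu>\<bar>" and hi: "\<bar>Y 1 w - \<mu>\<bar> \<le> 2 * real (i + 2) + 2"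
      unfolding i2 using floor_correct[of "\<bar>Y 1 w - \<mu>\<bar> / 2"] by (simp_all add: field_simps)
    have "(Y 1 w - \<mu>)\<^sup>2 \<le> (2 * real (i + 2) + 2)\<^sup>2"
      using hi by (intro abs_le_square_iff[THEN iffD1]) simp
    then have "ennreal ((Y 1 w - \<mu>)\<^sup>2) \<le> ennreal ((2 * real (i + 2) + 2)\<^sup>2) * indicator (F i) w"
      using lo w by (simp add: F_def ennreal_leI)
    also have "\<dots> = (\<Sum>j\<in>{i}. ennreal ((2 * real (j + 2) + 2)\<^sup>2) * indicator (F j) w)"
      by (simp only: sum.insert sum.empty finite.emptyI empty_iff not_False_eq_True add_0_right)
    also have "\<dots> \<le> (\<Sum>i. ennreal ((2 * real (i + 2) + 2)\<^sup>2) * indicator (F i) w)"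
      by (intro sum_le_suminf) auto
    finally show ?thesis by (rule order_trans) (rule add_increasing, simp_all)
  qed
  have "(\<integral>\<^sup>+w. ennreal ((Y 1 w - \<mu>)\<^sup>2) \<partial>M)
      \<le> (\<integral>\<^sup>+w. 16 + (\<Sum>i. ennreal ((2 * real (i + 2) + 2)\<^sup>2) * indicator (F i) w) \<partial>M)"
    by (intro nn_integral_mono bound)
  also have "\<dots> = 16 + (\<Sum>i. ennreal ((2 * real (i + 2) + 2)\<^sup>2) * emeasure M (F i))"
    using F by (simp add: nn_integral_add nn_integral_suminf nn_integral_cmult_indicator emeasure_space_1)
  also have "\<dots> \<le> 16 + (\<Sum>i. ennreal (r i))"
  proof (intro add_left_mono suminf_le)
    fix i
    have "prob (F i) \<le> 2 * Q * exp b * exp (- (real (i + 2) * b))"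
      unfolding F_def by (rule reward_tail[OF Q conc]) auto
    then have "(2 * real (i + 2) + 2)\<^sup>2 * prob (F i) \<le> r i"
      unfolding r_def by (intro mult_left_mono) auto
    then show "ennreal ((2 * real (i + 2) + 2)\<^sup>2) * emeasure M (F i) \<le> ennreal (r i)"
      by (simp add: emeasure_eq_measure ennreal_leI flip: ennreal_mult)
  qed auto
  also have "\<dots> = 16 + ennreal (\<Sum>i. r i)"
    using r r0 by (simp add: suminf_ennreal2)
  also have "\<dots> < \<infinity>" by simp
  finally have "integrable M (\<lambda>w. (Y 1 w - \<mu>)\<^sup>2)"
    by (intro integrableI_bounded) auto
  then show ?thesis
    using block_expectation_stationary(2)[OF s, of "\<lambda>y. (y - \<mu>)\<^sup>2" 1] by simp
qed

text \<open>A reward that is almost surely at least its mean equals it almost surely. Otherwise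
  there is mass strictly below the mean, and by continuity of measure also below it by some margin.
  There is then mass at or above the mean as well, since a reward almost surely below it would have
  a smaller mean.\<close>

lemma reward_atom_or_spread:
  assumes mean: "\<And>t. 1 \<le> t \<Longrightarrow> has_bochner_integral M (Y t) \<mu>"
  shows "(\<forall>t\<ge>1. AE w in M. Y t w = \<mu>) \<or>
    (\<exists>\<delta>>0. 0 < prob (block_event {..\<mu> - \<delta>} 1 1) \<and> 0 < prob (block_event {\<mu>..} 1 1))"
proof (cases "prob (block_event {..<\<mu>} 1 1) = 0")
  case True
  have "AE w in M. Y t w = \<mu>" if t: "1 \<le> t" for t
  proof -
    have "prob (block_event {..<\<mu>} t 1) = 0"
      using prob_block_stationary[OF t, of "{..<\<mu>}" 1] True by simp
    then have "AE w in M. w \<notin> block_event {..<\<mu>} t 1"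
      using t by (intro AE_not_in) (simp add: null_sets_def emeasure_eq_measure sets_block_event)
    then have ge: "AE w in M. 0 \<le> Y t w - \<mu>"
      using AE_space by eventually_elim (auto simp: block_event_def)
    have int: "integrable M (\<lambda>w. Y t w - \<mu>)" and "expectation (\<lambda>w. Y t w - \<mu>) = 0"
      using mean[OF t] by (auto simp: has_bochner_integral_iff prob_space)
    then have "AE w in M. Y t w - \<mu> = 0"
      using integral_nonneg_eq_0_iff_AE[OF int ge] by simp
    then show ?thesis by simp
  qed
  then show ?thesis by blast
next
  case False
  have "\<exists>n. prob (block_event {..\<mu> - 1 / real (Suc n)} 1 1) \<noteq> 0"
  proof (rule ccontr)
    assume "\<not> ?thesis"
    then have "block_event {..\<mu> - 1 / real (Suc n)} 1 1 \<in> null_sets M" for n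
      by (auto simp: null_sets_def emeasure_eq_measure intro: sets_block_event)
    then have "(\<Union>n. block_event {..\<mu> - 1 / real (Suc n)} 1 1) \<in> null_sets M" by (rule null_sets_UN)
    moreover have "block_event {..<\<mu>} 1 1 \<subseteq> (\<Union>n. block_event {..\<mu> - 1 / real (Suc n)} 1 1)"
    proof
      fix w assume w: "w \<in> block_event {..<\<mu>} 1 1"
      then have "0 < \<mu> - Y 1 w" by (simp add: block_event_def)
      then obtain n where "inverse (real (Suc n)) < \<mu> - Y 1 w" using reals_Archimedean by blast
      then show "w \<in> (\<Union>n. block_event {..\<mu> - 1 / real (Suc n)} 1 1)"
        using w by (auto simp: block_event_def field_simps inverse_eq_divide intro!: exI[of _ n])
    qed
    ultimately have "block_event {..<\<mu>} 1 1 \<in> null_sets M"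
      by (intro null_sets_subset[OF _ sets_block_event]) auto
    with False show False by (simp add: null_sets_def measure_def)
  qed
  then obtain n where n: "prob (block_event {..\<mu> - 1 / real (Suc n)} 1 1) \<noteq> 0" ..
  have "prob (block_event {\<mu>..} 1 1) \<noteq> 0"
  proof
    assume "prob (block_event {\<mu>..} 1 1) = 0"
    then have "AE w in M. w \<notin> block_event {\<mu>..} 1 1"
      by (intro AE_not_in) (simp add: null_sets_def emeasure_eq_measure sets_block_event)
    then have lt: "AE w in M. 0 < \<mu> - Y 1 w"
      using AE_space by eventually_elim (auto simp: block_event_def)
    then have ge: "AE w in M. 0 \<le> \<mu> - Y 1 w" by eventually_elim simp
    have int: "integrable M (\<lambda>w. \<mu> - Y 1 w)" and "expectation (\<lambda>w. \<mu> - Y 1 w) = 0"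
      using mean[of 1] by (auto simp: has_bochner_integral_iff prob_space)
    then have "AE w in M. \<mu> - Y 1 w = 0"
      using integral_nonneg_eq_0_iff_AE[OF int ge] by simp
    with lt have "AE w in M. False" by eventually_elim simp
    then show False by simp
  qed
  then have "0 < prob (block_event {\<mu>..} 1 1)" "0 < prob (block_event {..\<mu> - 1 / real (Suc n)} 1 1)"
    using n by (simp_all add: zero_less_measure_iff)
  then show ?thesis by (intro disjI2 exI[of _ "1 / real (Suc n)"]) simp
qed

text \<open>If \<open>S\<close> is the centred sum of \<open>m\<close> rewards, the difference of its values over the windows
  \<open>2, ..., m + 1\<close> and \<open>1, ..., m\<close> is \<open>Y (m + 1) - Y 1\<close>. The two terms are nearly independent, so
  unless the reward is constant the mean of \<open>\<bar>S\<bar>\<close> stays away from zero. Half of this mean comes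
  from the event \<open>S \<le> 0\<close>, which by Cauchy-Schwarz then cannot be too unlikely.\<close>

lemma prob_below_mean:
  assumes mean: "\<And>t. 1 \<le> t \<Longrightarrow> has_bochner_integral M (Y t) \<mu>"
    and Q: "0 < Q" "0 < b"
    and conc: "\<And>t. 1 \<le> t \<Longrightarrow>
      prob {w \<in> space M. real t \<le> \<bar>(\<Sum>j\<in>{1..<1+t}. Y j w) - real t * \<mu>\<bar>} \<le> Q * exp (- (real t * b))"
  shows "\<exists>c>0. \<exists>m0\<ge>1. \<forall>m\<ge>m0. c / (real m)\<^sup>2 \<le> prob (block_event {..real m * \<mu>} 1 m)"
proof -
  consider (atom) "\<forall>t\<ge>1. AE w in M. Y t w = \<mu>"
    | (spread) \<delta> where "0 < \<delta>" "0 < prob (block_event {..\<mu> - \<delta>} 1 1)" "0 < prob (block_event {\<mu>..} 1 1)"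
    using reward_atom_or_spread[of \<mu>] mean by blast
  then show ?thesis
  proof cases
    case atom
    have "prob (block_event {..real m * \<mu>} 1 m) = 1" for m
    proof -
      have "AE w in M. \<forall>t\<in>{1..<1+m}. Y t w = \<mu>"
        using atom by (intro AE_finite_allI) auto
      then have "AE w in M. w \<in> block_event {..real m * \<mu>} 1 m"
        using AE_space by eventually_elim (auto simp: block_event_def algebra_simps)
      then show ?thesis by (simp add: prob_eq_1 sets_block_event)
    qed
    then show ?thesis by (intro exI[of _ 1] conjI exI[of _ 1]) (auto simp: field_simps)
  next
    case spread
    note \<delta> = spread(1) and pa = spread(2) and pb = spread(3)
    define pA where "pA = prob (block_event {..\<mu> - \<delta>} 1 1)"
    define pB where "pB = prob (block_event {\<mu>..} 1 1)"
    \<comment> \<open>The added 1 keeps \<open>v\<close> positive; \<open>A\<close> and the final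
      constant rely on this.\<close>
    define v where "v = expectation (\<lambda>w. (Y 1 w - \<mu>)\<^sup>2) + 1"
    \<comment> \<open>The margin times a lower bound for the probability of the event
      \<open>E\<close> below, halved because the absolute sums over the two windows share the
      difference.\<close>
    define \<eta> where "\<eta> = \<delta> * (pA * pB / 2) / 2"
    have "0 \<le> expectation (\<lambda>w. (Y 1 w - \<mu>)\<^sup>2)" by simp
    then have v: "0 < v" unfolding v_def by linarith
    have \<eta>: "0 < \<eta>" using \<delta> pa pb by (simp add: \<eta>_def pA_def pB_def)
    have ind: "integrable M (indicator D :: 'a \<Rightarrow> real)" if "D \<in> events" for D
      using that by (intro integrable_real_indicator) (auto simp: less_top[symmetric])
    have sq: "integrable M (\<lambda>w. (Y t w - \<mu>)\<^sup>2)" "expectation (\<lambda>w. (Y t w - \<mu>)\<^sup>2) \<le> v" if "1 \<le> t" for t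
      using reward_square_integrable[OF Q conc that]
        block_expectation_stationary(1)[OF that, of "\<lambda>y. (y - \<mu>)\<^sup>2" 1] by (simp_all add: v_def)
    have "(\<lambda>n. mix ^ n) \<longlonglongrightarrow> 0" using mix_bounds by (intro LIMSEQ_realpow_zero)
    then have "eventually (\<lambda>n. mix ^ n < pB / 2) sequentially"
      using pb by (intro order_tendstoD) (auto simp: pB_def)
    then obtain n0 where n0: "\<And>n. n0 \<le> n \<Longrightarrow> mix ^ n < pB / 2" by (auto simp: eventually_sequentially)
    have "\<eta>\<^sup>2 / (4 * v) / (real m)\<^sup>2 \<le> prob (block_event {..real m * \<mu>} 1 m)" if m: "Suc n0 \<le> m" for m
    proof -
      define T where "T s w = (\<Sum>j\<in>{s..<s+m}. Y j w) - real m * \<mu>" for s w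
      have T_sum: "T s w = (\<Sum>j\<in>{s..<s+m}. Y j w - \<mu>)" for s w
        by (simp add: T_def sum_subtractf)
      have T_int: "integrable M (T s)" and T0: "expectation (T s) = 0" if "1 \<le> s" for s
      proof -
        have i: "integrable M (\<lambda>w. Y j w - \<mu>)" "expectation (\<lambda>w. Y j w - \<mu>) = 0" if "1 \<le> j" for j
          using mean[OF that] by (auto simp: has_bochner_integral_iff prob_space)
        show "integrable M (T s)" unfolding T_sum[abs_def] using \<open>1 \<le> s\<close> i by (intro Bochner_Integration.integrable_sum) auto
        show "expectation (T s) = 0" unfolding T_sum[abs_def] using \<open>1 \<le> s\<close> i
          by (subst Bochner_Integration.integral_sum) auto
      qed
      have T_sq: "(T 1 w)\<^sup>2 \<le> (\<Sum>j\<in>{1..<1+m}. (Y j w - \<mu>)\<^sup>2) * real m" for w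
        unfolding T_sum using sum_squared_le_sum_of_squares[of "\<lambda>j. Y j w - \<mu>" "{1..<1+m}"] by simp
      have T_sq_int: "integrable M (\<lambda>w. (T 1 w)\<^sup>2)"
      proof (rule Bochner_Integration.integrable_bound)
        show "integrable M (\<lambda>w. (\<Sum>j\<in>{1..<1+m}. (Y j w - \<mu>)\<^sup>2) * real m)"
          using sq by (intro integrable_mult_left Bochner_Integration.integrable_sum) auto
        show "(\<lambda>w. (T 1 w)\<^sup>2) \<in> borel_measurable M" using T_int[of 1] by measurable
        show "AE w in M. norm ((T 1 w)\<^sup>2) \<le> norm ((\<Sum>j\<in>{1..<1+m}. (Y j w - \<mu>)\<^sup>2) * real m)"
          using T_sq by (intro AE_I2) (simp add: abs_mult sum_nonneg)
      qed
      have T_sq_le: "expectation (\<lambda>w. (T 1 w)\<^sup>2) \<le> (real m)\<^sup>2 * v"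
      proof -
        have "expectation (\<lambda>w. (T 1 w)\<^sup>2) \<le> expectation (\<lambda>w. (\<Sum>j\<in>{1..<1+m}. (Y j w - \<mu>)\<^sup>2) * real m)"
          using sq T_sq by (intro integral_mono T_sq_int integrable_mult_left Bochner_Integration.integrable_sum) auto
        also have "\<dots> = (\<Sum>j\<in>{1..<1+m}. expectation (\<lambda>w. (Y j w - \<mu>)\<^sup>2)) * real m"
          unfolding integral_mult_left_zero using sq
          by (intro arg_cong2[where f="(*)"] Bochner_Integration.integral_sum) auto
        also have "\<dots> \<le> (\<Sum>j\<in>{1..<1+m}. v) * real m"
          using sq by (intro mult_right_mono sum_mono) auto
        finally show ?thesis by (simp add: power2_eq_square mult_ac)
      qed
      have abs_T2: "expectation (\<lambda>w. \<bar>T 2 w\<bar>) = expectation (\<lambda>w. \<bar>T 1 w\<bar>)"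
        using block_expectation_stationary(1)[of 2 "\<lambda>y. \<bar>y - real m * \<mu>\<bar>" m] by (simp add: T_def)
      \<comment> \<open>The past is reward 1, that is, the history before time 2, and the later
        block is reward \<open>m + 1\<close>. The gap between the times 2 and \<open>m + 1\<close>
        is \<open>m - 1\<close>.\<close>
      define g where "g = m - 1"
      have g: "n0 \<le> g" "2 + g = m + 1" using m by (auto simp: g_def)
      define C where "C = {p \<in> space (past 2). p 1 \<le> \<mu> - \<delta>}"
      have C: "C \<in> sets (past 2)" unfolding C_def by measurable
      define E where "E = past_event 2 C \<inter> block_event {\<mu>..} (2 + g) 1"
      have E: "E \<in> sets M" unfolding E_def by (intro sets.Int sets_past_event sets_block_event C) auto
      have past: "past_event 2 C = block_event {..\<mu> - \<delta>} 1 1"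
        using measurable_space[OF measurable_hist[of 2]]
        by (auto simp: past_event_def C_def block_event_def hist_def)
      have "pA * pB - mix ^ g * pA \<le> prob E"
        using mixing[OF _ C, of "{\<mu>..}" g 1] prob_block_stationary[of "2 + g" "{\<mu>..}" 1]
        by (simp add: past pA_def pB_def E_def abs_le_iff)
      moreover have "mix ^ g * pA \<le> pB / 2 * pA" using n0[OF g(1)] pa by (intro mult_right_mono) (auto simp: pA_def)
      ultimately have PE: "pA * pB / 2 \<le> prob E" by (simp add: algebra_simps)
      have "\<delta> * prob E = expectation (\<lambda>w. \<delta> * indicator E w)" using E by simp
      also have "\<dots> \<le> expectation (\<lambda>w. \<bar>T 2 w\<bar> + \<bar>T 1 w\<bar>)"
      proof (rule integral_mono)
        fix w assume w: "w \<in> space M"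
        have "{2..<2+m} \<union> {1} = {1..<1+m} \<union> {m+1}" using m by auto
        then have "(\<Sum>j\<in>{2..<2+m} \<union> {1}. Y j w) = (\<Sum>j\<in>{1..<1+m} \<union> {m+1}. Y j w)" by simp
        then have "(\<Sum>j\<in>{2..<2+m}. Y j w) + Y 1 w = (\<Sum>j\<in>{1..<1+m}. Y j w) + Y (m+1) w"
          by (subst (asm) sum.union_disjoint; simp add: sum.union_disjoint)
        then have "T 2 w - T 1 w = Y (m + 1) w - Y 1 w" by (simp add: T_def)
        moreover have "w \<in> E \<Longrightarrow> \<delta> \<le> Y (m + 1) w - Y 1 w"
          unfolding E_def past g(2) by (auto simp: block_event_def)
        ultimately show "\<delta> * indicator E w \<le> \<bar>T 2 w\<bar> + \<bar>T 1 w\<bar>"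
          by (auto split: split_indicator)
      qed (use ind[OF E] T_int in auto)
      also have "\<dots> = 2 * expectation (\<lambda>w. \<bar>T 1 w\<bar>)"
        using T_int[of 1] T_int[of 2] abs_T2 by simp
      finally have "\<delta> * prob E \<le> 2 * expectation (\<lambda>w. \<bar>T 1 w\<bar>)" .
      moreover have "\<delta> * (pA * pB / 2) \<le> \<delta> * prob E" using PE \<delta> by (intro mult_left_mono) auto
      ultimately have abs_lower: "\<eta> \<le> expectation (\<lambda>w. \<bar>T 1 w\<bar>)" by (simp add: \<eta>_def)
      define F where "F = block_event {..real m * \<mu>} 1 m"
      have F: "F \<in> sets M" unfolding F_def by (intro sets_block_event) auto
      \<comment> \<open>Off \<open>F\<close> the absolute value of \<open>T 1\<close> is
        \<open>T 1\<close> itself; on \<open>F\<close> it is \<open>T 1\<close> plus twice that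
        absolute value, and the double is at most \<open>A + (T 1 w)\<^sup>2 / A\<close>. As
        \<open>T 1\<close> has mean zero, only \<open>F\<close> and the square term remain, and this
        \<open>A\<close> makes the latter half of \<open>\<eta>\<close>.\<close>
      define A where "A = 2 * (real m)\<^sup>2 * v / \<eta>"
      have A: "0 < A" using m v \<eta> by (simp add: A_def)
      have "expectation (\<lambda>w. \<bar>T 1 w\<bar>) \<le> expectation (\<lambda>w. T 1 w + (A * indicator F w + (T 1 w)\<^sup>2 / A))"
      proof (rule integral_mono)
        fix w assume w: "w \<in> space M"
        have "2 * \<bar>T 1 w\<bar> \<le> A + (T 1 w)\<^sup>2 / A"
        proof -
          have "0 \<le> (A - \<bar>T 1 w\<bar>)\<^sup>2 / A" using A by simp
          also have "\<dots> = A - 2 * \<bar>T 1 w\<bar> + (T 1 w)\<^sup>2 / A"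
            using A by (simp add: field_simps power2_eq_square)
          finally show ?thesis by simp
        qed
        moreover have "w \<in> F \<longleftrightarrow> T 1 w \<le> 0" using w by (auto simp: F_def block_event_def T_def)
        moreover have "0 \<le> (T 1 w)\<^sup>2 / A" using A by simp
        ultimately show "\<bar>T 1 w\<bar> \<le> T 1 w + (A * indicator F w + (T 1 w)\<^sup>2 / A)"
          by (auto split: split_indicator)
      qed (use ind[OF F] T_int T_sq_int in auto)
      also have "\<dots> = A * prob F + expectation (\<lambda>w. (T 1 w)\<^sup>2) / A"
        using F ind[OF F] T_int[of 1] T_sq_int T0[of 1] by simp
      also have "\<dots> \<le> A * prob F + (real m)\<^sup>2 * v / A"
        using T_sq_le A by (intro add_left_mono divide_right_mono) auto
      also have "(real m)\<^sup>2 * v / A = \<eta> / 2"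
        using m v \<eta> by (simp add: A_def field_simps)
      finally have "\<eta> / 2 \<le> A * prob F" using abs_lower by simp
      then have "\<eta> / 2 / A \<le> prob F" using A by (simp add: field_simps)
      also have "\<eta> / 2 / A = \<eta>\<^sup>2 / (4 * v) / (real m)\<^sup>2"
        using m v \<eta> by (simp add: A_def field_simps power2_eq_square)
      finally show ?thesis by (simp add: F_def)
    qed
    then show ?thesis
      using v \<eta> by (intro exI[of _ "\<eta>\<^sup>2 / (4 * v)"] conjI exI[of _ "Suc n0"]) auto
  qed
qed

end

section \<open>Error probabilities of the comparisons\<close>

lemma block_mean_window:
  assumes "1 \<le> m"
  shows "block_mean y k s (s + m - 1) = (\<Sum>j\<in>{s..<s+m}. y k j) / real m"
proof -
  have "{s..s + m - 1} = {s..<s+m}" using assms by auto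
  moreover have "real (s + m - 1) - real s + 1 = real m" using assms by (simp add: of_nat_diff)
  ultimately show ?thesis by (simp add: block_mean_def)
qed

lemma block_mean_initial:
  "1 \<le> m \<Longrightarrow> block_mean y k 1 m = (\<Sum>j\<in>{1..<1+m}. y k j) / real m"
  using block_mean_window[of m y k 1] by simp

text \<open>The two inequalities describe a quantile in the presence of atoms. The infimum of the
  points at which the distribution function reaches \<open>v\<close> is one: right continuity gives
  the second inequality, the left limit the first.\<close>

lemma (in prob_space) quantile_exists:
  assumes V: "V \<in> borel_measurable M" and v: "0 < v" "v < 1"
  shows "\<exists>x::real. prob {w \<in> space M. V w < x} \<le> v \<and> v \<le> prob {w \<in> space M. V w \<le> x}"
proof -
  interpret D: real_distribution "distr M borel V" using V by (rule real_distribution_distr)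
  let ?F = "cdf (distr M borel V)"
  have F: "?F x = prob {w \<in> space M. V w \<le> x}" for x
    using V by (simp add: cdf_def measure_distr vimage_def Int_def conj_commute)
  have F': "measure (distr M borel V) {..<x} = prob {w \<in> space M. V w < x}" for x
    using V by (simp add: measure_distr vimage_def Int_def conj_commute)
  define A where "A = {x. v \<le> ?F x}"
  have "eventually (\<lambda>x. v < ?F x) at_top"
    by (rule order_tendstoD(1)[OF D.cdf_lim_at_top_prob v(2)])
  then obtain x1 where x1: "v < ?F x1" by (auto simp: eventually_at_top_linorder)
  then have ne: "A \<noteq> {}" by (auto simp: A_def intro: less_imp_le)
  have "eventually (\<lambda>x. ?F x < v) at_bot"
    by (rule order_tendstoD(2)[OF D.cdf_lim_at_bot v(1)])
  then obtain x2 where x2: "\<And>x. x \<le> x2 \<Longrightarrow> ?F x < v" by (auto simp: eventually_at_bot_linorder)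
  have bdd: "bdd_below A"
    using x2 unfolding A_def by (intro bdd_belowI[of _ x2]) (metis linear mem_Collect_eq not_le)
  define a where "a = Inf A"
  have above: "v \<le> ?F x" if x: "a < x" for x
  proof -
    obtain y where "y \<in> A" "y < x" using cInf_lessD[OF ne, of x] x unfolding a_def by blast
    then show ?thesis using D.cdf_nondecreasing[of y x] by (auto simp: A_def)
  qed
  have below: "?F x < v" if "x < a" for x
    using that cInf_lower[OF _ bdd, of x] unfolding a_def A_def by fastforce
  have "(?F \<longlongrightarrow> ?F a) (at_right a)" using D.cdf_is_right_cont[of a] by (simp add: continuous_within)
  then have "v \<le> ?F a"
    by (rule tendsto_lowerbound) (auto simp: eventually_at_right_less above intro: eventually_mono[OF eventually_at_right_less])
  moreover have "(?F \<longlongrightarrow> measure (distr M borel V) {..<a}) (at_left a)" by (rule D.cdf_at_left)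
  then have "measure (distr M borel V) {..<a} \<le> v"
  proof (rule tendsto_upperbound)
    have "eventually (\<lambda>x. x < a) (at_left a)" by (simp add: eventually_at_filter)
    then show "eventually (\<lambda>x. ?F x \<le> v) (at_left a)" by eventually_elim (use below in force)
  qed simp
  ultimately show ?thesis unfolding F F' by blast
qed

locale bandit = prob_space M for M :: "'w measure" +
  fixes S :: "'x measure" and K :: nat and P :: "nat \<Rightarrow> 'x \<Rightarrow> 'x measure"
    and \<nu> :: "real measure" and f :: "nat \<Rightarrow> 'x \<Rightarrow> real \<Rightarrow> real"
    and X :: "nat \<Rightarrow> nat \<Rightarrow> 'w \<Rightarrow> 'x" and Y :: "nat \<Rightarrow> nat \<Rightarrow> 'w \<Rightarrow> real"
    and \<mu> :: "nat \<Rightarrow> real" and c :: "nat \<Rightarrow> real"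
  assumes K: "2 \<le> K"
    and arm: "\<And>k. k \<in> {1..K} \<Longrightarrow> stationary_rewards M S (P k) \<nu> (f k) (X k) (Y k)"
    and means: "\<And>k t. k \<in> {1..K} \<Longrightarrow> 1 \<le> t \<Longrightarrow> has_bochner_integral M (Y k t) (\<mu> k)"
    and c_nonneg: "\<And>n. 0 \<le> c n"
    and c_mono: "mono c"
    and c_upper: "c \<in> o(\<lambda>n. ln (real n))"
    and c_lower: "filterlim (\<lambda>n. c n / ln (ln (real n))) at_top sequentially"
    and C2: "\<And>\<epsilon>::real. 0 < \<epsilon> \<Longrightarrow>
      \<exists>b>0. \<exists>Q>0. \<forall>k\<in>{1..K}. \<forall>t\<ge>1.
        measure M {w \<in> space M. \<epsilon> \<le> \<bar>block_mean (\<lambda>j v. Y j v w) k 1 t - \<mu> k\<bar>}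
          \<le> Q * exp (- (real t * b))"
    and C3: "\<And>k l. k \<in> {1..K} \<Longrightarrow> l \<in> {1..K} \<Longrightarrow>
      \<mu> k < best_mean K \<mu> \<Longrightarrow> \<mu> l = best_mean K \<mu> \<Longrightarrow>
      \<exists>b1>0. \<exists>Q1>0. \<exists>t1\<ge>1. \<forall>\<omega>\<le>\<mu> k. \<forall>t\<ge>t1.
        measure M {w \<in> space M. block_mean (\<lambda>j v. Y j v w) l 1 t < \<omega>}
          \<le> Q1 * exp (- (real t * b1)) *
            measure M {w \<in> space M. block_mean (\<lambda>j v. Y j v w) k 1 t < \<omega>}"
begin

abbreviation table :: "'w \<Rightarrow> nat \<Rightarrow> nat \<Rightarrow> real" where
  "table w \<equiv> \<lambda>j v. Y j v w"

text \<open>Only the comparison of means is recorded; the threshold of the procedure reappears as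
  the range of \<open>m\<close> in \<open>lossy\<close>. The event shrinks as \<open>N\<close>
  grows.\<close>

definition loss :: "nat \<Rightarrow> nat \<Rightarrow> nat \<Rightarrow> nat \<Rightarrow> 'w set" where
  "loss l k m N = {w \<in> space M. \<forall>t\<in>{1..N - m + 1}.
     block_mean (table w) l 1 m < block_mean (table w) k t (t + m - 1)}"

lemma Y_measurable [measurable]: "k \<in> {1..K} \<Longrightarrow> 1 \<le> t \<Longrightarrow> Y k t \<in> borel_measurable M"
proof -
  assume "k \<in> {1..K}" "1 \<le> t"
  interpret A: stationary_rewards M S "P k" \<nu> "f k" "X k" "Y k" by (rule arm) fact
  show ?thesis using \<open>1 \<le> t\<close> by simp
qed

lemma block_mean_measurable:
  "k \<in> {1..K} \<Longrightarrow> 1 \<le> s \<Longrightarrow> (\<lambda>w. block_mean (table w) k s u) \<in> borel_measurable M"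
  unfolding block_mean_def by (intro borel_measurable_divide borel_measurable_sum Y_measurable) auto

lemma sets_loss: "k \<in> {1..K} \<Longrightarrow> l \<in> {1..K} \<Longrightarrow> loss l k m N \<in> sets M"
  unfolding loss_def
  by (intro sets.sets_Collect_finite_All borel_measurable_less block_mean_measurable) auto

text \<open>If one of the \<open>n\<close> separated blocks of arm \<open>k\<close> has sum at most
  \<open>x\<close>, then arm \<open>l\<close> can lose only with a mean below
  \<open>x / real m\<close>. Leaving \<open>\<rho>\<close>, \<open>R\<close>, \<open>v\<close> and
  \<open>g\<close> abstract separates this argument from the choice of parameters.\<close>

lemma prob_loss:
  assumes k: "k \<in> {1..K}" and l: "l \<in> {1..K}"
    and mix: "\<And>x m g n q. prob {w \<in> space M. x < (\<Sum>j\<in>{1..<1+m}. Y k j w)} + \<rho> ^ g \<le> q \<Longrightarrow>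
      prob {w \<in> space M. \<forall>i<n. x < (\<Sum>j\<in>{1 + i * (m + g)..<1 + i * (m + g) + m}. Y k j w)} \<le> q ^ n"
    and C3: "\<And>\<omega>. \<omega> \<le> \<mu> k \<Longrightarrow>
        prob {w \<in> space M. block_mean (table w) l 1 m < \<omega>}
          \<le> R * prob {w \<in> space M. block_mean (table w) k 1 m < \<omega>}" "0 \<le> R"
    and v: "0 < v" "v < 1" "v \<le> prob {w \<in> space M. (\<Sum>j\<in>{1..<1+m}. Y k j w) \<le> real m * \<mu> k}"
    and m: "1 \<le> m" and n: "n * (m + g) \<le> N"
  shows "prob (loss l k m N) \<le> (1 - v + \<rho> ^ g) ^ n + R * v"
proof -
  let ?V = "\<lambda>w. \<Sum>j\<in>{1..<1+m}. Y k j w"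
  have V: "?V \<in> borel_measurable M" using k by (intro borel_measurable_sum Y_measurable) auto
  obtain x0 where x0: "prob {w \<in> space M. ?V w < x0} \<le> v" "v \<le> prob {w \<in> space M. ?V w \<le> x0}"
    using quantile_exists[OF V v(1,2)] by blast
  \<comment> \<open>The cap at the mean makes (C3) applicable. It preserves both quantile bounds,
    the lower one because the sum is at most its expectation with probability at least
    \<open>v\<close>.\<close>
  define x where "x = min x0 (real m * \<mu> k)"
  have "prob {w \<in> space M. ?V w < x} \<le> prob {w \<in> space M. ?V w < x0}"
    using V by (intro finite_measure_mono) (auto simp: x_def)
  then have x_lt: "prob {w \<in> space M. ?V w < x} \<le> v" using x0 by linarith
  have x_le: "v \<le> prob {w \<in> space M. ?V w \<le> x}" using x0 v(3) by (auto simp: x_def min_def)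
  have "prob {w \<in> space M. x < ?V w} = 1 - prob {w \<in> space M. ?V w \<le> x}"
    using V by (subst prob_neg[symmetric]) (auto simp: not_le)
  then have q: "prob {w \<in> space M. x < ?V w} + \<rho> ^ g \<le> 1 - v + \<rho> ^ g" using x_le by simp
  define U1 where "U1 = {w \<in> space M. \<forall>i<n. x < (\<Sum>j\<in>{1 + i * (m + g)..<1 + i * (m + g) + m}. Y k j w)}"
  define U2 where "U2 = {w \<in> space M. block_mean (table w) l 1 m < x / real m}"
  have "{w \<in> space M. \<forall>i\<in>{..<n}. x < (\<Sum>j\<in>{1 + i * (m + g)..<1 + i * (m + g) + m}. Y k j w)} \<in> sets M"
    using k by (intro sets.sets_Collect_finite_All borel_measurable_less borel_measurable_sum Y_measurable) auto
  then have U1: "U1 \<in> sets M" unfolding U1_def lessThan_iff Ball_def .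
  have U2: "U2 \<in> sets M" unfolding U2_def
    using l by (intro borel_measurable_less block_mean_measurable) auto
  have "loss l k m N \<subseteq> U1 \<union> U2"
  proof (rule subsetI, rule ccontr)
    fix w assume w: "w \<in> loss l k m N" and "w \<notin> U1 \<union> U2"
    then have sp: "w \<in> space M" and ge: "x / real m \<le> block_mean (table w) l 1 m" and "w \<notin> U1"
      by (auto simp: loss_def U2_def)
    then obtain i where i: "i < n" and le: "(\<Sum>j\<in>{1 + i * (m + g)..<1 + i * (m + g) + m}. Y k j w) \<le> x"
      by (auto simp: U1_def not_less)
    have "Suc i * (m + g) \<le> n * (m + g)" using i by (intro mult_right_mono) auto
    then have "1 + i * (m + g) \<in> {1..N - m + 1}" using n by simp
    then have "block_mean (table w) l 1 m < block_mean (table w) k (1 + i * (m + g)) (1 + i * (m + g) + m - 1)"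
      using w unfolding loss_def by blast
    also have "\<dots> = (\<Sum>j\<in>{1 + i * (m + g)..<1 + i * (m + g) + m}. Y k j w) / real m"
      using m by (rule block_mean_window)
    also have "\<dots> \<le> x / real m" using le by (rule divide_right_mono) simp
    finally show False using ge by simp
  qed
  then have "prob (loss l k m N) \<le> prob (U1 \<union> U2)" using U1 U2 by (intro finite_measure_mono) auto
  also have "\<dots> \<le> prob U1 + prob U2" using U1 U2 by (rule measure_Un_le)
  also have "prob U1 \<le> (1 - v + \<rho> ^ g) ^ n" unfolding U1_def by (rule mix[OF q])
  also have "prob U2 \<le> R * prob {w \<in> space M. block_mean (table w) k 1 m < x / real m}"
    unfolding U2_def using m by (intro C3) (simp add: x_def field_simps)
  also have "{w \<in> space M. block_mean (table w) k 1 m < x / real m} = {w \<in> space M. ?V w < x}"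
    unfolding block_mean_initial[OF m] using m by (simp add: divide_less_cancel del: sum.op_ivl_Suc)
  also have "R * prob \<dots> \<le> R * v" using x_lt C3(2) by (rule mult_left_mono)
  finally show ?thesis by simp
qed

definition opt :: "nat set" where "opt = optimal_arms K \<mu>"
definition sub :: "nat set" where "sub = {1..K} - optimal_arms K \<mu>"

lemma best_mean_ge: "k \<in> {1..K} \<Longrightarrow> \<mu> k \<le> best_mean K \<mu>"
  unfolding best_mean_def by (intro Max_ge) auto

lemma optD: "l \<in> opt \<Longrightarrow> l \<in> {1..K} \<and> \<mu> l = best_mean K \<mu>"
  by (simp add: opt_def optimal_arms_def)

lemma subD: "k \<in> sub \<Longrightarrow> k \<in> {1..K} \<and> \<mu> k < best_mean K \<mu>"
  using best_mean_ge by (fastforce simp: sub_def optimal_arms_def)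

lemma arm_opt_or_sub: "k \<in> {1..K} \<Longrightarrow> k \<notin> opt \<Longrightarrow> k \<in> sub"
  by (simp add: opt_def sub_def)

lemma finite_opt: "finite opt" and finite_sub: "finite sub"
  and card_opt: "card opt \<le> K" and card_sub: "card sub \<le> K"
proof -
  have "opt \<subseteq> {1..K}" "sub \<subseteq> {1..K}" using optD subD by auto
  then show "finite opt" "finite sub" "card opt \<le> K" "card sub \<le> K"
    using card_mono[of "{1..K}"] by (auto dest: finite_subset)
qed

lemma opt_nonempty: "opt \<noteq> {}"
proof -
  have "best_mean K \<mu> \<in> \<mu> ` {1..K}" unfolding best_mean_def using K by (intro Max_in) auto
  then show ?thesis by (auto simp: opt_def optimal_arms_def)
qed

lemma opt_sub_disjoint: "opt \<inter> sub = {}"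
  by (auto simp: opt_def sub_def)

lemma block_mean_stationary:
  assumes k: "k \<in> {1..K}" and s: "1 \<le> s" and m: "1 \<le> m" and B: "B \<in> sets borel"
  shows "prob {w \<in> space M. block_mean (table w) k s (s + m - 1) \<in> B} = prob {w \<in> space M. block_mean (table w) k 1 m \<in> B}"
proof -
  interpret A: stationary_rewards M S "P k" \<nu> "f k" "X k" "Y k" by (rule arm) fact
  let ?B = "(\<lambda>y. y / real m) -` B"
  have B': "?B \<in> sets borel"
    using measurable_sets[OF _ B, of "\<lambda>y. y / real m" borel] by simp
  have "{w \<in> space M. block_mean (table w) k s (s + m - 1) \<in> B} = A.block_event ?B s m" if "1 \<le> s" for s
    unfolding A.block_event_def block_mean_window[OF m] by simp
  from this[OF s] this[of 1] show ?thesis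
    using A.prob_block_stationary[OF s B', of m] by simp
qed

lemma arm_mixing:
  assumes k: "k \<in> {1..K}"
  shows "\<exists>\<rho>. 0 < \<rho> \<and> \<rho> < 1 \<and> (\<forall>x m g n q.
      prob {w \<in> space M. x < (\<Sum>j\<in>{1..<1+m}. Y k j w)} + \<rho> ^ g \<le> q \<longrightarrow>
      prob {w \<in> space M. \<forall>i<n. x < (\<Sum>j\<in>{1 + i * (m + g)..<1 + i * (m + g) + m}. Y k j w)} \<le> q ^ n)"
proof -
  interpret A: stationary_rewards M S "P k" \<nu> "f k" "X k" "Y k" by (rule arm) fact
  \<comment> \<open>The maximum makes the rate positive, so that its logarithm can serve as a
    divisor when gap lengths are chosen.\<close>
  define \<rho> where "\<rho> = max A.mix (1 / 2)"
  have "prob {w \<in> space M. \<forall>i<n. x < (\<Sum>j\<in>{1 + i * (m + g)..<1 + i * (m + g) + m}. Y k j w)} \<le> q ^ n"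
    if q: "prob {w \<in> space M. x < (\<Sum>j\<in>{1..<1+m}. Y k j w)} + \<rho> ^ g \<le> q" for x m g n q
  proof -
    have "A.mix ^ g \<le> \<rho> ^ g" using A.mix_bounds by (intro power_mono) (auto simp: \<rho>_def)
    then have "prob (A.block_event {x<..} 1 m) + A.mix ^ g \<le> q"
      using q unfolding A.block_event_def greaterThan_iff by linarith
    from A.prob_separated_blocks[OF _ this, of n] show ?thesis by simp
  qed
  moreover have "0 < \<rho>" "\<rho> < 1" using A.mix_bounds by (auto simp: \<rho>_def)
  ultimately show ?thesis by blast
qed

lemma arm_below_mean:
  assumes k: "k \<in> {1..K}"
  shows "\<exists>a>0. \<exists>m0\<ge>1. \<forall>m\<ge>m0. a / (real m)\<^sup>2 \<le> prob {w \<in> space M. (\<Sum>j\<in>{1..<1+m}. Y k j w) \<le> real m * \<mu> k}"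
proof -
  interpret A: stationary_rewards M S "P k" \<nu> "f k" "X k" "Y k" by (rule arm) fact
  \<comment> \<open>Deviation 1 of the mean is deviation \<open>real t\<close> of the sum, the scale
    in \<open>prob_below_mean\<close>.\<close>
  obtain b Q where "0 < b" "0 < Q" and C: "\<And>t. 1 \<le> t \<Longrightarrow>
     prob {w \<in> space M. 1 \<le> \<bar>block_mean (table w) k 1 t - \<mu> k\<bar>} \<le> Q * exp (- (real t * b))"
    using C2[of 1] k by auto
  have "prob {w \<in> space M. real t \<le> \<bar>(\<Sum>j\<in>{1..<1+t}. Y k j w) - real t * \<mu> k\<bar>} \<le> Q * exp (- (real t * b))"
    if t: "1 \<le> t" for t
  proof -
    have "(1 \<le> \<bar>z / real t - \<mu> k\<bar>) \<longleftrightarrow> (real t \<le> \<bar>z - real t * \<mu> k\<bar>)" for z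
    proof -
      have "z / real t - \<mu> k = (z - real t * \<mu> k) / real t" using t by (simp add: field_simps)
      then have "\<bar>z / real t - \<mu> k\<bar> = \<bar>z - real t * \<mu> k\<bar> / real t" by simp
      then show ?thesis using t by (simp add: le_divide_eq)
    qed
    then show ?thesis using C[OF t] unfolding block_mean_initial[OF t] by simp
  qed
  from A.prob_below_mean[OF means[OF k] \<open>0 < Q\<close> \<open>0 < b\<close> this]
  show ?thesis by (simp add: A.block_event_def)
qed

lemma eventually_c_large: "eventually (\<lambda>u. B \<le> c u) sequentially"
  and eventually_c_lnln: "eventually (\<lambda>u. B * ln (ln (real u)) \<le> c u) sequentially"
proof -
  have 1: "eventually (\<lambda>u. B \<le> c u / ln (ln (real u))) sequentially" for B
    using c_lower unfolding filterlim_at_top by blast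
  have 2: "eventually (\<lambda>u::nat. 1 \<le> ln (ln (real u))) sequentially" by real_asymp
  have *: "eventually (\<lambda>u. B * ln (ln (real u)) \<le> c u) sequentially" for B
    using 1[of B] 2 by eventually_elim (auto simp: le_divide_eq)
  then show "eventually (\<lambda>u. B * ln (ln (real u)) \<le> c u) sequentially" .
  show "eventually (\<lambda>u. B \<le> c u) sequentially"
    using *[of "max B 0"] 2
  proof eventually_elim
    case (elim u)
    have "max B 0 * 1 \<le> max B 0 * ln (ln (real u))" using elim by (intro mult_left_mono) auto
    with elim show ?case by simp
  qed
qed

lemma prob_loss_asymptotics:
  assumes k: "k \<in> sub" and l: "l \<in> opt" and D: "0 < D"
  shows "\<exists>C\<ge>0. eventually (\<lambda>u. \<forall>m N. 1 \<le> m \<longrightarrow> c u \<le> real m \<longrightarrow> real m \<le> D * ln (real u) \<longrightarrow>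
     real u \<le> real K * real N \<longrightarrow> prob (loss l k m N) \<le> C / (real u * ln (real u))) sequentially"
proof -
  have k': "k \<in> {1..K}" and l': "l \<in> {1..K}" using subD[OF k] optD[OF l] by auto
  obtain \<rho> where \<rho>: "0 < \<rho>" "\<rho> < 1" and mix: "\<And>x m g n q.
      prob {w \<in> space M. x < (\<Sum>j\<in>{1..<1+m}. Y k j w)} + \<rho> ^ g \<le> q \<Longrightarrow>
      prob {w \<in> space M. \<forall>i<n. x < (\<Sum>j\<in>{1 + i * (m + g)..<1 + i * (m + g) + m}. Y k j w)} \<le> q ^ n"
    using arm_mixing[OF k'] by blast
  obtain a m0 where a: "0 < a" and below: "\<And>m. m0 \<le> m \<Longrightarrow>
      a / (real m)\<^sup>2 \<le> prob {w \<in> space M. (\<Sum>j\<in>{1..<1+m}. Y k j w) \<le> real m * \<mu> k}"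
    using arm_below_mean[OF k'] by blast
  obtain b1 Q1 t1 where b1: "0 < b1" and Q1: "0 < Q1" and C3': "\<And>\<omega> t. \<omega> \<le> \<mu> k \<Longrightarrow> t1 \<le> t \<Longrightarrow>
      prob {w \<in> space M. block_mean (table w) l 1 t < \<omega>}
      \<le> Q1 * exp (- (real t * b1)) * prob {w \<in> space M. block_mean (table w) k 1 t < \<omega>}"
    using C3[OF k' l'] subD[OF k] optD[OF l] by blast
  \<comment> \<open>Chosen so that a gap of length at least \<open>A * ln u\<close> has mixing error
    at most \<open>1 / u\<close>.\<close>
  define A where "A = 1 / - ln \<rho>"
  have A: "0 < A" using \<rho> by (simp add: A_def)
  \<comment> \<open>A block together with its gap is at most \<open>E * ln u\<close> long; the final
    1 pays for rounding the gap up.\<close>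
  define E where "E = D + A + 1"
  have E: "0 < E" using A D by (simp add: E_def)
  define H where "H = real K * E"
  have H: "0 < H" using E K by (simp add: H_def)
  \<comment> \<open>The summand \<open>1 / u\<close> cancels the mixing error. There are at least
    \<open>u / (2 * H * ln u)\<close> separated blocks, so the other summand brings the probability
    that all of them exceed the quantile down to \<open>1 / u\<^sup>2\<close>.\<close>
  define v where "v u = 1 / real u + 4 * H * (ln (real u))\<^sup>2 / real u" for u :: nat
  define C where "C = 1 + Q1 * (1 + 4 * H)"
  have "eventually (\<lambda>u::nat. 1 \<le> ln (real u)) sequentially" by real_asymp
  moreover have "eventually (\<lambda>u. v u < 1) sequentially"
    unfolding v_def using H by real_asymp
  moreover have "eventually (\<lambda>u. v u * (D * ln (real u))\<^sup>2 \<le> a) sequentially"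
    unfolding v_def using H D a by real_asymp
  moreover have "eventually (\<lambda>u::nat. 2 * H * ln (real u) \<le> real u) sequentially"
    using H by real_asymp
  moreover have "eventually (\<lambda>u::nat. ln (real u) \<le> real u) sequentially"
    by real_asymp
  \<comment> \<open>With the factor \<open>3 / b1\<close> the exponential in (C3) is at most the
    inverse cube of \<open>ln u\<close>: two powers offset the growth in \<open>v\<close>, the third
    is the one in the claim.\<close>
  moreover note eventually_c_large[of "real (max m0 t1)"] eventually_c_lnln[of "3 / b1"]
  ultimately have "eventually (\<lambda>u. \<forall>m N. 1 \<le> m \<longrightarrow> c u \<le> real m \<longrightarrow> real m \<le> D * ln (real u) \<longrightarrow>
     real u \<le> real K * real N \<longrightarrow> prob (loss l k m N) \<le> C / (real u * ln (real u))) sequentially"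
  proof eventually_elim
    case (elim u)
    define L where "L = ln (real u)"
    have L: "1 \<le> L" and u: "0 < real u" using elim(1) by (auto simp: L_def intro!: Nat.gr0I)
    have uL: "exp L = real u" using u by (simp add: L_def)
    have v01: "0 < v u" "v u < 1" using elim(2) u H by (auto simp: v_def intro!: add_pos_nonneg)
    have expc: "exp (- (c u * b1)) \<le> 1 / L ^ 3"
    proof -
      have "3 * ln L \<le> c u * b1" using elim(7) b1 by (simp add: L_def field_simps)
      then have "exp (- (c u * b1)) \<le> exp (- (3 * ln L))" by simp
      also have "\<dots> = 1 / L ^ 3" using L exp_of_nat_mult[of 3 "ln L"] by (simp add: exp_minus inverse_eq_divide)
      finally show ?thesis .
    qed
    show ?case
    proof (intro allI impI)
      fix m N assume m: "1 \<le> m" "c u \<le> real m" "real m \<le> D * ln (real u)" and N: "real u \<le> real K * real N"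
      define g where "g = nat \<lceil>A * L\<rceil>"
      have g: "A * L \<le> real g" "real g \<le> A * L + 1" using A L by (auto simp: g_def)
      define n where "n = N div (m + g)"
      have n: "n * (m + g) \<le> N" by (simp add: n_def)
      have mg: "real (m + g) \<le> E * L" "0 < real (m + g)"
        using m g L by (auto simp: E_def L_def algebra_simps)
      have "N < (n + 1) * (m + g)"
      proof -
        have r: "N mod (m + g) < m + g" using m by (intro mod_less_divisor) simp
        have "N = n * (m + g) + N mod (m + g)" unfolding n_def by (rule div_mult_mod_eq[symmetric])
        also have "\<dots> < n * (m + g) + (m + g)" using r by (rule add_strict_left_mono)
        finally show ?thesis by (simp only: add_mult_distrib mult_1)
      qed
      then have "real N < (real n + 1) * real (m + g)" by (metis of_nat_1 of_nat_add of_nat_less_iff of_nat_mult)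
      also have "\<dots> \<le> (real n + 1) * (E * L)" using mg by (intro mult_left_mono) auto
      finally have "real K * real N \<le> real K * ((real n + 1) * (E * L))" by (intro mult_left_mono) auto
      then have "real u \<le> (real n + 1) * (H * L)" using N by (simp add: H_def algebra_simps)
      then have nu: "real u \<le> 2 * (H * L) * real n"
        using elim(4) by (simp add: L_def algebra_simps)
      have rg: "\<rho> ^ g \<le> 1 / real u"
      proof -
        have "\<rho> ^ g = exp (real g * ln \<rho>)" using \<rho> by (simp add: exp_of_nat_mult)
        also have "real g * ln \<rho> \<le> A * L * ln \<rho>" using g \<rho> by (intro mult_right_mono_neg) auto
        also have "A * L * ln \<rho> = - L" using \<rho> by (simp add: A_def)
        finally show ?thesis using uL by (simp add: exp_minus inverse_eq_divide)
      qed
      have base: "0 \<le> 1 - v u + \<rho> ^ g" "1 - v u + \<rho> ^ g \<le> exp (- (4 * H * L\<^sup>2 / real u))"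
      proof -
        show "0 \<le> 1 - v u + \<rho> ^ g" using v01 \<rho> by (simp add: add_nonneg_nonneg)
        have "1 - v u + \<rho> ^ g \<le> 1 + - (4 * H * L\<^sup>2 / real u)" using rg by (simp add: v_def L_def)
        also have "\<dots> \<le> exp (- (4 * H * L\<^sup>2 / real u))" by (rule exp_ge_add_one_self)
        finally show "1 - v u + \<rho> ^ g \<le> exp (- (4 * H * L\<^sup>2 / real u))" .
      qed
      have "(1 - v u + \<rho> ^ g) ^ n \<le> exp (- (4 * H * L\<^sup>2 / real u)) ^ n"
        using base by (intro power_mono) auto
      also have "\<dots> = exp (- (2 * L * (2 * (H * L) * real n) / real u))"
        by (simp add: power2_eq_square algebra_simps flip: exp_of_nat_mult)
      also have "\<dots> \<le> exp (- (2 * L))"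
      proof -
        have "2 * L * real u \<le> 2 * L * (2 * (H * L) * real n)" using nu L by (intro mult_left_mono) auto
        then show ?thesis using u by (simp add: le_divide_eq)
      qed
      also have "\<dots> = 1 / (real u * real u)"
        unfolding uL[symmetric] by (simp add: exp_minus inverse_eq_divide flip: exp_add)
      finally have first: "(1 - v u + \<rho> ^ g) ^ n \<le> 1 / (real u * real u)" .
      define R where "R = Q1 * exp (- (real m * b1))"
      have mm: "m0 \<le> m" "t1 \<le> m" using elim(6) m by linarith+
      have vm: "v u \<le> prob {w \<in> space M. (\<Sum>j\<in>{1..<1+m}. Y k j w) \<le> real m * \<mu> k}"
      proof -
        have "v u * (real m)\<^sup>2 \<le> v u * (D * ln (real u))\<^sup>2"
          using m v01 by (intro mult_left_mono power_mono) auto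
        with elim(3) have "v u * (real m)\<^sup>2 \<le> a" by linarith
        then have "v u \<le> a / (real m)\<^sup>2" using m by (simp add: le_divide_eq)
        with below[OF mm(1)] show ?thesis by linarith
      qed
      have R: "R \<le> Q1 * (1 / L ^ 3)"
      proof -
        have "exp (- (real m * b1)) \<le> exp (- (c u * b1))" using m b1 by simp
        then have "exp (- (real m * b1)) \<le> 1 / L ^ 3" using expc by (rule order_trans)
        then show ?thesis unfolding R_def using Q1 by (intro mult_left_mono) auto
      qed
      have v_le: "v u \<le> (1 + 4 * H) * L\<^sup>2 / real u"
      proof -
        have "1 \<le> L\<^sup>2" using L by simp
        then show ?thesis using u by (simp add: v_def L_def divide_right_mono algebra_simps flip: add_divide_distrib)
      qed
      have "R * v u \<le> (Q1 * (1 / L ^ 3)) * ((1 + 4 * H) * L\<^sup>2 / real u)"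
        using R v_le v01 Q1 L by (intro mult_mono) auto
      also have "\<dots> = Q1 * (1 + 4 * H) / (real u * L)"
        using L u by (simp add: field_simps power2_eq_square power3_eq_cube)
      finally have second: "R * v u \<le> Q1 * (1 + 4 * H) / (real u * L)" .
      have "real u * L \<le> real u * real u" using elim(5) u by (intro mult_left_mono) (auto simp: L_def)
      then have "1 / (real u * real u) \<le> 1 / (real u * L)" using u L by (intro divide_left_mono) auto
      with first have first': "(1 - v u + \<rho> ^ g) ^ n \<le> 1 / (real u * L)" by linarith
      have "prob (loss l k m N) \<le> (1 - v u + \<rho> ^ g) ^ n + R * v u"
      proof (rule prob_loss[OF k' l' mix _ _ v01 vm m(1) n])
        show "prob {w \<in> space M. block_mean (table w) l 1 m < \<omega>}
          \<le> R * prob {w \<in> space M. block_mean (table w) k 1 m < \<omega>}" if "\<omega> \<le> \<mu> k" for \<omega>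
          unfolding R_def by (rule C3'[OF that mm(2)])
      qed (use Q1 in \<open>auto simp: R_def\<close>)
      also have "\<dots> \<le> 1 / (real u * L) + Q1 * (1 + 4 * H) / (real u * L)"
        by (rule add_mono[OF first' second])
      also have "\<dots> = C / (real u * ln (real u))" by (simp add: C_def L_def add_divide_distrib)
      finally show "prob (loss l k m N) \<le> C / (real u * ln (real u))" .
    qed
  qed
  moreover have "0 \<le> C" using Q1 H by (simp add: C_def)
  ultimately show ?thesis by blast
qed

text \<open>With all windows \<open>t\<close> the event covers a suboptimal challenger of an optimal
  leader. The case \<open>t = 1\<close> covers the reverse challenge and ties for the lead, both of
  which compare with an initial sample of the optimal arm. Since \<open>m\<close> and
  \<open>t\<close> range up to \<open>u\<close>, one such event serves all earlier rounds
  too.\<close>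

definition close :: "real \<Rightarrow> nat \<Rightarrow> 'w set" where
  "close D u = {w \<in> space M. \<exists>l\<in>opt. \<exists>k\<in>sub. \<exists>m\<in>{1..u}. \<exists>t\<in>{1..u}. D * ln (real u) \<le> real m \<and>
     block_mean (table w) l t (t + m - 1) \<le> block_mean (table w) k 1 m}"

text \<open>Every leader of round \<open>u\<close> has at least \<open>u / K\<close> observations,
  which fixes the last argument of \<open>loss\<close>. Sizes below \<open>c u\<close> are left out
  because a challenger that small and behind the leader wins outright.\<close>

definition lossy :: "real \<Rightarrow> nat \<Rightarrow> nat \<Rightarrow> 'w set" where
  "lossy D l u = (\<Union>k\<in>sub. \<Union>m\<in>{m \<in> {1..u}. c u \<le> real m \<and> real m < D * ln (real u)}.
     loss l k m (nat \<lceil>real u / real K\<rceil>))"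

lemma gap_exists: "\<exists>\<epsilon>>0. \<forall>k\<in>sub. \<mu> k + 2 * \<epsilon> \<le> best_mean K \<mu>"
proof (cases "sub = {}")
  case True
  then show ?thesis by (auto intro: exI[of _ 1])
next
  case False
  define d where "d = Min ((\<lambda>k. best_mean K \<mu> - \<mu> k) ` sub)"
  have "d \<in> (\<lambda>k. best_mean K \<mu> - \<mu> k) ` sub" unfolding d_def using False finite_sub by (intro Min_in) auto
  then have "0 < d" using subD by auto
  moreover have "d \<le> best_mean K \<mu> - \<mu> k" if "k \<in> sub" for k
    unfolding d_def using that finite_sub by (intro Min_le) auto
  ultimately show ?thesis by (intro exI[of _ "d / 2"]) force
qed

lemma sets_close: "close D u \<in> sets M"
proof -
  have ev: "{w \<in> space M. D * ln (real u) \<le> real m \<and>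
     block_mean (table w) l t (t + m - 1) \<le> block_mean (table w) k 1 m} \<in> sets M"
    if "l \<in> opt" "k \<in> sub" "t \<in> {1..u}" for l k m t
  proof -
    have "(\<lambda>w. block_mean (table w) l t (t + m - 1)) \<in> borel_measurable M"
      "(\<lambda>w. block_mean (table w) k 1 m) \<in> borel_measurable M"
      using that optD subD by (auto intro!: block_mean_measurable)
    then show ?thesis by measurable
  qed
  show ?thesis unfolding close_def
    by (intro sets.sets_Collect_finite_Ex finite_opt finite_sub finite_atLeastAtMost) (rule ev)
qed

lemma sets_lossy: "l \<in> opt \<Longrightarrow> lossy D l u \<in> sets M"
  unfolding lossy_def using optD subD finite_sub by (intro sets.finite_UN sets_loss) auto

lemma prob_close:
  "\<exists>D>0. \<exists>C\<ge>0. \<forall>u\<ge>1. prob (close D u) \<le> C / real u ^ 3"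
proof -
  obtain \<epsilon> where \<epsilon>: "0 < \<epsilon>" and gap: "\<And>k. k \<in> sub \<Longrightarrow> \<mu> k + 2 * \<epsilon> \<le> best_mean K \<mu>"
    using gap_exists by blast
  obtain b Q where b: "0 < b" and Q: "0 < Q" and conc: "\<And>k t. k \<in> {1..K} \<Longrightarrow> 1 \<le> t \<Longrightarrow>
     prob {w \<in> space M. \<epsilon> \<le> \<bar>block_mean (table w) k 1 t - \<mu> k\<bar>} \<le> Q * exp (- (real t * b))"
    using C2[OF \<epsilon>] by blast
  \<comment> \<open>The factor 5 bounds each deviation probability by a multiple of \<open>u\<close>
    to the power -5. The index tuples number at most \<open>K\<^sup>2 * u\<^sup>2\<close>, which
    leaves the power -3.\<close>
  define D where "D = 5 / b"
  have D: "0 < D" using b by (simp add: D_def)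
  define C where "C = 2 * Q * (real K)\<^sup>2"
  have "prob (close D u) \<le> C / real u ^ 3" if u: "1 \<le> u" for u
  proof -
    define far where "far k s m = {w \<in> space M. \<epsilon> \<le> \<bar>block_mean (table w) k s (s + m - 1) - \<mu> k\<bar>}" for k s m
    define J where "J = opt \<times> sub \<times> {m \<in> {1..u}. D * ln (real u) \<le> real m} \<times> {1..u}"
    have far: "far k s m \<in> sets M" if "k \<in> {1..K}" "1 \<le> s" for k s m
      using block_mean_measurable[OF that, of "s + m - 1"] unfolding far_def by measurable
    have far_prob: "prob (far k s m) \<le> Q / real u ^ 5"
      if "k \<in> {1..K}" "1 \<le> s" "1 \<le> m" "D * ln (real u) \<le> real m" for k s m
    proof -
      have "prob (far k s m) = prob {w \<in> space M. \<epsilon> \<le> \<bar>block_mean (table w) k 1 m - \<mu> k\<bar>}"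
        using block_mean_stationary[OF that(1,2,3), of "{y. \<epsilon> \<le> \<bar>y - \<mu> k\<bar>}"] by (simp add: far_def)
      also have "\<dots> \<le> Q * exp (- (real m * b))" by (intro conc that)
      also have "\<dots> \<le> Q * exp (- (5 * ln (real u)))"
        using that(4) b Q by (intro mult_left_mono) (auto simp: D_def field_simps)
      also have "exp (- (5 * ln (real u))) = 1 / real u ^ 5"
        using u exp_of_nat_mult[of 5 "ln (real u)"] by (simp add: exp_minus inverse_eq_divide)
      finally show ?thesis by simp
    qed
    have J: "finite J" unfolding J_def using finite_opt finite_sub by auto
    have cardJ: "real (card J) \<le> (real K)\<^sup>2 * (real u)\<^sup>2"
    proof -
      have "card {m \<in> {1..u}. D * ln (real u) \<le> real m} \<le> card {1..u}" by (intro card_mono) auto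
      then have "card J \<le> K * (K * (u * u))"
        unfolding J_def card_cartesian_product using card_opt card_sub by (intro mult_le_mono) auto
      then have "real (card J) \<le> real (K * (K * (u * u)))" by (rule of_nat_mono)
      then show ?thesis by (simp add: power2_eq_square mult_ac)
    qed
    have sub: "close D u \<subseteq> (\<Union>(l, k, m, t)\<in>J. far l t m \<union> far k 1 m)"
    proof
      fix w assume "w \<in> close D u"
      then obtain l k m t where *: "w \<in> space M" "l \<in> opt" "k \<in> sub" "m \<in> {1..u}" "t \<in> {1..u}" "D * ln (real u) \<le> real m"
        "block_mean (table w) l t (t + m - 1) \<le> block_mean (table w) k 1 m"
        unfolding close_def by blast
      have "w \<in> far l t m \<union> far k 1 m"
      proof (rule ccontr)
        assume "w \<notin> far l t m \<union> far k 1 m"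
        then have "\<bar>block_mean (table w) l t (t + m - 1) - \<mu> l\<bar> < \<epsilon>" "\<bar>block_mean (table w) k 1 m - \<mu> k\<bar> < \<epsilon>"
          using * by (auto simp: far_def)
        then show False using *(7) gap[OF *(3)] optD[OF *(2)] by linarith
      qed
      moreover have "(l, k, m, t) \<in> J" using * by (auto simp: J_def)
      ultimately show "w \<in> (\<Union>(l, k, m, t)\<in>J. far l t m \<union> far k 1 m)" by blast
    qed
    have far_J: "(case j of (l, k, m, t) \<Rightarrow> far l t m \<union> far k 1 m) \<in> sets M \<and>
        prob (case j of (l, k, m, t) \<Rightarrow> far l t m \<union> far k 1 m) \<le> 2 * Q / real u ^ 5" if "j \<in> J" for j
    proof -
      obtain l k m t where j: "j = (l, k, m, t)" by (cases j)
      have *: "l \<in> {1..K}" "k \<in> {1..K}" "1 \<le> m" "1 \<le> t" "D * ln (real u) \<le> real m"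
        using that optD subD by (auto simp: J_def j)
      have "prob (far l t m \<union> far k 1 m) \<le> prob (far l t m) + prob (far k 1 m)"
        using * by (intro measure_Un_le far) auto
      also have "\<dots> \<le> Q / real u ^ 5 + Q / real u ^ 5" using * by (intro add_mono far_prob) auto
      finally show ?thesis using * far by (simp add: j sets.Un)
    qed
    have "prob (close D u) \<le> prob (\<Union>(l, k, m, t)\<in>J. far l t m \<union> far k 1 m)"
      using sub far_J J by (intro finite_measure_mono sets.finite_UN) auto
    also have "\<dots> \<le> (\<Sum>j\<in>J. prob (case j of (l, k, m, t) \<Rightarrow> far l t m \<union> far k 1 m))"
      using J far_J by (intro measure_UNION_le) auto
    also have "\<dots> \<le> (\<Sum>j\<in>J. 2 * Q / real u ^ 5)" using far_J by (intro sum_mono) auto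
    also have "\<dots> = real (card J) * (2 * Q / real u ^ 5)" by simp
    also have "\<dots> \<le> ((real K)\<^sup>2 * (real u)\<^sup>2) * (2 * Q / real u ^ 5)"
      using cardJ Q by (intro mult_right_mono) auto
    also have "\<dots> = C / real u ^ 3" using u by (simp add: C_def field_simps power_numeral_reduce)
    finally show ?thesis .
  qed
  then show ?thesis using D Q by (intro exI[of _ D] conjI exI[of _ C]) (auto simp: C_def)
qed

lemma prob_lossy:
  assumes l: "l \<in> opt" and D: "0 < D"
  shows "\<exists>C\<ge>0. eventually (\<lambda>u. prob (lossy D l u) \<le> C / real u) sequentially"
proof -
  have all: "\<forall>k\<in>sub. \<exists>C\<ge>0. eventually (\<lambda>u. \<forall>m N. 1 \<le> m \<longrightarrow> c u \<le> real m \<longrightarrow> real m \<le> D * ln (real u) \<longrightarrow>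
     real u \<le> real K * real N \<longrightarrow> prob (loss l k m N) \<le> C / (real u * ln (real u))) sequentially"
    by (intro ballI prob_loss_asymptotics l D)
  obtain C where CC: "\<forall>k\<in>sub. 0 \<le> C k \<and>
     eventually (\<lambda>u. \<forall>m N. 1 \<le> m \<longrightarrow> c u \<le> real m \<longrightarrow> real m \<le> D * ln (real u) \<longrightarrow>
     real u \<le> real K * real N \<longrightarrow> prob (loss l k m N) \<le> C k / (real u * ln (real u))) sequentially"
    using bchoice[OF all] by (rule exE)
  then have C: "\<And>k. k \<in> sub \<Longrightarrow> 0 \<le> C k" by simp
  have "eventually (\<lambda>u. \<forall>k\<in>sub. \<forall>m N. 1 \<le> m \<longrightarrow> c u \<le> real m \<longrightarrow> real m \<le> D * ln (real u) \<longrightarrow>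
     real u \<le> real K * real N \<longrightarrow> prob (loss l k m N) \<le> C k / (real u * ln (real u))) sequentially"
    using CC by (intro eventually_ball_finite finite_sub ballI) (drule (1) bspec, erule conjunct2)
  moreover have "eventually (\<lambda>u::nat. 1 \<le> ln (real u)) sequentially" by real_asymp
  ultimately have "eventually (\<lambda>u. prob (lossy D l u) \<le> (D * (\<Sum>k\<in>sub. C k)) / real u) sequentially"
  proof eventually_elim
    case (elim u)
    have u: "0 < real u" using elim(2) by (auto intro!: Nat.gr0I)
    define J where "J = {m \<in> {1..u}. c u \<le> real m \<and> real m < D * ln (real u)}"
    define N where "N = nat \<lceil>real u / real K\<rceil>"
    have N: "real u \<le> real K * real N"
    proof -
      have "real u / real K \<le> real N" by (simp add: N_def)
      then show ?thesis using K by (simp add: field_simps)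
    qed
    \<comment> \<open>The number of admissible sizes supplies the factor \<open>ln u\<close> that
      cancels the one in the bound for a single loss.\<close>
    have J: "finite J" "real (card J) \<le> D * ln (real u)"
    proof -
      show "finite J" by (simp add: J_def)
      have "J \<subseteq> {1..nat \<lfloor>D * ln (real u)\<rfloor>}" by (auto simp: J_def le_nat_floor)
      then have "card J \<le> nat \<lfloor>D * ln (real u)\<rfloor>" using card_mono[of "{1..nat \<lfloor>D * ln (real u)\<rfloor>}" J] by simp
      then show "real (card J) \<le> D * ln (real u)" using D elim(2) by (simp add: le_nat_floor le_nat_iff le_floor_iff)
    qed
    have meas: "loss l k m N \<in> sets M" if "k \<in> sub" for k m
      using subD[OF that] optD[OF l] by (intro sets_loss) auto
    have "prob (lossy D l u) \<le> (\<Sum>k\<in>sub. prob (\<Union>m\<in>J. loss l k m N))"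
      unfolding lossy_def J_def[symmetric] N_def[symmetric]
      using finite_sub meas J by (intro measure_UNION_le) auto
    also have "\<dots> \<le> (\<Sum>k\<in>sub. \<Sum>m\<in>J. prob (loss l k m N))"
      using meas J by (intro sum_mono measure_UNION_le) auto
    also have "\<dots> \<le> (\<Sum>k\<in>sub. \<Sum>m\<in>J. C k / (real u * ln (real u)))"
    proof (intro sum_mono)
      fix k m assume "k \<in> sub" "m \<in> J"
      then show "prob (loss l k m N) \<le> C k / (real u * ln (real u))"
        using elim(1) N by (auto simp: J_def)
    qed
    also have "\<dots> = real (card J) * (\<Sum>k\<in>sub. C k) / (real u * ln (real u))"
      by (simp add: sum_distrib_left sum_divide_distrib)
    also have "\<dots> \<le> (D * ln (real u)) * (\<Sum>k\<in>sub. C k) / (real u * ln (real u))"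
      using J elim(2) u C by (intro divide_right_mono mult_right_mono sum_nonneg) auto
    also have "\<dots> = (D * (\<Sum>k\<in>sub. C k)) / real u"
    proof -
      have "(D * L) * s / (r * L) = (D * s) / r" if "1 \<le> L" for L s r :: real
        using that by simp
      then show ?thesis using elim(2) .
    qed
    finally show ?case .
  qed
  then show ?thesis using D C by (intro exI[of _ "D * (\<Sum>k\<in>sub. C k)"]) (auto intro!: mult_nonneg_nonneg sum_nonneg)
qed

end

section \<open>Sample paths of subsample-mean comparison\<close>

locale ssmc_run =
  fixes K :: nat and c :: "nat \<Rightarrow> real" and y :: "nat \<Rightarrow> nat \<Rightarrow> real" and \<tau> :: "nat \<Rightarrow> nat set \<Rightarrow> nat"
  assumes K: "2 \<le> K"
    and draw: "\<And>r A. 2 \<le> r \<Longrightarrow> A \<subseteq> {1..K} \<Longrightarrow> A \<noteq> {} \<Longrightarrow> \<tau> r A \<in> A"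
begin

abbreviation n where "n \<equiv> ssmc_count K c y \<tau>"

definition sampled :: "nat \<Rightarrow> nat set" where
  "sampled r = fst (ssmc_round K c y \<tau> r (ssmc_state K c y \<tau> (r - 1)))"

text \<open>Round 1 has no leader, so the value at \<open>r = 1\<close> carries no meaning; its uses
  are restricted to \<open>2 \<le> r\<close>.\<close>

definition lead :: "nat \<Rightarrow> nat" where
  "lead r = leader K y (\<tau> r) (n r) (snd (ssmc_state K c y \<tau> (r - 1)))"

lemma count_eq: "n r = fst (ssmc_state K c y \<tau> (r - 1))"
  by (rule ext) (simp add: ssmc_count_def)

lemma count_Suc: "1 \<le> r \<Longrightarrow> n (Suc r) k = n r k + (if k \<in> sampled r then 1 else 0)"
  by (cases r) (auto simp: ssmc_count_def sampled_def Let_def split: prod.splits)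

lemma sampled_1: "sampled 1 = {1..K}"
  by (simp add: sampled_def ssmc_round_def)

lemma sampled_eq: "2 \<le> r \<Longrightarrow> sampled r = sampled_arms K c y (n r) (lead r)"
  by (simp add: sampled_def ssmc_round_def lead_def count_eq Let_def)

lemma count_1: "n 1 k = 0"
  by (simp add: ssmc_count_def)

lemma tied_arms_nonempty: "tied_arms K y m \<noteq> {}"
proof -
  have "Max (m ` {1..K}) \<in> m ` {1..K}" using K by (intro Max_in) auto
  then obtain a where "a \<in> {1..K}" "m a = Max (m ` {1..K})" by auto
  then have a: "a \<in> most_sampled K m" by (auto simp: most_sampled_def)
  have fin: "finite (most_sampled K m)" by (simp add: most_sampled_def)
  let ?b = "\<lambda>k. block_mean y k 1 (m k)"
  have "Max (?b ` most_sampled K m) \<in> ?b ` most_sampled K m" using a fin by (intro Max_in) auto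
  then obtain k where "k \<in> most_sampled K m" "?b k = Max (?b ` most_sampled K m)" by auto
  then have "k \<in> tied_arms K y m" using fin by (auto simp: tied_arms_def)
  then show ?thesis by blast
qed

lemma lead_tied: "2 \<le> r \<Longrightarrow> lead r \<in> tied_arms K y (n r)"
proof -
  assume "2 \<le> r"
  moreover have "tied_arms K y (n r) \<subseteq> {1..K}" by (auto simp: tied_arms_def most_sampled_def)
  ultimately show ?thesis
    using draw tied_arms_nonempty by (auto simp: lead_def leader_def split: option.splits)
qed

lemma lead_arm: "2 \<le> r \<Longrightarrow> lead r \<in> {1..K}"
  and lead_max: "2 \<le> r \<Longrightarrow> j \<in> {1..K} \<Longrightarrow> n r j \<le> n r (lead r)"
  using lead_tied[of r] by (auto simp: tied_arms_def most_sampled_def)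

lemma lead_tie:
  assumes "2 \<le> r" "j \<in> {1..K}" "n r j = n r (lead r)"
  shows "block_mean y j 1 (n r j) \<le> block_mean y (lead r) 1 (n r j)"
proof -
  have "j \<in> most_sampled K (n r)" using assms lead_max by (auto simp: most_sampled_def)
  then show ?thesis using lead_tied[OF assms(1)] assms(3) by (auto simp: tied_arms_def)
qed

lemma sampled_subset: "1 \<le> r \<Longrightarrow> sampled r \<subseteq> {1..K}"
  using sampled_1 sampled_eq[of r] lead_arm[of r]
  by (cases "r = 1") (auto simp: sampled_arms_def Let_def split: if_splits)

lemma sampled_nonempty: "1 \<le> r \<Longrightarrow> sampled r \<noteq> {}"
  using sampled_1 sampled_eq[of r] K
  by (cases "r = 1") (auto simp: sampled_arms_def Let_def)

lemma sampled_challenger: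
  "2 \<le> r \<Longrightarrow> k \<in> sampled r \<Longrightarrow> k \<noteq> lead r \<Longrightarrow> challenger_wins K c y (n r) (lead r) k"
  using sampled_eq[of r] by (auto simp: sampled_arms_def Let_def split: if_splits)

lemma challenger_sampled:
  assumes "2 \<le> r" "k \<in> {1..K}" "challenger_wins K c y (n r) (lead r) k"
  shows "k \<in> sampled r" "lead r \<notin> sampled r"
proof -
  have "k \<noteq> lead r" using assms(3) by (auto simp: challenger_wins_def)
  then show "k \<in> sampled r" "lead r \<notin> sampled r"
    using sampled_eq[OF assms(1)] assms by (auto simp: sampled_arms_def Let_def)
qed

lemma count_mono: "1 \<le> r \<Longrightarrow> r \<le> r' \<Longrightarrow> n r k \<le> n r' k"
proof -
  assume r: "1 \<le> r" and "r \<le> r'"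
  from this(2) show ?thesis
    by (induction r' rule: dec_induct) (use r in \<open>auto simp: count_Suc\<close>)
qed

lemma count_le: "1 \<le> r \<Longrightarrow> n r k \<le> r - 1"
proof (induction r rule: nat_induct_at_least)
  case base
  then show ?case by (simp add: count_1[simplified])
next
  case (Suc r)
  then show ?case by (auto simp: count_Suc)
qed

lemma count_pos: "2 \<le> r \<Longrightarrow> k \<in> {1..K} \<Longrightarrow> 1 \<le> n r k"
  using count_mono[of 2 r k] count_Suc[of 1 k] sampled_1 by (auto simp: numeral_2_eq_2)

lemma total_Suc: "1 \<le> r \<Longrightarrow> ssmc_total K c y \<tau> (Suc r) = ssmc_total K c y \<tau> r + card (sampled r)"
proof -
  assume r: "1 \<le> r"
  have "ssmc_total K c y \<tau> (Suc r) = (\<Sum>k=1..K. n r k + (if k \<in> sampled r then 1 else 0))"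
    unfolding ssmc_total_def by (rule sum.cong) (simp_all add: count_Suc[OF r])
  also have "\<dots> = ssmc_total K c y \<tau> r + card ({1..K} \<inter> sampled r)"
    by (simp add: sum.distrib ssmc_total_def sum.If_cases)
  also have "{1..K} \<inter> sampled r = sampled r" using sampled_subset[OF r] by auto
  finally show ?thesis .
qed

lemma total_strict: "1 \<le> r \<Longrightarrow> ssmc_total K c y \<tau> r < ssmc_total K c y \<tau> (Suc r)"
  using sampled_nonempty[of r] sampled_subset[of r] finite_subset[of "sampled r" "{1..K}"]
  by (simp add: total_Suc card_gt_0_iff)

lemma total_1: "ssmc_total K c y \<tau> 1 = 0"
  by (simp add: ssmc_total_def count_1[simplified])

lemma total_ge: "1 \<le> r \<Longrightarrow> r - 1 \<le> ssmc_total K c y \<tau> r"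
proof (induction r rule: nat_induct_at_least)
  case (Suc r)
  with total_strict[of r] show ?case by simp
qed simp

text \<open>Every completed round adds an observation, and round 1 adds \<open>K \<ge> 2\<close>,
  which makes up for round \<open>r\<close> itself being still to come.\<close>

lemma total_ge': "2 \<le> r \<Longrightarrow> r \<le> ssmc_total K c y \<tau> r"
proof (induction r rule: nat_induct_at_least)
  case base
  have "ssmc_total K c y \<tau> (Suc 1) = K" using total_Suc[of 1] total_1 sampled_1 by simp
  then show ?case using K by (simp add: numeral_2_eq_2)
next
  case (Suc r)
  with total_strict[of r] show ?case by simp
qed

lemma total_le: "1 \<le> r \<Longrightarrow> ssmc_total K c y \<tau> r \<le> K * r"
proof -
  assume "1 \<le> r"
  then have "ssmc_total K c y \<tau> r \<le> (\<Sum>k=1..K. r)"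
    unfolding ssmc_total_def using count_le[of r] by (intro sum_mono) (meson diff_le_self le_trans)
  then show ?thesis by simp
qed

lemma lead_count_ge: "2 \<le> r \<Longrightarrow> r \<le> K * n r (lead r)"
proof -
  assume r: "2 \<le> r"
  have "r \<le> ssmc_total K c y \<tau> r" by (rule total_ge'[OF r])
  also have "\<dots> \<le> (\<Sum>k=1..K. n r (lead r))"
    unfolding ssmc_total_def using lead_max[OF r] by (intro sum_mono) auto
  finally show ?thesis by simp
qed

text \<open>A challenger level with the leader loses, so one that is sampled was strictly behind and
  can at most draw level.\<close>

lemma count_Suc_le_lead:
  assumes "2 \<le> r" "j \<in> {1..K}" "j \<noteq> lead r"
  shows "n (Suc r) j \<le> n r (lead r)"
proof (cases "j \<in> sampled r")
  case True
  then have "n r j < n r (lead r)"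
    using sampled_challenger[OF assms(1) _ assms(3)] by (auto simp: challenger_wins_def)
  then show ?thesis using assms(1) by (simp add: count_Suc)
next
  case False
  then show ?thesis using assms lead_max[OF assms(1,2)] by (simp add: count_Suc)
qed

text \<open>As challengers can only draw level, the lead changes hands only at a tie in counts,
  where sample means decide.\<close>

lemma new_leader_tied:
  assumes r: "2 \<le> r" and ne: "lead (Suc r) \<noteq> lead r"
  shows "n (Suc r) (lead r) = n (Suc r) (lead (Suc r))"
proof -
  have a: "lead (Suc r) \<in> {1..K}" "lead r \<in> {1..K}" using lead_arm r by auto
  have "n (Suc r) (lead (Suc r)) \<le> n r (lead r)" using count_Suc_le_lead[OF r a(1) ne] .
  moreover have "n r (lead r) \<le> n (Suc r) (lead r)" using r by (simp add: count_Suc)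
  moreover have "n (Suc r) (lead r) \<le> n (Suc r) (lead (Suc r))" using r by (intro lead_max a) simp
  ultimately show ?thesis by linarith
qed

text \<open>If round \<open>r\<close> is in progress at observation \<open>N\<close>, then
  \<open>r - 1\<close> is at most the total before that round, hence at most \<open>N\<close>.
  Monotonicity passes to round \<open>Suc N\<close>, and the incomplete round adds at most one
  observation.\<close>

lemma alloc_le:
  "ssmc_alloc K c y \<tau> \<sigma> N k \<le> n (Suc N) k + 1"
proof -
  let ?T = "ssmc_total K c y \<tau>"
  let ?Q = "\<lambda>r. 1 \<le> r \<and> ?T r \<le> N \<and> N < ?T (Suc r)"
  have mono: "?T r \<le> ?T r'" if "1 \<le> r" "r \<le> r'" for r r'
    using that(2)
  proof (induction r' rule: dec_induct)
    case (step i)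
    then show ?case using total_strict[of i] that(1) by simp
  qed simp
  define r where "r = (LEAST r. 1 \<le> r \<and> N < ?T (Suc r))"
  have "1 \<le> Suc N \<and> N < ?T (Suc (Suc N))" using total_ge[of "Suc (Suc N)"] by simp
  then have r: "1 \<le> r \<and> N < ?T (Suc r)" unfolding r_def by (rule LeastI)
  have "?T r \<le> N"
  proof (cases "r = 1")
    case True
    then show ?thesis by (simp only: total_1)
  next
    case False
    then have "\<not> (1 \<le> r - 1 \<and> N < ?T (Suc (r - 1)))"
      using r unfolding r_def by (intro not_less_Least) simp
    then show ?thesis using r False by auto
  qed
  then have Q: "?Q r" using r by simp
  have uniq: "r' = r" if "?Q r'" for r'
  proof (rule ccontr)
    assume "r' \<noteq> r"
    then consider "Suc r \<le> r'" | "Suc r' \<le> r" by linarith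
    then show False
      by cases (use mono[of "Suc r" r'] mono[of "Suc r'" r] Q that in auto)
  qed
  have "(THE r. ?Q r) = r" using Q uniq by (rule the_equality)
  moreover have "r - 1 \<le> N" using total_ge[of r] Q le_trans by blast
  then have "r \<le> Suc N" by linarith
  then have "n r k \<le> n (Suc N) k" using Q by (intro count_mono) auto
  ultimately show ?thesis by (simp add: ssmc_alloc_def Let_def)
qed

end

text \<open>By \<open>log_small\<close>, a leader from round \<open>v0\<close> on has reached the
  sample size \<open>D * ln u\<close> at which misranking counts as \<open>close_at\<close>.\<close>

locale ssmc_analysis = ssmc_run +
  fixes opt sub :: "nat set" and D :: real and v0 :: nat
  assumes split_arms: "opt \<union> sub = {1..K}" "opt \<inter> sub = {}"
    and c_mono: "mono c"
    and v0: "2 \<le> v0"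
    and log_small: "\<And>u. v0 \<le> u \<Longrightarrow> D * ln (real u) \<le> real u / real K"
begin

definition close_at :: "nat \<Rightarrow> bool" where
  "close_at u \<longleftrightarrow> (\<exists>l\<in>opt. \<exists>k\<in>sub. \<exists>m\<in>{1..u}. \<exists>t\<in>{1..u}. D * ln (real u) \<le> real m \<and>
     block_mean y l t (t + m - 1) \<le> block_mean y k 1 m)"

definition lossy_at :: "nat \<Rightarrow> nat \<Rightarrow> bool" where
  "lossy_at l u \<longleftrightarrow> (\<exists>k\<in>sub. \<exists>m\<in>{1..u}. c u \<le> real m \<and> real m < D * ln (real u) \<and>
     (\<forall>t\<in>{1..nat \<lceil>real u / real K\<rceil> - m + 1}. block_mean y l 1 m < block_mean y k t (t + m - 1)))"

lemma arm_cases: "j \<in> {1..K} \<Longrightarrow> j \<in> opt \<or> j \<in> sub"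
  using split_arms(1) by blast

lemma close_atI:
  "l \<in> opt \<Longrightarrow> k \<in> sub \<Longrightarrow> 1 \<le> m \<Longrightarrow> m \<le> u \<Longrightarrow> 1 \<le> t \<Longrightarrow> t \<le> u \<Longrightarrow> D * ln (real u) \<le> real m \<Longrightarrow>
    block_mean y l t (t + m - 1) \<le> block_mean y k 1 m \<Longrightarrow> close_at u"
  unfolding close_at_def by force

lemma lead_count_large:
  assumes "v0 \<le> u"
  shows "D * ln (real u) \<le> real (n u (lead u))" "nat \<lceil>real u / real K\<rceil> \<le> n u (lead u)"
proof -
  have "real u \<le> real K * real (n u (lead u))"
    using lead_count_ge[of u] v0 assms by (simp flip: of_nat_mult)
  then have le: "real u / real K \<le> real (n u (lead u))" using K by (simp add: field_simps)
  then show "D * ln (real u) \<le> real (n u (lead u))" using log_small[OF assms] by linarith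
  show "nat \<lceil>real u / real K\<rceil> \<le> n u (lead u)" using le by (simp add: nat_le_iff ceiling_le_iff)
qed

text \<open>If \<open>l\<close> were level with the leader, the tie rule would give the suboptimal
  arm the larger mean on a large sample. If \<open>l\<close> were behind and lost its challenge, it
  would have a large sample and be misranked, or one between the threshold and
  \<open>D * ln u\<close> and be lossy.\<close>

lemma optimal_arm_sampled:
  assumes u: "v0 \<le> u" and lead: "lead u \<in> sub" and l: "l \<in> opt"
    and "\<not> close_at u" "\<not> lossy_at l u"
  shows "l \<in> sampled u \<and> lead u \<notin> sampled u"
proof -
  have u2: "2 \<le> u" using u v0 by simp
  have lK: "l \<in> {1..K}" and ne: "l \<noteq> lead u" using l lead split_arms by auto
  have m: "1 \<le> n u l" "n u l \<le> u" "n u l \<le> n u (lead u)"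
    using count_pos[OF u2 lK] count_le[of u l] u2 lead_max[OF u2 lK] by auto
  have lt: "n u l < n u (lead u)"
  proof (rule ccontr)
    assume "\<not> ?thesis"
    then have eq: "n u l = n u (lead u)" using m by simp
    have "close_at u"
      using close_atI[OF l lead m(1,2), of 1] lead_tie[OF u2 lK eq] lead_count_large(1)[OF u] eq u2 by simp
    then show False using assms by blast
  qed
  have "challenger_wins K c y (n u) (lead u) l"
  proof (rule ccontr)
    assume "\<not> ?thesis"
    then have c: "c (ssmc_total K c y \<tau> u) \<le> real (n u l)"
      and below: "\<And>t. t \<in> {1..n u (lead u) - n u l + 1} \<Longrightarrow>
        block_mean y l 1 (n u l) < block_mean y (lead u) t (t + n u l - 1)"
      using lt by (auto simp: challenger_wins_def ssmc_total_def not_less not_le)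
    \<comment> \<open>The procedure evaluates the threshold at the total number of observations,
      which is at least \<open>u\<close>.\<close>
    have cu: "c u \<le> real (n u l)"
      using c monoD[OF c_mono total_ge'[OF u2]] by linarith
    show False
    proof (cases "D * ln (real u) \<le> real (n u l)")
      case True
      have "block_mean y l 1 (n u l) < block_mean y (lead u) 1 (n u l)" using below[of 1] by simp
      then have "close_at u" using close_atI[OF l lead m(1,2), of 1] True u2 by simp
      then show False using assms by blast
    next
      case False
      have "lossy_at l u"
        unfolding lossy_at_def
      proof (rule bexI[of _ "lead u"], rule bexI[of _ "n u l"], intro conjI ballI)
        fix t assume "t \<in> {1..nat \<lceil>real u / real K\<rceil> - n u l + 1}"
        \<comment> \<open>Losing against all windows of the actual sample of the leader includes the
          windows of the shorter guaranteed sample.\<close>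
        moreover have "nat \<lceil>real u / real K\<rceil> - n u l \<le> n u (lead u) - n u l"
          by (intro diff_le_mono lead_count_large u)
        ultimately have "t \<in> {1..n u (lead u) - n u l + 1}" unfolding atLeastAtMost_iff by linarith
        then show "block_mean y l 1 (n u l) < block_mean y (lead u) t (t + n u l - 1)" by (rule below)
      qed (use lead m False cu in auto)
      then show False using assms by blast
    qed
  qed
  then show ?thesis using challenger_sampled[OF u2 lK] by blast
qed

text \<open>The change happens at a tie on a large sample, so the suboptimal arm takes over only
  with a mean at least that of the optimal one.\<close>

lemma leader_change_close:
  assumes u: "v0 \<le> u" and opt: "lead u \<in> opt" and sub: "lead (Suc u) \<in> sub"
  shows "close_at (Suc u)"
proof -
  have u2: "2 \<le> u" using u v0 by simp
  have ne: "lead (Suc u) \<noteq> lead u" and K: "lead u \<in> {1..K}" using opt sub split_arms by auto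
  have eq: "n (Suc u) (lead u) = n (Suc u) (lead (Suc u))" using new_leader_tied[OF u2 ne] .
  have "1 \<le> n (Suc u) (lead u)" "n (Suc u) (lead u) \<le> Suc u"
    using count_pos[of "Suc u", OF _ K] count_le[of "Suc u" "lead u"] u2 by auto
  then show ?thesis
    using close_atI[OF opt sub, of "n (Suc u) (lead u)" "Suc u" 1] lead_tie[of "Suc u", OF _ K eq]
      lead_count_large(1)[of "Suc u"] eq u u2 by simp
qed

text \<open>Without misranking the lead never passes from an optimal to a suboptimal arm, so all
  leaders from \<open>s div 4\<close> to \<open>s\<close> are suboptimal. Each round that is not
  lossy gives \<open>l\<close> an observation and leaves the maximal count unchanged, so
  \<open>l\<close> would overtake the leader unless many rounds are lossy.\<close>

lemma suboptimal_leader: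
  assumes s: "v0 \<le> s div 4" and lead: "lead s \<in> sub" and l: "l \<in> opt"
    and no_close: "\<And>u. u \<in> {s div 4..s} \<Longrightarrow> \<not> close_at u"
  shows "real s / 4 \<le> real (card {u \<in> {s div 4..<s}. lossy_at l u})"
proof -
  define v where "v = s div 4"
  \<comment> \<open>Backward induction: an optimal leader in round \<open>u\<close> followed by a
    suboptimal one would be misranking.\<close>
  have lead_sub: "lead u \<in> sub" if "v \<le> u" "u \<le> s" for u
    using that(2,1)
  proof (induction u rule: inc_induct)
    case (step u)
    have u: "v \<le> u" "u < s" using step by auto
    then have "lead (Suc u) \<in> sub" "\<not> close_at (Suc u)"
      using step.IH no_close[of "Suc u"] by (auto simp: v_def)
    moreover have "v0 \<le> u" "2 \<le> u" using u s v0 by (auto simp: v_def)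
    ultimately show ?case
      using leader_change_close[of u] arm_cases[OF lead_arm[of u]] by blast
  qed (use lead in simp)
  define B where "B u = card {w \<in> {v..<u}. lossy_at l w}" for u
  have B_Suc: "B (Suc u) = B u + (if lossy_at l u then 1 else 0)" if "v \<le> u" for u
  proof -
    have "{w \<in> {v..<Suc u}. lossy_at l w}
        = (if lossy_at l u then insert u {w \<in> {v..<u}. lossy_at l w} else {w \<in> {v..<u}. lossy_at l w})"
      using that by (auto simp: less_Suc_eq)
    then show ?thesis unfolding B_def by simp
  qed
  \<comment> \<open>Invariant with \<open>B u\<close> lossy rounds so far. At \<open>u = s\<close>
    it bounds the count of \<open>l\<close> from both sides, so
    \<open>s \<le> 2 * v + 2 * B s\<close>; with \<open>v \<le> s / 4\<close> at least
    \<open>s / 4\<close> rounds were lossy.\<close>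
  have "u - v \<le> n u l + B u \<and> (\<forall>j\<in>{1..K}. n u j \<le> v + B u)" if "v \<le> u" "u \<le> s" for u
    using that
  proof (induction u rule: dec_induct)
    case base
    have "n v j \<le> v" for j using count_le[of v j] s v0 by (simp add: v_def)
    then show ?case by (auto intro: trans_le_add1)
  next
    case (step u)
    then have IH: "u - v \<le> n u l + B u" "\<And>j. j \<in> {1..K} \<Longrightarrow> n u j \<le> v + B u" and u: "v \<le> u" "u < s" by auto
    have u1: "1 \<le> u" and u2: "2 \<le> u" and uv: "v0 \<le> u" using u s v0 by (auto simp: v_def)
    have sub: "lead u \<in> sub" using lead_sub u by simp
    show ?case
    proof (cases "lossy_at l u")
      case True
      then show ?thesis using IH u1 u by (auto simp: B_Suc count_Suc) force+
    next
      case False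
      then have smp: "l \<in> sampled u" "lead u \<notin> sampled u"
        using optimal_arm_sampled[OF uv sub l] no_close[of u] u by (auto simp: v_def)
      have "n (Suc u) j \<le> v + B u" if j: "j \<in> {1..K}" for j
      proof (cases "j = lead u")
        case True
        then show ?thesis using smp IH(2)[OF j] u1 by (simp add: count_Suc)
      next
        case neq: False
        show ?thesis using count_Suc_le_lead[OF u2 j neq] IH(2)[OF lead_arm[OF u2]] by linarith
      qed
      then show ?thesis using IH smp u1 u False by (auto simp: B_Suc count_Suc)
    qed
  qed
  from this[of s] have "s - v \<le> n s l + B s" "n s l \<le> v + B s"
    using l split_arms by (auto simp: v_def)
  then have "s \<le> 2 * v + 2 * B s" by linarith
  moreover have "4 * v \<le> s" by (simp add: v_def)
  ultimately have "real s \<le> 4 * real (B s)" by linarith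
  then show ?thesis by (simp add: B_def v_def)
qed

text \<open>Under an optimal leader, arm \<open>k\<close> is sampled only while its count is below
  \<open>Z\<close>: from there on it is past the threshold, and a win by means would be a misranking
  at a size of at least \<open>D * ln r\<close>. The single condition
  \<open>\<not> close_at r\<close> excludes this in all rounds before \<open>r\<close>.\<close>

lemma suboptimal_count:
  assumes k: "k \<in> sub" and r: "s0 \<le> r" and s0: "2 \<le> s0" and close: "\<not> close_at r"
    and Z: "0 \<le> Z" "c (K * r) \<le> Z" "D * ln (real r) \<le> Z"
  shows "real (n r k) \<le> real s0 + Z + 1 + real (card {u \<in> {s0..<r}. lead u \<in> sub})"
proof -
  define B where "B s = card {u \<in> {s0..<s}. lead u \<in> sub}" for s
  have B_Suc: "B (Suc s) = B s + (if lead s \<in> sub then 1 else 0)" if "s0 \<le> s" for s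
  proof -
    have "{w \<in> {s0..<Suc s}. lead w \<in> sub} = (if lead s \<in> sub then insert s {w \<in> {s0..<s}. lead w \<in> sub} else {w \<in> {s0..<s}. lead w \<in> sub})"
      using that by (auto simp: less_Suc_eq)
    then show ?thesis unfolding B_def by simp
  qed
  have "real (n s k) \<le> real s0 + Z + 1 + real (B s)" if "s0 \<le> s" "s \<le> r" for s
    using that
  proof (induction s rule: dec_induct)
    case base
    have "n s0 k \<le> s0" using count_le[of s0 k] s0 by simp
    then show ?case using Z by simp
  next
    case (step s)
    have s2: "2 \<le> s" and s1: "1 \<le> s" using step s0 by auto
    have IH: "real (n s k) \<le> real s0 + Z + 1 + real (B s)" using step by simp
    consider "k \<notin> sampled s" | "lead s \<in> sub" | "k \<in> sampled s" "lead s \<in> opt"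
      using arm_cases[OF lead_arm[OF s2]] by blast
    then show ?case
    proof cases
      case 3
      then have "k \<noteq> lead s" using k split_arms by auto
      then have win: "challenger_wins K c y (n s) (lead s) k" using 3 s2 by (intro sampled_challenger)
      have kK: "k \<in> {1..K}" using k split_arms by auto
      have "real (n s k) < Z"
      proof (rule ccontr)
        assume "\<not> ?thesis"
        then have ge: "Z \<le> real (n s k)" by simp
        have "c (ssmc_total K c y \<tau> s) \<le> c (K * r)"
        proof (rule monoD[OF c_mono])
          have "K * s \<le> K * r" using step by (intro mult_le_mono2) simp
          with total_le[OF s1] show "ssmc_total K c y \<tau> s \<le> K * r" by (rule le_trans)
        qed
        then have "\<not> real (n s k) < c (\<Sum>j=1..K. n s j)" using ge Z by (simp add: ssmc_total_def)
        then obtain t where t: "t \<in> {1..n s (lead s) - n s k + 1}"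
          "block_mean y (lead s) t (t + n s k - 1) \<le> block_mean y k 1 (n s k)"
          using win by (auto simp: challenger_wins_def)
        have "n s (lead s) \<le> s - 1" "n s k \<le> s - 1" "1 \<le> n s k"
          using count_le[OF s1] count_pos[OF s2 kK] by auto
        then have "t \<le> r" "n s k \<le> r" "1 \<le> n s k" "1 \<le> t" using t step by auto
        then have "close_at r" using close_atI[OF 3(2) k, of "n s k" r t] t ge Z by simp
        with close show False by simp
      qed
      then show ?thesis using s1 step by (simp add: count_Suc B_Suc)
    qed (use IH s1 step in \<open>simp_all add: count_Suc B_Suc\<close>)
  qed
  from this[OF r] show ?thesis by (simp add: B_def)
qed

end

section \<open>Expected counts and regret\<close>

text \<open>Telescoping with \<open>ln (1 + x) \<ge> x - x\<^sup>2\<close> at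
  \<open>x = 1 / r\<close>; for \<open>r \<ge> 2\<close> the factor 2 absorbs the quadratic
  term.\<close>

lemma sum_inverse_le_ln:
  assumes "2 \<le> (s0::nat)" "s0 \<le> r"
  shows "(\<Sum>s\<in>{s0..<r}. 1 / real s) \<le> 2 * ln (real r)"
  using assms(2)
proof (induction r rule: dec_induct)
  case base
  then show ?case using assms(1) by simp
next
  case (step r)
  then have r: "2 \<le> real r" using assms by simp
  have "1 / real r \<le> 2 * (1 / real r - (1 / real r)\<^sup>2)" using r by (simp add: field_simps power2_eq_square)
  also have "\<dots> \<le> 2 * ln (1 + 1 / real r)"
    using r by (intro mult_left_mono ln_one_plus_pos_lower_bound) auto
  also have "1 + 1 / real r = real (Suc r) / real r" using r by (simp add: field_simps)
  also have "ln (real (Suc r) / real r) = ln (real (Suc r)) - ln (real r)" using r by (simp add: ln_div)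
  finally have "1 / real r \<le> 2 * (ln (real (Suc r)) - ln (real r))" .
  then show ?case using step by simp
qed

lemma divide_le_self_of_one_le: "0 \<le> x \<Longrightarrow> 1 \<le> z \<Longrightarrow> x / z \<le> (x::real)"
  using mult_left_mono[of 1 z x] by (simp add: divide_le_eq)

context bandit
begin

text \<open>The factor 2 absorbs \<open>ln K\<close> once \<open>r \<ge> K\<close>.\<close>

lemma eventually_c_le: "eventually (\<lambda>r. c (K * r) \<le> 2 * ln (real r)) sequentially"
proof -
  have "eventually (\<lambda>n. norm (c n) \<le> 1 * norm (ln (real n))) sequentially"
    using c_upper by (rule landau_o.smallD) simp
  moreover have "filterlim (\<lambda>r. K * r) sequentially sequentially"
    using K by (intro mult_nat_left_at_top) simp
  ultimately have "eventually (\<lambda>r. norm (c (K * r)) \<le> 1 * norm (ln (real (K * r)))) sequentially"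
    by (rule eventually_compose_filterlim)
  then show ?thesis using eventually_ge_at_top[of K]
  proof eventually_elim
    case (elim r)
    have "0 \<le> ln (real K)" using K by simp
    moreover have "ln (real K * real r) = ln (real K) + ln (real r)" using K elim by (intro ln_mult_pos) auto
    moreover have "ln (real K) \<le> ln (real r)" using K elim by simp
    ultimately show ?case using elim(1) by simp
  qed
qed

text \<open>The majorant is assembled from \<open>close\<close> and \<open>lossy\<close> alone. It
  is therefore integrable by construction, and one and the same \<open>V r\<close> serves every
  suboptimal arm and every way of resolving ties.\<close>

lemma pathwise_bound:
  "\<exists>V r0 C. 0 \<le> C \<and> (\<forall>r\<ge>r0. integrable M (V r) \<and> expectation (V r) \<le> C * ln (real r) \<and>
     (\<forall>\<tau> w k. w \<in> space M \<longrightarrow> k \<in> sub \<longrightarrow>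
        (\<forall>i\<ge>2. \<forall>A. A \<subseteq> {1..K} \<longrightarrow> A \<noteq> {} \<longrightarrow> \<tau> i A \<in> A) \<longrightarrow>
        real (ssmc_count K c (table w) \<tau> r k) \<le> V r w))"
proof -
  obtain D C1 where D: "0 < D" and C1: "0 \<le> C1" and close: "\<And>u. 1 \<le> u \<Longrightarrow> prob (close D u) \<le> C1 / real u ^ 3"
    using prob_close by blast
  obtain l where l: "l \<in> opt" using opt_nonempty by blast
  obtain C2 where C2: "0 \<le> C2" and lossy: "eventually (\<lambda>u. prob (lossy D l u) \<le> C2 / real u) sequentially"
    using prob_lossy[OF l D] by blast
  have "eventually (\<lambda>u. D * ln (real u) \<le> real u / real K) sequentially"
    using D K by real_asymp
  with lossy have "eventually (\<lambda>u. prob (lossy D l u) \<le> C2 / real u \<and> D * ln (real u) \<le> real u / real K) sequentially"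
    by (rule eventually_conj)
  then obtain v1 where v1: "\<And>u. v1 \<le> u \<Longrightarrow> prob (lossy D l u) \<le> C2 / real u"
     "\<And>u. v1 \<le> u \<Longrightarrow> D * ln (real u) \<le> real u / real K"
    by (auto simp: eventually_sequentially)
  define v0 where "v0 = max v1 2"
  \<comment> \<open>Guarantees \<open>v0 \<le> s div 4\<close> for \<open>s \<ge> s0\<close>, as
    \<open>suboptimal_leader\<close> requires.\<close>
  define s0 where "s0 = 4 * v0"
  have v0: "2 \<le> v0" "v1 \<le> v0" and s0: "2 \<le> s0" by (auto simp: v0_def s0_def)
  \<comment> \<open>At least 1 whenever the leader of round \<open>s\<close> is suboptimal. The
    factor \<open>4 / s\<close> is Markov's inequality for having at least \<open>s / 4\<close>
    lossy rounds.\<close>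
  define h where "h s w = (\<Sum>u\<in>{s div 4..s}. indicator (close D u) w) +
      4 / real s * (\<Sum>u\<in>{s div 4..<s}. indicator (lossy D l u) w)" for s :: nat and w
  \<comment> \<open>The last term covers misranking at \<open>r\<close> by the trivial bound
    \<open>r\<close> for a count.\<close>
  define V where "V r w = real s0 + (c (K * r) + D * ln (real r)) + 1 + (\<Sum>s\<in>{s0..<r}. h s w)
      + real r * indicator (close D r) w" for r :: nat and w
  have ind: "integrable M (indicator (close D u) :: 'w \<Rightarrow> real)" "integrable M (indicator (lossy D l u) :: 'w \<Rightarrow> real)" for u
    using sets_close sets_lossy[OF l] by (auto intro!: integrable_real_indicator simp: less_top[symmetric])
  have h_int: "integrable M (h s)" for s
    unfolding h_def by (intro Bochner_Integration.integrable_add integrable_mult_right Bochner_Integration.integrable_sum ind)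
  have V_int: "integrable M (V r)" for r
    unfolding V_def by (intro Bochner_Integration.integrable_add integrable_mult_right
        Bochner_Integration.integrable_sum ind h_int integrable_const)
  \<comment> \<open>From \<open>u \<ge> s div 4\<close> follows \<open>u \<ge> s / 8\<close>,
    rounding included. So 512 is the cube of 8, and 32 is 8 times the Markov factor 4.\<close>
  define C3 where "C3 = 512 * C1 + 32 * C2"
  have h_exp: "expectation (h s) \<le> C3 / real s" if s: "s0 \<le> s" for s
  proof -
    have s8: "8 \<le> s" and d: "v0 \<le> s div 4" using s v0 by (auto simp: s0_def)
    have sp: "0 < real s" using s8 by simp
    have u: "1 / real u \<le> 8 / real s" "v0 \<le> u" "1 \<le> u" if "s div 4 \<le> u" for u
    proof -
      show "v0 \<le> u" "1 \<le> u" using that d v0 by auto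
      have "s \<le> 8 * u" using that s8 by linarith
      then have "real s \<le> 8 * real u" by linarith
      then show "1 / real u \<le> 8 / real s" using sp \<open>1 \<le> u\<close> by (simp add: field_simps)
    qed
    have "expectation (h s) = (\<Sum>u\<in>{s div 4..s}. prob (close D u)) + 4 / real s * (\<Sum>u\<in>{s div 4..<s}. prob (lossy D l u))"
      unfolding h_def using ind sets_close sets_lossy[OF l]
      by (subst Bochner_Integration.integral_add)
        (auto simp: Bochner_Integration.integral_sum sets.Int_space_eq2 simp del: sum.op_ivl_Suc
          intro!: Bochner_Integration.integrable_sum integrable_mult_right)
    also have "\<dots> \<le> (\<Sum>u\<in>{s div 4..s}. 512 * C1 / real s ^ 3) + 4 / real s * (\<Sum>u\<in>{s div 4..<s}. 8 * C2 / real s)"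
    proof (intro add_mono mult_left_mono sum_mono)
      fix i assume "i \<in> {s div 4..s}"
      then have i: "s div 4 \<le> i" by simp
      have "prob (close D i) \<le> C1 / real i ^ 3" by (intro close u i)
      also have "\<dots> = C1 * (1 / real i) ^ 3" by (simp add: power_divide)
      also have "\<dots> \<le> C1 * (8 / real s) ^ 3" using u[OF i] C1 by (intro mult_left_mono power_mono) auto
      finally show "prob (close D i) \<le> 512 * C1 / real s ^ 3" by (simp add: power_divide mult.commute)
    next
      fix i assume "i \<in> {s div 4..<s}"
      then have i: "s div 4 \<le> i" by simp
      have "prob (lossy D l i) \<le> C2 / real i" using u[OF i] v0 by (intro v1) simp
      also have "\<dots> = C2 * (1 / real i)" by simp
      also have "\<dots> \<le> C2 * (8 / real s)" using u[OF i] C2 by (intro mult_left_mono) auto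
      finally show "prob (lossy D l i) \<le> 8 * C2 / real s" by (simp add: mult.commute)
    qed simp
    also have "\<dots> = real (card {s div 4..s}) * (512 * C1 / real s ^ 3) + 4 / real s * (real (card {s div 4..<s}) * (8 * C2 / real s))"
      by (simp only: sum_constant)
    also have "\<dots> \<le> real s * (512 * C1 / real s ^ 3) + 4 / real s * (real s * (8 * C2 / real s))"
      using s8 C1 C2 d v0 by (intro add_mono mult_right_mono mult_left_mono) (auto simp: of_nat_diff)
    also have "\<dots> \<le> 512 * C1 / real s + 32 * C2 / real s"
    proof (rule add_mono)
      have "real s * (512 * C1 / real s ^ 3) = (512 * C1 / real s) / real s"
        using sp by (simp add: field_simps power3_eq_cube)
      also have "\<dots> \<le> 512 * C1 / real s"
        using s8 C1 by (intro divide_le_self_of_one_le) auto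
      finally show "real s * (512 * C1 / real s ^ 3) \<le> 512 * C1 / real s" .
      show "4 / real s * (real s * (8 * C2 / real s)) \<le> 32 * C2 / real s" using sp by simp
    qed
    finally show ?thesis by (simp add: C3_def add_divide_distrib)
  qed
  define C where "C = real s0 + D + 3 + 2 * C3 + C1"
  have "0 \<le> C3" using C1 C2 by (simp add: C3_def)
  then have C: "0 \<le> C" using D C1 by (simp add: C_def)
  have "eventually (\<lambda>r::nat. 1 \<le> ln (real r)) sequentially" by real_asymp
  with eventually_c_le have "eventually (\<lambda>r. c (K * r) \<le> 2 * ln (real r) \<and> 1 \<le> ln (real r)) sequentially"
    by (rule eventually_conj)
  then obtain r1 where r1: "\<And>r. r1 \<le> r \<Longrightarrow> c (K * r) \<le> 2 * ln (real r)" "\<And>r. r1 \<le> r \<Longrightarrow> 1 \<le> ln (real r)"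
    by (auto simp: eventually_sequentially)
  show ?thesis
  proof (rule exI[of _ V], rule exI[of _ "max s0 r1"], rule exI[of _ C], rule conjI[OF C], rule allI, rule impI, intro conjI allI impI)
    fix r assume r: "max s0 r1 \<le> r"
    have rs: "s0 \<le> r" "r1 \<le> r" "1 \<le> r" "0 < real r" using r s0 by auto
    have L: "1 \<le> ln (real r)" using r1 rs by simp
    show "integrable M (V r)" by (rule V_int)
    have "expectation (V r) = real s0 + (c (K * r) + D * ln (real r)) + 1 + (\<Sum>s\<in>{s0..<r}. expectation (h s))
        + real r * prob (close D r)"
      unfolding V_def using ind h_int sets_close
      by (simp add: Bochner_Integration.integral_sum prob_space del: sum.op_ivl_Suc)
    also have "\<dots> \<le> real s0 * ln (real r) + (2 * ln (real r) + D * ln (real r)) + ln (real r) + 2 * C3 * ln (real r) + C1 * ln (real r)"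
    proof (intro add_mono)
      show "real s0 \<le> real s0 * ln (real r)" using L by (simp add: mult_le_cancel_left1)
      have "(\<Sum>s\<in>{s0..<r}. expectation (h s)) \<le> (\<Sum>s\<in>{s0..<r}. C3 / real s)"
        by (intro sum_mono h_exp) simp
      also have "\<dots> = C3 * (\<Sum>s\<in>{s0..<r}. 1 / real s)" by (simp add: sum_distrib_left)
      also have "\<dots> \<le> C3 * (2 * ln (real r))"
        by (intro mult_left_mono sum_inverse_le_ln s0 rs \<open>0 \<le> C3\<close>)
      finally show "(\<Sum>s\<in>{s0..<r}. expectation (h s)) \<le> 2 * C3 * ln (real r)" by simp
      have "real r * prob (close D r) \<le> real r * (C1 / real r ^ 3)" using rs by (intro mult_left_mono close) auto
      also have "\<dots> = C1 / (real r)\<^sup>2" using rs by (simp add: power2_eq_square power3_eq_cube)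
      also have "\<dots> \<le> C1" using rs C1 by (intro divide_le_self_of_one_le) auto
      also have "\<dots> \<le> C1 * ln (real r)" using C1 L by (simp add: mult_le_cancel_left1)
      finally show "real r * prob (close D r) \<le> C1 * ln (real r)" .
    qed (use r1 rs L in auto)
    also have "\<dots> = C * ln (real r)" by (simp add: C_def algebra_simps)
    finally show "expectation (V r) \<le> C * ln (real r)" .
    fix \<tau> :: "nat \<Rightarrow> nat set \<Rightarrow> nat" and w k
    assume w: "w \<in> space M" and k: "k \<in> sub"
      and draw: "\<forall>i\<ge>2. \<forall>A. A \<subseteq> {1..K} \<longrightarrow> A \<noteq> {} \<longrightarrow> \<tau> i A \<in> A"
    interpret R: ssmc_analysis K c "table w" \<tau> opt sub D v0
    proof
      show "opt \<union> sub = {1..K}" using optD subD arm_opt_or_sub by blast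
    qed (use K draw opt_sub_disjoint c_mono v0 v1 in auto)
    have close_iff: "R.close_at u \<longleftrightarrow> w \<in> close D u" for u
      using w by (auto simp: R.close_at_def close_def)
    have lossy_iff: "R.lossy_at l u \<longleftrightarrow> w \<in> lossy D l u" for u
      unfolding R.lossy_at_def lossy_def loss_def UN_iff mem_Collect_eq Bex_def
      by (simp only: w conj_assoc simp_thms)
    have h0: "0 \<le> h s w" for s unfolding h_def by (intro add_nonneg_nonneg mult_nonneg_nonneg sum_nonneg) auto
    have h1: "1 \<le> h s w" if s: "s0 \<le> s" and lead: "R.lead s \<in> sub" for s
    proof (cases "\<exists>u\<in>{s div 4..s}. R.close_at u")
      case True
      then obtain u where "u \<in> {s div 4..s}" "w \<in> close D u" using close_iff by auto
      then have "1 \<le> (\<Sum>u\<in>{s div 4..s}. indicator (close D u) w :: real)"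
        using member_le_sum[of u "{s div 4..s}" "\<lambda>u. indicator (close D u) w :: real"] by simp
      moreover have "0 \<le> 4 / real s * (\<Sum>u\<in>{s div 4..<s}. indicator (lossy D l u) w :: real)"
        by (intro mult_nonneg_nonneg sum_nonneg) auto
      ultimately show ?thesis unfolding h_def by linarith
    next
      case False
      have sp: "0 < real s" using s s0 by simp
      have "v0 \<le> s div 4" using s by (simp add: s0_def)
      then have "real s / 4 \<le> real (card {u \<in> {s div 4..<s}. R.lossy_at l u})"
        using False by (intro R.suboptimal_leader lead l) auto
      also have "\<dots> = (\<Sum>u\<in>{s div 4..<s}. indicator (lossy D l u) w)"
        unfolding lossy_iff by (simp add: indicator_def sum.If_cases Int_def del: sum.op_ivl_Suc)
      finally have "1 \<le> 4 / real s * (\<Sum>u\<in>{s div 4..<s}. indicator (lossy D l u) w)"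
        using sp by (simp add: field_simps)
      moreover have "0 \<le> (\<Sum>u\<in>{s div 4..s}. indicator (close D u) w :: real)" by (intro sum_nonneg) auto
      ultimately show ?thesis unfolding h_def by linarith
    qed
    have hs: "0 \<le> (\<Sum>s\<in>{s0..<r}. h s w)" by (intro sum_nonneg h0)
    have Z: "0 \<le> c (K * r)" "0 \<le> D * ln (real r)" using c_nonneg D L by auto
    show "real (ssmc_count K c (table w) \<tau> r k) \<le> V r w"
    proof (cases "R.close_at r")
      case True
      have "real (ssmc_count K c (table w) \<tau> r k) \<le> real r" using R.count_le[of r k] rs by simp
      also have "real r = real r * indicator (close D r) w" using True close_iff by simp
      also have "\<dots> \<le> V r w" unfolding V_def using hs Z by simp
      finally show ?thesis .
    next
      case False
      have "real (ssmc_count K c (table w) \<tau> r k)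
          \<le> real s0 + (c (K * r) + D * ln (real r)) + 1 + real (card {u \<in> {s0..<r}. R.lead u \<in> sub})"
        using Z by (intro R.suboptimal_count k rs s0 False) auto
      also have "real (card {u \<in> {s0..<r}. R.lead u \<in> sub}) = (\<Sum>u\<in>{u \<in> {s0..<r}. R.lead u \<in> sub}. 1)" by simp
      also have "\<dots> \<le> (\<Sum>u\<in>{u \<in> {s0..<r}. R.lead u \<in> sub}. h u w)" by (intro sum_mono h1) auto
      also have "\<dots> \<le> (\<Sum>s\<in>{s0..<r}. h s w)" by (intro sum_mono2 h0) auto
      finally show ?thesis unfolding V_def by (simp add: False close_iff[symmetric])
    qed
  qed
qed

end

theorem theorem3:
  fixes M :: "'w measure" and S :: "'x measure" and K :: nat
    and P :: "nat \<Rightarrow> 'x \<Rightarrow> 'x measure"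
    and \<nu> :: "real measure" and f :: "nat \<Rightarrow> 'x \<Rightarrow> real \<Rightarrow> real"
    and X :: "nat \<Rightarrow> nat \<Rightarrow> 'w \<Rightarrow> 'x" and Y :: "nat \<Rightarrow> nat \<Rightarrow> 'w \<Rightarrow> real"
    and \<mu> :: "nat \<Rightarrow> real" and c :: "nat \<Rightarrow> real"
    and tie :: "nat \<Rightarrow> nat set \<Rightarrow> 'w \<Rightarrow> nat"
    and sel :: "nat \<Rightarrow> nat set \<Rightarrow> nat \<Rightarrow> 'w \<Rightarrow> nat set"
  assumes M: "prob_space M"
    and K: "2 \<le> K"
    and nu: "sets \<nu> = sets borel"
    and chains: "\<And>k. k \<in> {1..K} \<Longrightarrow> markov_chain M S (P k) (X k)"
    and stationary: "\<And>k. k \<in> {1..K} \<Longrightarrow> stationary_process M S (X k)"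
    and rewards: "\<And>k. k \<in> {1..K} \<Longrightarrow> hidden_rewards M S \<nu> (f k) (X k) (Y k)"
    and means: "\<And>k t. k \<in> {1..K} \<Longrightarrow> 1 \<le> t \<Longrightarrow> has_bochner_integral M (Y k t) (\<mu> k)"
    and draws: "uniform_draws M K tie sel"
    and indep: "independent_sources M S K X Y tie sel"
    and c_nonneg: "\<And>n. 0 \<le> c n"
    and c_mono: "mono c"
    and c_upper: "c \<in> o(\<lambda>n. ln (real n))"
    and c_lower: "filterlim (\<lambda>n. c n / ln (ln (real n))) at_top sequentially"
    and C1: "\<And>k. k \<in> {1..K} \<Longrightarrow>
      \<exists>\<Lambda>. sets \<Lambda> = sets S \<and> emeasure \<Lambda> (space S) \<noteq> 0 \<and>
        (\<forall>x\<in>space S. \<forall>A\<in>sets S. emeasure \<Lambda> A \<le> emeasure (P k x) A)"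
    and C2: "\<And>\<epsilon>::real. 0 < \<epsilon> \<Longrightarrow>
      \<exists>b>0. \<exists>Q>0. \<forall>k\<in>{1..K}. \<forall>t\<ge>1.
        measure M {w \<in> space M. \<epsilon> \<le> \<bar>block_mean (\<lambda>j v. Y j v w) k 1 t - \<mu> k\<bar>}
          \<le> Q * exp (- (real t * b))"
    and C3: "\<And>k l. k \<in> {1..K} \<Longrightarrow> l \<in> {1..K} \<Longrightarrow>
      \<mu> k < best_mean K \<mu> \<Longrightarrow> \<mu> l = best_mean K \<mu> \<Longrightarrow>
      \<exists>b1>0. \<exists>Q1>0. \<exists>t1\<ge>1. \<forall>\<omega>\<le>\<mu> k. \<forall>t\<ge>t1.
        measure M {w \<in> space M. block_mean (\<lambda>j v. Y j v w) l 1 t < \<omega>}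
          \<le> Q1 * exp (- (real t * b1)) *
            measure M {w \<in> space M. block_mean (\<lambda>j v. Y j v w) k 1 t < \<omega>}"
  shows "(\<forall>k \<in> {1..K} - optimal_arms K \<mu>.
            (\<lambda>r. \<integral>w. real (round_count K c Y tie r k w) \<partial>M) \<in> O(\<lambda>r. ln (real r)))
         \<and> (\<lambda>N. regret M K \<mu> c Y tie sel N) \<in> O(\<lambda>N. ln (real N))"
proof -
  interpret prob_space M by (rule M)
  interpret bandit M S K P \<nu> f X Y \<mu> c
    by unfold_locales (rule K, rule nu, erule chains, erule rewards, erule stationary, erule C1,
        erule (1) means, rule c_nonneg, rule c_mono, rule c_upper, rule c_lower, erule C2, erule (3) C3)
  obtain V r0 C where VC: "0 \<le> C \<and> (\<forall>r\<ge>r0. integrable M (V r) \<and> expectation (V r) \<le> C * ln (real r) \<and>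
     (\<forall>\<tau> w k. w \<in> space M \<longrightarrow> k \<in> sub \<longrightarrow>
        (\<forall>i\<ge>2. \<forall>A. A \<subseteq> {1..K} \<longrightarrow> A \<noteq> {} \<longrightarrow> \<tau> i A \<in> A) \<longrightarrow>
        real (ssmc_count K c (table w) \<tau> r k) \<le> V r w))"
    using pathwise_bound by (elim exE)
  note C = conjunct1[OF VC]
  note bound = conjunct2[OF VC, THEN spec, THEN mp]
  have V: "integrable M (V r)" "expectation (V r) \<le> C * ln (real r)" if "r0 \<le> r" for r
    using bound[OF that] by simp_all
  have count: "real (ssmc_count K c (table w) \<tau> r k) \<le> V r w"
    if "r0 \<le> r" "w \<in> space M" "k \<in> sub"
      "\<And>i A. 2 \<le> i \<Longrightarrow> A \<subseteq> {1..K} \<Longrightarrow> A \<noteq> {} \<Longrightarrow> \<tau> i A \<in> A" for r \<tau> w k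
    using bound[OF that(1), THEN conjunct2, THEN conjunct2] that(2-4) by blast
  have tie: "tie i A w \<in> A" if "2 \<le> i" "A \<subseteq> {1..K}" "A \<noteq> {}" "w \<in> space M" for i A w
  proof -
    have "tie i A \<in> M \<rightarrow>\<^sub>M count_space A"
      using draws that(1,2,3) unfolding uniform_draws_def by blast
    from measurable_space[OF this that(4)] show ?thesis by simp
  qed
  have round: "real (round_count K c Y tie r k w) \<le> V r w"
    if "r0 \<le> r" "w \<in> space M" "k \<in> sub" for r k w
    unfolding round_count_def by (rule count[OF that(1,2,3)]) (rule tie[OF _ _ _ that(2)])
  have nonneg: "0 \<le> V r w" if "r0 \<le> r" "w \<in> space M" "k \<in> sub" for r k w
    using round[OF that] of_nat_0_le_iff order_trans by blast
  have horizon: "real (horizon_count K c Y tie sel N k w) \<le> V (Suc N) w + 1"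
    if "r0 \<le> N" "w \<in> space M" "k \<in> sub" for N k w
  proof -
    interpret R: ssmc_run K c "table w" "\<lambda>i A. tie i A w"
      using K tie that(2) by unfold_locales
    have "real (horizon_count K c Y tie sel N k w) \<le> real (round_count K c Y tie (Suc N) k w + 1)"
      unfolding horizon_count_def round_count_def by (intro of_nat_mono R.alloc_le)
    with round[of "Suc N" w k] that show ?thesis by simp
  qed
  have "(\<lambda>r. \<integral>w. real (round_count K c Y tie r k w) \<partial>M) \<in> O(\<lambda>r. ln (real r))" if k: "k \<in> sub" for k
  proof (rule bigoI[of _ C])
    show "eventually (\<lambda>r. norm (\<integral>w. real (round_count K c Y tie r k w) \<partial>M) \<le> C * norm (ln (real r))) sequentially"
      using eventually_ge_at_top[of "max r0 1"]
    proof eventually_elim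
      case (elim r)
      \<comment> \<open>\<open>integral_mono'\<close> asks for integrability and nonnegativity of
        the majorant only: a nonintegrable count would have integral 0 by convention.\<close>
      have "(\<integral>w. real (round_count K c Y tie r k w) \<partial>M) \<le> expectation (V r)"
        using elim k by (intro integral_mono' V round nonneg) auto
      also have "\<dots> \<le> C * ln (real r)" using elim by (intro V) simp
      finally show ?case using elim by simp
    qed
  qed
  moreover have "(\<lambda>N. \<integral>w. real (horizon_count K c Y tie sel N k w) \<partial>M) \<in> O(\<lambda>N. ln (real N))" if k: "k \<in> sub" for k
  proof (rule bigoI[of _ "2 * C + 1"])
    show "eventually (\<lambda>N. norm (\<integral>w. real (horizon_count K c Y tie sel N k w) \<partial>M)
        \<le> (2 * C + 1) * norm (ln (real N))) sequentially"
    proof -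
      have "eventually (\<lambda>N::nat. 1 \<le> ln (real N)) sequentially" by real_asymp
      moreover have "eventually (\<lambda>N::nat. ln (real (Suc N)) \<le> 2 * ln (real N)) sequentially" by real_asymp
      ultimately show ?thesis using eventually_ge_at_top[of r0]
      proof eventually_elim
        case (elim N)
        have "(\<integral>w. real (horizon_count K c Y tie sel N k w) \<partial>M) \<le> expectation (\<lambda>w. V (Suc N) w + 1)"
          using elim k nonneg[of "Suc N" _ k]
          by (intro integral_mono' horizon Bochner_Integration.integrable_add V integrable_const add_nonneg_nonneg) auto
        also have "\<dots> = expectation (V (Suc N)) + 1"
          using V(1)[of "Suc N"] elim by (simp add: prob_space)
        also have "\<dots> \<le> C * ln (real (Suc N)) + 1" using V(2)[of "Suc N"] elim by simp
        also have "\<dots> \<le> C * (2 * ln (real N)) + 1 * ln (real N)"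
          using elim C by (intro add_mono mult_left_mono) auto
        also have "\<dots> = (2 * C + 1) * ln (real N)" by (simp add: algebra_simps)
        finally show ?case using elim(1) by simp
      qed
    qed
  qed
  then have "(\<lambda>N. regret M K \<mu> c Y tie sel N) \<in> O(\<lambda>N. ln (real N))"
    unfolding regret_def
  proof (intro big_sum_in_bigo)
    fix k assume "k \<in> {k \<in> {1..K}. \<mu> k < best_mean K \<mu>}"
    then have "k \<in> sub" by (auto simp: sub_def optimal_arms_def)
    then show "(\<lambda>N. (best_mean K \<mu> - \<mu> k) * (\<integral>w. real (horizon_count K c Y tie sel N k w) \<partial>M)) \<in> O(\<lambda>N. ln (real N))"
      using \<open>\<And>k. k \<in> sub \<Longrightarrow> (\<lambda>N. \<integral>w. real (horizon_count K c Y tie sel N k w) \<partial>M) \<in> O(\<lambda>N. ln (real N))\<close>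
      by simp
  qed
  ultimately show ?thesis by (simp add: sub_def)
qed

end
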